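(* Let $\mu,\nu$ be partitions, and let $\mathbf p=(p_1,p_2,\dots)$, $\mathbf p'=(p_1',p_2',\dots)$ be two sets of indeterminates. Then, with sums over all partitions $\lambda$, $$\sum_{\lambda}s_{\lambda/\mu}(\mathbf p\,\|\,\boldsymbol\alpha;\boldsymbol\beta)\,\widehat s_{\lambda/\nu}(\mathbf p'\,\|\,\boldsymbol\alpha;\boldsymbol\beta)=e^{\xi(\mathbf p;\mathbf p')}\sum_{\lambda}\widehat s_{\mu/\lambda}(\mathbf p'\,\|\,\boldsymbol\alpha;\boldsymbol\beta)\,s_{\nu/\lambda}(\mathbf p\,\|\,\boldsymbol\alpha;\boldsymbol\beta),$$ $$\sum_{\lambda}s_{\lambda/\mu}(\mathbf p\,\|\,\boldsymbol\alpha;\boldsymbol\beta)\,\widehat s_{\lambda/\nu}(-\mathbf p'\,\|\,\boldsymbol\alpha;\boldsymbol\beta)=e^{-\xi(\mathbf p;\mathbf p')}\sum_{\lambda}\widehat s_{\mu/\lambda}(-\mathbf p'\,\|\,\boldsymbol\alpha;\boldsymbol\beta)\,s_{\nu/\lambda}(\mathbf p\,\|\,\boldsymbol\alpha;\boldsymbol\beta).$$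
   Context: $\boldsymbol\alpha=(\alpha_i)_{i\in\mathbb Z}$, $\boldsymbol\beta=(\beta_i)_{i\in\mathbb Z}$ are sequences in $\mathbb C$. For $k\in\mathbb Z$, $(z;\boldsymbol\alpha)^k=\prod_{i=1}^k(1-z\alpha_i)$ if $k\ge 0$ and $\prod_{i=k+1}^{0}(1-z\alpha_i)^{-1}$ if $k<0$; $(z|\boldsymbol\beta)^k=\prod_{i=1}^k(z-\beta_i)$ if $k\ge0$ and $\prod_{i=k+1}^0(z-\beta_i)^{-1}$ if $k<0$. The Clifford algebra is generated by $\psi_i,\psi_i^*$ ($i\in\mathbb Z$) with $[\psi_i,\psi_j]_+=[\psi_i^*,\psi_j^*]_+=0$, $[\psi_i,\psi_j^*]_+=\delta_{ij}$. The charge $0$ Fock space has basis $|\lambda\rangle=v_{\lambda_1}\wedge v_{\lambda_2-1}\wedge v_{\lambda_3-2}\wedge\cdots$ over partitions; $\psi_j$ acts by $v_j\wedge$, $\psi_j^*$ by contraction against $v_j$; $\langle\lambda|$ is the dual basis. Normal ordering: $:\!\psi_i\psi_j^*\!:\,=\psi_i\psi_j^*$ if $i>0$, $=-\psi_j^*\psi_i$ if $i\le0$. Deformed fields: $\psi(z|\boldsymbol\alpha;\boldsymbol\beta)=\sum_i z\frac{(z|\boldsymbol\beta)^{i-1}}{(z;\boldsymbol\alpha)^i}\psi_i$, $\psi^*(w|\boldsymbol\alpha;\boldsymbol\beta)=\sum_j(1-\alpha_j\beta_j)\frac{(w;\boldsymbol\alpha)^{j-1}}{(w|\boldsymbol\beta)^j}\psi_j^*$.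 Deformed currents: $:\!\psi(z|\boldsymbol\alpha;\boldsymbol\beta)\psi^*(z|\boldsymbol\alpha;\boldsymbol\beta)\!:\,=\sum_kJ_k^{(\boldsymbol\alpha;\boldsymbol\beta)}z^{-k}$ (expanded for $|\beta_a|<|z|<|\alpha_b^{-1}|$, all $a,b$). Hamiltonians: $H_\pm(\mathbf p|\boldsymbol\alpha;\boldsymbol\beta)=\sum_{k\ge1}\frac{p_k}{k}J_{\pm k}^{(\boldsymbol\alpha;\boldsymbol\beta)}$. Explicitly $J_k^{(\boldsymbol\alpha;\boldsymbol\beta)}=\sum_{i,j}A_{ij}^k:\!\psi_i\psi_j^*\!:$ where for $k>0$, $i\ne j$: $A_{ij}^k=(1-\alpha_j\beta_j)\sum_{r-s=j-i-k}e_r(-\alpha_{i+1},\dots,-\alpha_{j-1})h_s(\beta_i,\dots,\beta_j)$ (zero if $j<i$), $A_{ij}^{-k}=(1-\alpha_j\beta_j)\sum_{r-s=j-i+k}h_r(\alpha_j,\dots,\alpha_i)e_s(-\beta_{j+1},\dots,-\beta_{i-1})$ (zero if $j>i$), $A_{ii}^k=\beta_i^k$, $A_{ii}^{-k}=\alpha_i^k$. Definitions: $s_{\lambda/\mu}(\mathbf p\,\|\,\boldsymbol\alpha;\boldsymbol\beta)=\langle\mu|e^{H_+(\mathbf p|\boldsymbol\alpha;\boldsymbol\beta)}|\lambda\rangle$ and $\widehat s_{\lambda/\mu}(\mathbf p\,\|\,\boldsymbol\alpha;\boldsymbol\beta)=\langle\lambda|e^{H_-(\mathbf p|\boldsymbol\alpha;\boldsymbol\beta)}|\mu\rangle$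 for all partitions $\lambda,\mu$; both vanish unless $\mu\subseteq\lambda$. $-\mathbf p=(-p_1,-p_2,\dots)$ and $\xi(\mathbf p;\mathbf p')=\sum_{k\ge1}\frac1kp_kp_k'$. Standing assumption: the formulas $\langle\varnothing|\psi(z|\boldsymbol\alpha;\boldsymbol\beta)\psi^*(w|\boldsymbol\alpha;\boldsymbol\beta)|\varnothing\rangle=\frac z{z-w}$ (expanded in $w/z$) and $\langle\varnothing|\psi^*(w|\boldsymbol\alpha;\boldsymbol\beta)\psi(z|\boldsymbol\alpha;\boldsymbol\beta)|\varnothing\rangle=\frac z{w-z}$ (expanded in $z/w$) are valid, and the infinite sums arising in products of operators are taken to converge accordingly. *)

theory Defs
  imports
    "HOL-Analysis.Infinite_Sum"
    "HOL-Library.Multiset"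
    "HOL-Computational_Algebra.Formal_Laurent_Series"
begin

section \<open>Formal power series in arbitrarily many indeterminates\<close>

text \<open>A monomial in indeterminates indexed by \<open>'v\<close> is a finite multiset over \<open>'v\<close>; a formal power
  series over the complex numbers is an arbitrary function from monomials to coefficients.\<close>

typedef 'v pser = "UNIV :: ('v multiset \<Rightarrow> complex) set"
  morphisms pcoeff Pser by simp

lemma pser_eqI: "(\<And>M. pcoeff f M = pcoeff g M) \<Longrightarrow> f = g"
  by (metis ext pcoeff_inject)

lemma pcoeff_Pser [simp]: "pcoeff (Pser c) M = c M"
  by (simp add: Pser_inverse)

definition pconst :: "complex \<Rightarrow> 'v pser"
  where "pconst c = Pser (\<lambda>M. if M = {#} then c else 0)"

definition pvar :: "'v \<Rightarrow> 'v pser"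
  where "pvar v = Pser (\<lambda>M. if M = {#v#} then 1 else 0)"

lemma finite_submultisets: "finite {A. A \<subseteq># M}"
proof (rule finite_subset)
  show "{A. A \<subseteq># M} \<subseteq> (\<Union>n\<le>size M. multisets_of_size (set_mset M) n)"
    by (auto simp: multisets_of_size_def size_mset_mono mset_subset_eqD)
  show "finite (\<Union>n\<le>size M. multisets_of_size (set_mset M) n)"
    by (auto intro: finite_multisets_of_size)
qed

instantiation pser :: (type) comm_ring_1
begin

definition "0 = Pser (\<lambda>M. 0)"
definition "1 = pconst 1"
definition "f + g = Pser (\<lambda>M. pcoeff f M + pcoeff g M)"
definition "- f = Pser (\<lambda>M. - pcoeff f M)"
definition "f - g = Pser (\<lambda>M. pcoeff f M - pcoeff g M)"
definition "f * g = Pser (\<lambda>M. \<Sum>A | A \<subseteq># M. pcoeff f A * pcoeff g (M - A))"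

instance
proof
  fix f g h :: "'a pser"
  show "f * g * h = f * (g * h)"
  proof (rule pser_eqI)
    fix M
    have "pcoeff (f * g * h) M =
        (\<Sum>A | A \<subseteq># M. \<Sum>B | B \<subseteq># A. pcoeff f B * pcoeff g (A - B) * pcoeff h (M - A))"
      by (simp add: times_pser_def sum_distrib_right)
    also have "\<dots> = (\<Sum>(A, B) \<in> (SIGMA A:{A. A \<subseteq># M}. {B. B \<subseteq># A}).
        pcoeff f B * pcoeff g (A - B) * pcoeff h (M - A))"
      by (rule sum.Sigma) (auto simp: finite_submultisets)
    also have "\<dots> = (\<Sum>(B, C) \<in> (SIGMA B:{B. B \<subseteq># M}. {C. C \<subseteq># M - B}).
        pcoeff f B * pcoeff g C * pcoeff h (M - B - C))"
      by (rule sum.reindex_bij_witness[of _ "\<lambda>(B, C). (B + C, B)" "\<lambda>(A, B). (B, A - B)"])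
        (auto simp: subset_mset.le_diff_conv2 add.commute subset_mset.add_diff_inverse
           intro: subset_mset.order_trans)
    also have "\<dots> = (\<Sum>B | B \<subseteq># M. \<Sum>C | C \<subseteq># M - B. pcoeff f B * pcoeff g C * pcoeff h (M - B - C))"
      by (rule sum.Sigma[symmetric]) (auto simp: finite_submultisets)
    also have "\<dots> = pcoeff (f * (g * h)) M"
      by (simp add: times_pser_def sum_distrib_left mult.assoc)
    finally show "pcoeff (f * g * h) M = pcoeff (f * (g * h)) M" .
  qed
  show "f * g = g * f"
  proof (rule pser_eqI)
    fix M
    show "pcoeff (f * g) M = pcoeff (g * f) M"
      unfolding times_pser_def pcoeff_Pser
      by (rule sum.reindex_bij_witness[of _ "\<lambda>A. M - A" "\<lambda>A. M - A"])
        (auto simp: mult.commute subset_mset.diff_diff_right)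
  qed
  show "1 * f = f"
  proof (rule pser_eqI)
    fix M
    have "pcoeff (1 * f) M = (\<Sum>A | A \<subseteq># M. if A = {#} then pcoeff f M else 0)"
      unfolding times_pser_def one_pser_def pconst_def pcoeff_Pser by (rule sum.cong) auto
    also have "\<dots> = pcoeff f M"
      by (simp add: sum.delta finite_submultisets)
    finally show "pcoeff (1 * f) M = pcoeff f M" .
  qed
  show "(f + g) * h = f * h + g * h"
    by (rule pser_eqI) (simp add: times_pser_def plus_pser_def distrib_right sum.distrib)
  show "(0 :: 'a pser) \<noteq> 1"
    by (metis (mono_tags) one_pser_def pcoeff_Pser pconst_def zero_neq_one zero_pser_def)
qed (rule pser_eqI; simp add: plus_pser_def zero_pser_def uminus_pser_def minus_pser_def)+

end

text \<open>Infinite sums of power series are taken coefficient by coefficient.\<close>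

definition psummable :: "('i \<Rightarrow> 'v pser) \<Rightarrow> 'i set \<Rightarrow> bool"
  where "psummable f I \<longleftrightarrow> (\<forall>M. (\<lambda>i. pcoeff (f i) M) summable_on I)"

definition pinfsum :: "('i \<Rightarrow> 'v pser) \<Rightarrow> 'i set \<Rightarrow> 'v pser"
  where "pinfsum f I = Pser (\<lambda>M. \<Sum>\<^sub>\<infinity>i\<in>I. pcoeff (f i) M)"

definition pexp :: "'v pser \<Rightarrow> 'v pser"
  where "pexp x = pinfsum (\<lambda>n::nat. pconst (1 / fact n) * x ^ n) UNIV"

section \<open>Partitions and Fock space\<close>

text \<open>Parts are indexed from \<open>0\<close>: the parts \<open>\<lambda>\<^sub>1 \<ge> \<lambda>\<^sub>2 \<ge> \<dots>\<close> are \<open>lam 0 \<ge> lam 1 \<ge> \<dots>\<close>.\<close>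

definition partitions :: "(nat \<Rightarrow> nat) set"
  where "partitions = {lam. antimono lam \<and> finite {i. lam i \<noteq> 0}}"

abbreviation empty_partition :: "nat \<Rightarrow> nat"
  where "empty_partition \<equiv> (\<lambda>_. 0)"

text \<open>The semi-infinite wedge with decreasing factors \<open>v\<^sub>s\<close>, \<open>s \<in> S\<close>, is identified with the set
  \<open>S\<close> (which has finitely many positive elements and contains almost all nonpositive integers).
  A possibly infinite linear combination of wedges is given by its coefficients; \<open>|\<lambda>\<rangle>\<close> is the
  wedge with factors \<open>\<lambda>\<^sub>i - i + 1\<close>, \<open>i \<ge> 1\<close>.\<close>

type_synonym fock = "int set \<Rightarrow> complex"

definition maya :: "(nat \<Rightarrow> nat) \<Rightarrow> int set"
  where "maya lam = range (\<lambda>i. int (lam i) - int i)"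

definition ket :: "(nat \<Rightarrow> nat) \<Rightarrow> fock"
  where "ket lam = (\<lambda>S. if S = maya lam then 1 else 0)"

text \<open>\<open>psi j\<close> is \<open>v\<^sub>j \<wedge> _\<close> and \<open>psi_star j\<close> is the contraction against \<open>v\<^sub>j\<close>; the sign comes from
  moving \<open>v\<^sub>j\<close> past the factors \<open>v\<^sub>s\<close> with \<open>s > j\<close>.\<close>

definition psi :: "int \<Rightarrow> fock \<Rightarrow> fock"
  where "psi j f = (\<lambda>S. if j \<in> S then (-1) ^ card {s \<in> S. j < s} * f (S - {j}) else 0)"

definition psi_star :: "int \<Rightarrow> fock \<Rightarrow> fock"
  where "psi_star j f = (\<lambda>S. if j \<notin> S then (-1) ^ card {s \<in> S. j < s} * f (insert j S) else 0)"

definition normal_ordered :: "int \<Rightarrow> int \<Rightarrow> fock \<Rightarrow> fock"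
  where "normal_ordered i j =
    (if i > 0 then psi i \<circ> psi_star j else (\<lambda>f S. - psi_star j (psi i f) S))"

text \<open>\<open>mel mu X lam\<close> is the matrix element \<open>\<langle>\<mu>|X|\<lambda>\<rangle>\<close>.\<close>

definition mel :: "(nat \<Rightarrow> nat) \<Rightarrow> (fock \<Rightarrow> fock) \<Rightarrow> (nat \<Rightarrow> nat) \<Rightarrow> complex"
  where "mel mu X lam = X (ket lam) (maya mu)"

section \<open>Deformed fields\<close>

text \<open>\<open>(z;\<alpha>)\<^sup>k\<close> and \<open>(z|\<beta>)\<^sup>k\<close>, over any field so that \<open>z\<close> may be a formal Laurent series.\<close>

definition semi_pow :: "'a::field \<Rightarrow> (int \<Rightarrow> 'a) \<Rightarrow> int \<Rightarrow> 'a"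
  where "semi_pow z \<alpha> k =
    (if k \<ge> 0 then (\<Prod>i=1..k. 1 - z * \<alpha> i) else (\<Prod>i=k+1..0. inverse (1 - z * \<alpha> i)))"

definition bar_pow :: "'a::field \<Rightarrow> (int \<Rightarrow> 'a) \<Rightarrow> int \<Rightarrow> 'a"
  where "bar_pow z \<beta> k =
    (if k \<ge> 0 then (\<Prod>i=1..k. z - \<beta> i) else (\<Prod>i=k+1..0. inverse (z - \<beta> i)))"

definition psi_fun :: "(int \<Rightarrow> 'a::field) \<Rightarrow> (int \<Rightarrow> 'a) \<Rightarrow> int \<Rightarrow> 'a \<Rightarrow> 'a"
  where "psi_fun \<alpha> \<beta> i z = z * bar_pow z \<beta> (i - 1) / semi_pow z \<alpha> i"

definition psi_star_fun :: "(int \<Rightarrow> 'a::field) \<Rightarrow> (int \<Rightarrow> 'a) \<Rightarrow> int \<Rightarrow> 'a \<Rightarrow> 'a"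
  where "psi_star_fun \<alpha> \<beta> j w =
    (1 - \<alpha> j * \<beta> j) * semi_pow w \<alpha> (j - 1) / bar_pow w \<beta> j"

text \<open>Coefficient of \<open>z\<^sup>m\<close> in the expansion of the coefficient of \<open>\<psi>\<^sub>i\<close> (resp. \<open>\<psi>\<^sub>i\<^sup>*\<close>) of the deformed
  field for \<open>|\<beta>\<^sub>a| < |z| < |\<alpha>\<^sub>b\<^sup>-\<^sup>1|\<close>. Up to polynomial factors, each of these rational functions has
  either only factors \<open>1 - z \<alpha>\<^sub>b\<close> in the denominator, and is expanded in \<open>z\<close>, or only factors
  \<open>z - \<beta>\<^sub>a\<close>, and is expanded in \<open>z\<^sup>-\<^sup>1\<close>: put \<open>z = X\<close> or \<open>z = X\<^sup>-\<^sup>1\<close> in the field of Laurent series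
  in \<open>X\<close>.\<close>

definition psi_coeff :: "(int \<Rightarrow> complex) \<Rightarrow> (int \<Rightarrow> complex) \<Rightarrow> int \<Rightarrow> int \<Rightarrow> complex"
  where "psi_coeff \<alpha> \<beta> i m =
    (if i > 0 then fls_nth (psi_fun (fls_const \<circ> \<alpha>) (fls_const \<circ> \<beta>) i fls_X) m
     else fls_nth (psi_fun (fls_const \<circ> \<alpha>) (fls_const \<circ> \<beta>) i (inverse fls_X)) (- m))"

definition psi_star_coeff :: "(int \<Rightarrow> complex) \<Rightarrow> (int \<Rightarrow> complex) \<Rightarrow> int \<Rightarrow> int \<Rightarrow> complex"
  where "psi_star_coeff \<alpha> \<beta> j n =
    (if j > 0 then fls_nth (psi_star_fun (fls_const \<circ> \<alpha>) (fls_const \<circ> \<beta>) j (inverse fls_X)) (- n)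
     else fls_nth (psi_star_fun (fls_const \<circ> \<alpha>) (fls_const \<circ> \<beta>) j fls_X) n)"

text \<open>The two-point formulas, compared at each \<open>z\<^sup>m w\<^sup>n\<close>:
  \<open>z/(z-w) = \<Sum>\<^sub>n\<^sub>\<ge>\<^sub>0 (w/z)\<^sup>n\<close> and \<open>z/(w-z) = \<Sum>\<^sub>m\<^sub>\<ge>\<^sub>1 (z/w)\<^sup>m\<close>.\<close>

definition vacuum_formulas :: "(int \<Rightarrow> complex) \<Rightarrow> (int \<Rightarrow> complex) \<Rightarrow> bool"
  where "vacuum_formulas \<alpha> \<beta> \<longleftrightarrow>
    (\<forall>m n. ((\<lambda>(i, j). psi_coeff \<alpha> \<beta> i m * psi_star_coeff \<alpha> \<beta> j n *
                mel empty_partition (psi i \<circ> psi_star j) empty_partition)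
              has_sum (if n \<ge> 0 \<and> m = - n then 1 else 0)) UNIV) \<and>
    (\<forall>m n. ((\<lambda>(i, j). psi_coeff \<alpha> \<beta> i m * psi_star_coeff \<alpha> \<beta> j n *
                mel empty_partition (psi_star j \<circ> psi i) empty_partition)
              has_sum (if m \<ge> 1 \<and> n = - m then 1 else 0)) UNIV)"

section \<open>Deformed currents\<close>

text \<open>Elementary and complete homogeneous symmetric polynomials in the \<open>x i\<close>, \<open>i \<in> I\<close>.\<close>

definition esym :: "nat \<Rightarrow> int set \<Rightarrow> (int \<Rightarrow> complex) \<Rightarrow> complex"
  where "esym r I x = (\<Sum>S | S \<subseteq> I \<and> card S = r. \<Prod>i\<in>S. x i)"

definition hsym :: "nat \<Rightarrow> int set \<Rightarrow> (int \<Rightarrow> complex) \<Rightarrow> complex"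
  where "hsym r I x = (\<Sum>M\<in>multisets_of_size I r. \<Prod>i\<in>#M. x i)"

text \<open>\<open>A\<^sub>i\<^sub>j\<^sup>k\<close> for \<open>k \<noteq> 0\<close>. The bounds on \<open>r\<close> and \<open>s\<close> are the numbers of variables of the elementary
  symmetric polynomials, which vanish beyond; they make the index sets finite.\<close>

definition current_coeff ::
    "(int \<Rightarrow> complex) \<Rightarrow> (int \<Rightarrow> complex) \<Rightarrow> int \<Rightarrow> int \<Rightarrow> int \<Rightarrow> complex"
  where "current_coeff \<alpha> \<beta> k i j =
    (if k > 0 then
       (if i = j then \<beta> i ^ nat k
        else if i < j then (1 - \<alpha> j * \<beta> j) *
          (\<Sum>(r, s) | int r - int s = j - i - k \<and> int r \<le> j - i - 1.
             esym r {i+1..j-1} (\<lambda>a. - \<alpha> a) * hsym s {i..j} \<beta>)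
        else 0)
     else
       (if i = j then \<alpha> i ^ nat (- k)
        else if j < i then (1 - \<alpha> j * \<beta> j) *
          (\<Sum>(r, s) | int r - int s = j - i - k \<and> int s \<le> i - j - 1.
             hsym r {j..i} \<alpha> * esym s {j+1..i-1} (\<lambda>a. - \<beta> a))
        else 0))"

text \<open>\<open>\<langle>\<mu>|J\<^sub>k|\<lambda>\<rangle>\<close>; only finitely many terms are nonzero.\<close>

definition current ::
    "(int \<Rightarrow> complex) \<Rightarrow> (int \<Rightarrow> complex) \<Rightarrow> int \<Rightarrow> (nat \<Rightarrow> nat) \<Rightarrow> (nat \<Rightarrow> nat) \<Rightarrow> complex"
  where "current \<alpha> \<beta> k mu lam =
    (\<Sum>\<^sub>\<infinity>(i, j)\<in>UNIV. current_coeff \<alpha> \<beta> k i j * mel mu (normal_ordered i j) lam)"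

text \<open>The product of currents \<open>J\<^sub>k\<close>, \<open>k\<close> running through the list \<open>ks\<close>, has the matrix element
  \<open>\<langle>\<mu>|_|\<nu>\<rangle>\<close> obtained by summing the following products over all lists \<open>kappas\<close> of intermediate
  partitions. Such sums can be infinite when raising currents stand to the right of lowering ones,
  as they do in the expansion of \<open>exp(H\<^sub>+) exp(H\<^sub>-)\<close>; they are required to converge
  unconditionally.\<close>

definition path_weight ::
    "(int \<Rightarrow> complex) \<Rightarrow> (int \<Rightarrow> complex) \<Rightarrow> int list \<Rightarrow> (nat \<Rightarrow> nat) \<Rightarrow> (nat \<Rightarrow> nat) list \<Rightarrow>
      (nat \<Rightarrow> nat) \<Rightarrow> complex"
  where "path_weight \<alpha> \<beta> ks mu kappas nu =
    (\<Prod>t<length ks. current \<alpha> \<beta> (ks ! t) ((mu # kappas @ [nu]) ! t) ((mu # kappas @ [nu]) ! Suc t))"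

definition current_products_converge :: "(int \<Rightarrow> complex) \<Rightarrow> (int \<Rightarrow> complex) \<Rightarrow> bool"
  where "current_products_converge \<alpha> \<beta> \<longleftrightarrow>
    (\<forall>ks ls. \<forall>mu\<in>partitions. \<forall>nu\<in>partitions.
       (\<forall>k\<in>set ks. k > 0) \<and> (\<forall>l\<in>set ls. l < 0) \<longrightarrow>
       (\<lambda>kappas. path_weight \<alpha> \<beta> (ks @ ls) mu kappas nu) summable_on
         {kappas. set kappas \<subseteq> partitions \<and> Suc (length kappas) = length (ks @ ls)})"

section \<open>Hamiltonians and deformed Schur functions\<close>

text \<open>Operators with power series matrix elements are given by these elements, rows first.\<close>

type_synonym 'v op = "(nat \<Rightarrow> nat) \<Rightarrow> (nat \<Rightarrow> nat) \<Rightarrow> 'v pser"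

fun op_power :: "'v op \<Rightarrow> nat \<Rightarrow> 'v op" where
  "op_power H 0 mu lam = (if mu = lam then 1 else 0)"
| "op_power H (Suc n) mu lam = pinfsum (\<lambda>kappa. H mu kappa * op_power H n kappa lam) partitions"

definition op_exp :: "'v op \<Rightarrow> 'v op"
  where "op_exp H mu lam = pinfsum (\<lambda>n. pconst (1 / fact n) * op_power H n mu lam) UNIV"

definition ham_plus :: "(int \<Rightarrow> complex) \<Rightarrow> (int \<Rightarrow> complex) \<Rightarrow> (nat \<Rightarrow> 'v pser) \<Rightarrow> 'v op"
  where "ham_plus \<alpha> \<beta> p mu lam =
    pinfsum (\<lambda>k. pconst (current \<alpha> \<beta> (int k) mu lam / of_nat k) * p k) {1..}"

definition ham_minus :: "(int \<Rightarrow> complex) \<Rightarrow> (int \<Rightarrow> complex) \<Rightarrow> (nat \<Rightarrow> 'v pser) \<Rightarrow> 'v op"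
  where "ham_minus \<alpha> \<beta> p mu lam =
    pinfsum (\<lambda>k. pconst (current \<alpha> \<beta> (- int k) mu lam / of_nat k) * p k) {1..}"

text \<open>\<open>schur \<alpha> \<beta> lam mu p\<close> and \<open>schur_hat \<alpha> \<beta> lam mu p\<close> are \<open>s\<close> and \<open>s\<close>-hat of skew shape
  \<open>lam / mu\<close>.\<close>

definition schur ::
    "(int \<Rightarrow> complex) \<Rightarrow> (int \<Rightarrow> complex) \<Rightarrow> (nat \<Rightarrow> nat) \<Rightarrow> (nat \<Rightarrow> nat) \<Rightarrow> (nat \<Rightarrow> 'v pser) \<Rightarrow> 'v pser"
  where "schur \<alpha> \<beta> lam mu p = op_exp (ham_plus \<alpha> \<beta> p) mu lam"

definition schur_hat ::
    "(int \<Rightarrow> complex) \<Rightarrow> (int \<Rightarrow> complex) \<Rightarrow> (nat \<Rightarrow> nat) \<Rightarrow> (nat \<Rightarrow> nat) \<Rightarrow> (nat \<Rightarrow> 'v pser) \<Rightarrow> 'v pser"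
  where "schur_hat \<alpha> \<beta> lam mu p = op_exp (ham_minus \<alpha> \<beta> p) lam mu"

definition xi :: "(nat \<Rightarrow> 'v pser) \<Rightarrow> (nat \<Rightarrow> 'v pser) \<Rightarrow> 'v pser"
  where "xi p p' = pinfsum (\<lambda>k. pconst (1 / of_nat k) * p k * p' k) {1..}"

text \<open>The two independent sets of indeterminates (index \<open>0\<close> is never used).\<close>

definition P :: "nat \<Rightarrow> (nat + nat) pser"
  where "P k = pvar (Inl k)"

definition P' :: "nat \<Rightarrow> (nat + nat) pser"
  where "P' k = pvar (Inr k)"

end

theory Submission
  imports Defs
begin

text \<open>Write \<open>H\<close> and \<open>K\<close> for the two Hamiltonians. If \<open>[J\<^sub>k, J\<^sub>-\<^sub>l] = k \<delta>\<^sub>k\<^sub>l\<close> for \<open>k, l > 0\<close>, then \<open>[H, K] = \<xi>\<close> is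
  central and \<open>e\<^sup>H e\<^sup>K = e\<^sup>\<xi> e\<^sup>K e\<^sup>H\<close>, whose matrix elements are the two identities (for
  \<open>\<plusminus>p'\<close>). For the commutator, \<open>J\<^sub>k\<close> is a sum of normally ordered
  bilinears with coefficient matrix \<open>A\<^sup>k\<close>. By the anticommutation relations it suffices that
  \<open>A\<^sup>k A\<^sup>-\<^sup>l = A\<^sup>-\<^sup>l A\<^sup>k\<close> and that \<open>\<Sum> A\<^sup>k\<^sub>i\<^sub>j A\<^sup>-\<^sup>l\<^sub>j\<^sub>i = k \<delta>\<^sub>k\<^sub>l\<close>, the sum being over \<open>i \<le> 0 < j\<close>. The
  entries of these matrices are coefficients of products of the deformed field functions; the sum over
  the intermediate index telescopes, and the vacuum formulas say precisely that the telescoping sums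
  have no contribution from infinity.\<close>

text \<open>The obstacle is convergence. A lowering current has finite columns and a raising current
  finite rows, so a product with the raising factor on the left is a finite sum, whereas e^H e^K
  involves infinite sums over partitions and cannot be reassociated freely. The exponentials are
  therefore expanded into words of currents: for words with all lowering letters on the left,
  \<open>current_products_converge\<close> gives an unconditionally convergent sum over chains of
  partitions, and cutting the chains at one or two places justifies the regroupings. Total degree in
  the indeterminates then reduces the identity of exponentials to finite identities between divided
  powers. On the analytic side, the fields are expanded both at z = 0 and, with z = 1/X, at
  infinity, where the factors X - a and 1 - bX exchange roles. A vanishing \<alpha> turns 1/(X -
  \<alpha>) into a pole at X = 0, so it must be tracked which combinations have no negative powers.
  The second set of indeterminates carries a scalar c; its values 1 and -1 give the two
  identities.\<close>

unbundle fps_syntax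

section \<open>Deformed fields as Laurent series\<close>

lemma semi_pow_0 [simp]: "semi_pow z \<alpha> 0 = 1"
  and bar_pow_0 [simp]: "bar_pow z \<beta> 0 = 1"
  by (simp_all add: semi_pow_def bar_pow_def)

lemma semi_pow_rec:
  assumes "1 - z * \<alpha> k \<noteq> 0"
  shows "semi_pow z \<alpha> k = semi_pow z \<alpha> (k - 1) * (1 - z * \<alpha> k)"
proof (cases "k \<ge> 1")
  case True
  then have "{1..k} = insert k {1..k-1}" by auto
  with True show ?thesis by (simp add: semi_pow_def mult.commute)
next
  case False
  then have "{k..0} = insert k {k+1..0}" by auto
  with False assms show ?thesis by (simp add: semi_pow_def field_simps)
qed

lemma bar_pow_rec:
  assumes "z - \<beta> k \<noteq> 0"
  shows "bar_pow z \<beta> k = bar_pow z \<beta> (k - 1) * (z - \<beta> k)"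
proof (cases "k \<ge> 1")
  case True
  then have "{1..k} = insert k {1..k-1}" by auto
  with True show ?thesis by (simp add: bar_pow_def mult.commute)
next
  case False
  then have "{k..0} = insert k {k+1..0}" by auto
  with False assms show ?thesis by (simp add: bar_pow_def field_simps)
qed

lemma semi_pow_nonzero: "(\<And>i. 1 - z * \<alpha> i \<noteq> 0) \<Longrightarrow> semi_pow z \<alpha> k \<noteq> 0"
  by (simp add: semi_pow_def)

lemma bar_pow_nonzero: "(\<And>i. z - \<beta> i \<noteq> 0) \<Longrightarrow> bar_pow z \<beta> k \<noteq> 0"
  by (simp add: bar_pow_def)

text \<open>Consecutive values differ by the factor (z - \<beta>)/(1 - z\<alpha>), and both field
  coefficients are this ratio or its inverse up to elementary factors, so all telescoping goes
  through it.\<close>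

definition pow_ratio :: "'a::field \<Rightarrow> (int \<Rightarrow> 'a) \<Rightarrow> (int \<Rightarrow> 'a) \<Rightarrow> int \<Rightarrow> 'a"
  where "pow_ratio z \<alpha> \<beta> k = bar_pow z \<beta> k / semi_pow z \<alpha> k"

lemma pow_ratio_0 [simp]: "pow_ratio z \<alpha> \<beta> 0 = 1"
  by (simp add: pow_ratio_def)

text \<open>For negative k the products contain the inverses of these factors, and inverse 0 = 0
  would break the recursion in k.\<close>

locale regular_point =
  fixes z :: "'a::field" and \<alpha> \<beta> :: "int \<Rightarrow> 'a"
  assumes semi_ne: "1 - z * \<alpha> i \<noteq> 0" and bar_ne: "z - \<beta> i \<noteq> 0"
begin

lemma pow_ratio_nonzero: "pow_ratio z \<alpha> \<beta> k \<noteq> 0"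
  by (simp add: pow_ratio_def semi_pow_nonzero[OF semi_ne] bar_pow_nonzero[OF bar_ne])

lemma pow_ratio_rec:
  "pow_ratio z \<alpha> \<beta> k = pow_ratio z \<alpha> \<beta> (k - 1) * (z - \<beta> k) / (1 - z * \<alpha> k)"
  by (simp add: pow_ratio_def semi_pow_rec[of z \<alpha> k, OF semi_ne] bar_pow_rec[of z \<beta> k, OF bar_ne])

lemma psi_fun_ratio: "psi_fun \<alpha> \<beta> k z = z * pow_ratio z \<alpha> \<beta> (k - 1) / (1 - z * \<alpha> k)"
  by (simp add: psi_fun_def pow_ratio_def semi_pow_rec[of z \<alpha> k, OF semi_ne])

lemma psi_star_fun_ratio:
  "psi_star_fun \<alpha> \<beta> k z = (1 - \<alpha> k * \<beta> k) / (pow_ratio z \<alpha> \<beta> (k - 1) * (z - \<beta> k))"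
  by (simp add: psi_star_fun_def pow_ratio_def bar_pow_rec[of z \<beta> k, OF bar_ne])

end

lemma fls_X_times_nth:
  fixes f :: "complex fls"
  shows "(fls_X * f) $$ n = f $$ (n - 1)"
  by (simp add: fls_X_times_conv_shift)

lemma fls_inverse_X_times_nth:
  fixes f :: "complex fls" shows "(inverse fls_X * f) $$ n = f $$ (n + 1)"
  by (simp add: fls_inverse_X fls_X_inv_times_conv_shift)

lemma regular_point_X: "regular_point fls_X (fls_const \<circ> \<alpha>) (fls_const \<circ> (\<beta> :: int \<Rightarrow> complex))"
proof
  fix i
  have "(1 - fls_X * (fls_const \<circ> \<alpha>) i :: complex fls) $$ 0 \<noteq> 0"
    by (simp add: fls_X_times_nth)
  then show "1 - fls_X * (fls_const \<circ> \<alpha>) i \<noteq> 0" by (metis fls_zero_nth)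
  have "(fls_X - (fls_const \<circ> \<beta>) i) $$ 1 \<noteq> 0"
    by simp
  then show "fls_X - (fls_const \<circ> \<beta>) i \<noteq> 0" by (metis fls_zero_nth)
qed

lemma regular_point_inverse_X:
  "regular_point (inverse fls_X) (fls_const \<circ> \<alpha>) (fls_const \<circ> (\<beta> :: int \<Rightarrow> complex))"
proof
  fix i
  have "(1 - inverse fls_X * (fls_const \<circ> \<alpha>) i :: complex fls) $$ 0 \<noteq> 0"
    by (simp add: fls_inverse_X)
  then show "1 - inverse fls_X * (fls_const \<circ> \<alpha>) i \<noteq> 0" by (metis fls_zero_nth)
  have "(inverse fls_X - (fls_const \<circ> \<beta>) i) $$ (-1) \<noteq> 0"
    by (simp add: fls_inverse_X)
  then show "inverse fls_X - (fls_const \<circ> \<beta>) i \<noteq> 0" by (metis fls_zero_nth)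
qed

section \<open>Laurent series without negative powers and the geometric series\<close>

abbreviation den :: "complex \<Rightarrow> complex fls"
  where "den c \<equiv> 1 - fls_X * fls_const c"

abbreviation nom :: "complex \<Rightarrow> complex fls"
  where "nom c \<equiv> fls_X - fls_const c"

definition fls_nonneg :: "complex fls \<Rightarrow> bool"
  where "fls_nonneg f \<longleftrightarrow> (\<forall>n<0. f $$ n = 0)"

lemma fls_nonneg_iff: "fls_nonneg f \<longleftrightarrow> (\<exists>g. f = fps_to_fls g)"
proof
  assume "fls_nonneg f"
  then have "f = fps_to_fls (fls_regpart f)"
    by (intro fls_eqI) (auto simp: fls_nonneg_def)
  then show "\<exists>g. f = fps_to_fls g" ..
qed (auto simp: fls_nonneg_def)

lemma fls_nonneg_const [simp]: "fls_nonneg (fls_const c)"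
  and fls_nonneg_1 [simp]: "fls_nonneg 1"
  and fls_nonneg_X [simp]: "fls_nonneg fls_X"
  by (auto simp: fls_nonneg_def)

lemma fls_nonneg_mult: "fls_nonneg f \<Longrightarrow> fls_nonneg g \<Longrightarrow> fls_nonneg (f * g)"
  unfolding fls_nonneg_iff by (metis fls_times_fps_to_fls)

lemma fls_nonneg_diff: "fls_nonneg f \<Longrightarrow> fls_nonneg g \<Longrightarrow> fls_nonneg (f - g)"
  by (auto simp: fls_nonneg_def)

lemma fls_geometric:
  "1 / den (c::complex) = fps_to_fls (Abs_fps (\<lambda>n. c ^ n))"
proof -
  have "den c * fps_to_fls (Abs_fps (\<lambda>n. c ^ n)) = 1"
  proof (rule fls_eqI)
    fix n :: int
    let ?g = "fps_to_fls (Abs_fps (\<lambda>n. c ^ n))"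
    have "(den c * ?g) $$ n = ?g $$ n - c * ?g $$ (n - 1)"
      by (simp add: left_diff_distrib mult.assoc fls_X_times_nth)
    also have "\<dots> = (if n = 0 then 1 else 0)"
    proof (cases "n \<ge> 1")
      case True
      then have "c ^ nat n = c * c ^ nat (n - 1)"
        by (simp add: nat_diff_distrib' flip: power_Suc)
      with True show ?thesis by simp
    qed auto
    finally show "(den c * ?g) $$ n = 1 $$ n" by simp
  qed
  moreover have "den c \<noteq> 0"
    using regular_point.semi_ne[OF regular_point_X[of "\<lambda>_. c" "\<lambda>_. 0"]] by simp
  ultimately show ?thesis by (simp add: field_simps)
qed

lemma fls_nonneg_geometric: "fls_nonneg (1 / den c)"
  unfolding fls_geometric fls_nonneg_iff by blast

text \<open>A convolution range that depends only on lower bounds, not on the subdegrees of the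
  factors: the same finite range then serves a whole family of factors, as is needed to exchange the
  convolution with a sum over the family.\<close>

lemma fls_mult_nth_window:
  fixes f g :: "complex fls"
  assumes f: "\<And>n. n < d \<Longrightarrow> f $$ n = 0" and g: "fls_nonneg g" and n: "n \<le> N"
  shows "(f * g) $$ n = (\<Sum>m=d..N. f $$ m * g $$ (n - m))"
proof (cases "f = 0 \<or> g = 0")
  case False
  have d: "d \<le> fls_subdegree f"
    using False f by (metis nth_fls_subdegree_nonzero not_le)
  have e: "0 \<le> fls_subdegree g"
    using False g by (metis fls_nonneg_def nth_fls_subdegree_nonzero not_le)
  have "(f * g) $$ n = (\<Sum>m=fls_subdegree f..n - fls_subdegree g. f $$ m * g $$ (n - m))"
    by (rule fls_times_nth(2))
  also have "\<dots> = (\<Sum>m=d..N. f $$ m * g $$ (n - m))"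
    by (rule sum.mono_neutral_left) (use d e n in auto)
  finally show ?thesis .
qed auto

text \<open>The coefficient of X^k Y^l in f(X) g(Y) / (1 - XY), with the geometric series cut after
  (XY)^K. For z = 1/X and w = Y the kernel is z/(z - w). The cut avoids series in two variables and
  is harmless once f has no coefficients below index k - K.\<close>

definition diag_sum :: "nat \<Rightarrow> complex fls \<Rightarrow> complex fls \<Rightarrow> int \<Rightarrow> int \<Rightarrow> complex"
  where "diag_sum K f g k l = (\<Sum>t\<le>K. f $$ (k - int t) * g $$ (l - int t))"

lemma diag_sum_commute: "diag_sum K f g k l = diag_sum K g f l k"
  by (simp add: diag_sum_def mult.commute)

lemma diag_sum_shift:
  "diag_sum K (fls_X * f) g k l = diag_sum K f g (k - 1) l"
  "diag_sum K f (fls_X * g) k l = diag_sum K f g k (l - 1)"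
  by (simp_all add: diag_sum_def fls_X_times_nth algebra_simps)

lemma diag_sum_diff:
  "diag_sum K (f - f') g k l = diag_sum K f g k l - diag_sum K f' g k l"
  "diag_sum K f (g - g') k l = diag_sum K f g k l - diag_sum K f g' k l"
  by (simp_all add: diag_sum_def algebra_simps sum_subtractf)

lemma diag_sum_const:
  "diag_sum K (fls_const c * f) g k l = c * diag_sum K f g k l"
  "diag_sum K f (fls_const c * g) k l = c * diag_sum K f g k l"
  by (simp_all add: diag_sum_def sum_distrib_left mult_ac)

text \<open>The shifted sum runs over t = 1..K+1 instead of 0..K; the bound on k turns the surplus
  term t = K + 1 into a coefficient of f of negative index.\<close>

lemma diag_sum_pred:
  assumes "fls_nonneg f" "k \<le> int K"
  shows "diag_sum K f g (k - 1) (l - 1) = diag_sum K f g k l - f $$ k * g $$ l"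
proof -
  have "diag_sum K f g (k - 1) (l - 1) = (\<Sum>t\<in>Suc ` {..K}. f $$ (k - int t) * g $$ (l - int t))"
    by (simp add: diag_sum_def sum.reindex algebra_simps)
  also have "\<dots> = (\<Sum>t\<in>{..K} - {0}. f $$ (k - int t) * g $$ (l - int t))"
  proof (rule sum.mono_neutral_right)
    show "\<forall>i\<in>Suc ` {..K} - ({..K} - {0}). f $$ (k - int i) * g $$ (l - int i) = 0"
    proof
      fix i assume "i \<in> Suc ` {..K} - ({..K} - {0})"
      then have "i = Suc K" by (auto simp: le_Suc_eq)
      with assms show "f $$ (k - int i) * g $$ (l - int i) = 0"
        by (simp add: fls_nonneg_def)
    qed
    show "{..K} - {0} \<subseteq> Suc ` {..K}"
    proof
      fix x assume "x \<in> {..K} - {0}"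
      then show "x \<in> Suc ` {..K}" by (intro image_eqI[of _ _ "x - 1"]) auto
    qed
  qed auto
  also have "\<dots> = diag_sum K f g k l - f $$ k * g $$ l"
    by (simp add: diag_sum_def sum_diff1)
  finally show ?thesis .
qed

text \<open>Coefficientwise form of \<open>(1-\<alpha>w)(z-\<beta>) - (w-\<beta>)(1-\<alpha>z) = (1-\<alpha>\<beta>)(z-w)\<close> with \<open>z = X\<^sup>-\<^sup>1\<close>; it makes
  the sums over the deformed basis telescope.\<close>

lemma diag_sum_telescope:
  assumes "fls_nonneg f" "k \<le> int K"
  shows "diag_sum K (den b * f) (den a * g) k l
       - diag_sum K (nom a * f) (nom b * g) k l
       = (1 - a * b) * f $$ k * g $$ l"
proof -
  have *: "den b * f = f - fls_const b * (fls_X * f)"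
    "nom b * f = fls_X * f - fls_const b * f" for f and b :: complex
    by (simp_all add: algebra_simps)
  show ?thesis
    unfolding * diag_sum_diff diag_sum_const diag_sum_shift
    by (simp add: diag_sum_pred[OF assms] algebra_simps)
qed

text \<open>Partial fractions: (X - a)/((1 - XY)(1 - aY)) = X/(1 - XY) - a/(1 - aY), and the
  coefficient of Y^l on the right is X^(l+1) - a^(l+1).\<close>

lemma diag_sum_geometric:
  assumes "0 \<le> l" "l \<le> int K"
  shows "diag_sum K (nom a * f) (1 / den a) k l =
    f $$ (k - l - 1) - a ^ nat (l + 1) * f $$ k"
proof -
  obtain n where n: "l = int n" "n \<le> K" using assms by (metis nonneg_int_cases of_nat_le_iff)
  have "diag_sum K (nom a * f) (1 / den a) k l
     = (\<Sum>t\<le>K. (f $$ (k - int t - 1) - a * f $$ (k - int t)) * (if t \<le> n then a ^ (n - t) else 0))"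
    unfolding diag_sum_def fls_geometric
    by (intro sum.cong arg_cong2[where f = "(*)"])
      (auto simp: n left_diff_distrib fls_X_times_nth nat_diff_distrib')
  also have "\<dots> = (\<Sum>t\<le>n. (f $$ (k - int t - 1) - a * f $$ (k - int t)) * a ^ (n - t))"
    by (rule sum.mono_neutral_cong_right) (use n in auto)
  also have "\<dots> = (\<Sum>t\<le>n. f $$ (k - int (Suc t)) * a ^ (Suc n - Suc t) - f $$ (k - int t) * a ^ (Suc n - t))"
    by (rule sum.cong) (auto simp: Suc_diff_le algebra_simps)
  also have "\<dots> = f $$ (k - int (Suc n)) * a ^ (Suc n - Suc n) - f $$ (k - int 0) * a ^ (Suc n - 0)"
    using sum_lessThan_telescope[of "\<lambda>t. f $$ (k - int t) * a ^ (Suc n - t)" "Suc n"]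
    by (simp add: lessThan_Suc_atMost)
  finally show ?thesis by (simp add: n nat_add_distrib algebra_simps)
qed

text \<open>Separates the factors F and G, which may have poles, from the regular factors f and g,
  to which the vacuum formulas apply.\<close>

lemma diag_sum_mult:
  assumes F: "\<And>n. n < d \<Longrightarrow> F $$ n = 0" and G: "\<And>n. n < e \<Longrightarrow> G $$ n = 0"
    and f: "fls_nonneg f" and g: "fls_nonneg g"
  shows "diag_sum K (F * f) (G * g) k l =
    (\<Sum>m=d..k. \<Sum>n=e..l. F $$ m * G $$ n * diag_sum K f g (k - m) (l - n))"
proof -
  have "diag_sum K (F * f) (G * g) k l = (\<Sum>t\<le>K.
      (\<Sum>m=d..k. F $$ m * f $$ (k - int t - m)) * (\<Sum>n=e..l. G $$ n * g $$ (l - int t - n)))"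
    unfolding diag_sum_def
    by (intro sum.cong refl arg_cong2[where f = "(*)"] fls_mult_nth_window assms) auto
  also have "\<dots> = (\<Sum>t\<le>K. \<Sum>m=d..k. \<Sum>n=e..l. F $$ m * G $$ n * (f $$ (k - m - int t) * g $$ (l - n - int t)))"
    by (simp add: sum_product algebra_simps)
  also have "\<dots> = (\<Sum>m=d..k. \<Sum>t\<le>K. \<Sum>n=e..l. F $$ m * G $$ n * (f $$ (k - m - int t) * g $$ (l - n - int t)))"
    by (rule sum.swap)
  also have "\<dots> = (\<Sum>m=d..k. \<Sum>n=e..l. \<Sum>t\<le>K. F $$ m * G $$ n * (f $$ (k - m - int t) * g $$ (l - n - int t)))"
    by (intro sum.cong refl sum.swap)
  finally show ?thesis by (simp add: diag_sum_def sum_distrib_left)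
qed

section \<open>Vacuum matrix elements of fermion pairs\<close>

lemma maya_empty: "maya empty_partition = {..0}"
proof
  show "{..0} \<subseteq> maya empty_partition"
  proof
    fix s :: int assume "s \<in> {..0}"
    then have "s = int 0 - int (nat (- s))" by auto
    then show "s \<in> maya empty_partition" unfolding maya_def by blast
  qed
qed (auto simp: maya_def)

lemma mel_vacuum_psi_psi_star:
  "mel empty_partition (psi i \<circ> psi_star j) empty_partition = (if i = j \<and> i \<le> 0 then 1 else 0)"
proof (cases "i \<le> 0 \<and> i = j")
  case True
  then have "{s \<in> {..0} - {i}. j < s} = {s \<in> {..0}. i < s}" by auto
  with True show ?thesis
    by (simp add: mel_def ket_def psi_def psi_star_def maya_empty insert_absorb flip: power_add mult_2)
next
  case False
  show ?thesis
  proof (cases "i \<le> 0")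
    case True
    with False have "insert j ({..0} - {i}) \<noteq> {..0}" by blast
    with False True show ?thesis
      by (simp add: mel_def ket_def psi_def psi_star_def maya_empty)
  qed (simp add: mel_def psi_def maya_empty)
qed

lemma mel_vacuum_psi_star_psi:
  "mel empty_partition (psi_star j \<circ> psi i) empty_partition = (if i = j \<and> i \<ge> 1 then 1 else 0)"
proof (cases "j \<ge> 1")
  case True
  then have 1: "{s. s \<le> 0 \<and> j < s} = {}" "{s. (s = j \<or> s \<le> 0) \<and> j < s} = {}" "j \<notin> {..0}"
    by auto
  have 2: "insert j {..0} - {i} = {..0} \<longleftrightarrow> i = j"
    using 1(3) by (cases "i = j") blast+
  show ?thesis
    using True 2 by (cases "i = j") (simp_all add: 1 mel_def ket_def psi_def psi_star_def maya_empty)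
qed (simp add: mel_def psi_star_def maya_empty)

lemma has_sum_diagonal:
  fixes f :: "'a \<times> 'a \<Rightarrow> 'b::{comm_monoid_add,topological_space}"
  assumes "(f has_sum s) UNIV" and "\<And>i j. i \<noteq> j \<or> i \<notin> A \<Longrightarrow> f (i, j) = 0"
  shows "((\<lambda>i. f (i, i)) has_sum s) A"
proof -
  have "(f has_sum s) UNIV \<longleftrightarrow> (f has_sum s) ((\<lambda>i. (i, i)) ` A)"
    by (rule has_sum_cong_neutral) (use assms(2) in auto)
  also have "\<dots> \<longleftrightarrow> ((\<lambda>i. f (i, i)) has_sum s) A"
    by (subst has_sum_reindex) (auto simp: inj_on_def o_def)
  finally show ?thesis using assms(1) by simp
qed

text \<open>Under z = 1/x both z - b and 1 - za acquire a factor 1/x, which cancels in their ratio;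
  compared with the expansion at 0 the shapes x - c and 1 - xc change places.\<close>

lemma inverse_substitution:
  fixes x :: "'a::field" assumes "x \<noteq> 0"
  shows "(inverse x - b) / (1 - inverse x * a) = (1 - x * b) / (x - a)"
    and "inverse x * u / (1 - inverse x * a) = u / (x - a)"
    and "c / (u * (inverse x - b)) = c * x / (u * (1 - x * b))"
proof -
  have *: "inverse x - b = (1 - x * b) / x" "1 - inverse x * a = (x - a) / x"
    using assms by (simp_all add: field_simps)
  show "(inverse x - b) / (1 - inverse x * a) = (1 - x * b) / (x - a)"
    "inverse x * u / (1 - inverse x * a) = u / (x - a)"
    "c / (u * (inverse x - b)) = c * x / (u * (1 - x * b))"
    unfolding * using assms by simp_all
qed

section \<open>Expansions of the deformed fields at 0 and at infinity\<close>

locale deformation =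
  fixes \<alpha> \<beta> :: "int \<Rightarrow> complex"
begin

sublocale at_zero: regular_point fls_X "fls_const \<circ> \<alpha>" "fls_const \<circ> \<beta>"
  by (rule regular_point_X)

sublocale at_inf: regular_point "inverse fls_X" "fls_const \<circ> \<alpha>" "fls_const \<circ> \<beta>"
  by (rule regular_point_inverse_X)

text \<open>Coefficient functions of the deformed fields and the ratio \<open>(z|\<beta>)\<^sup>k / (z;\<alpha>)\<^sup>k\<close>, expanded at
  \<open>z = X = 0\<close> and at \<open>z = X\<^sup>-\<^sup>1 = \<infinity>\<close>.\<close>

definition F0 where "F0 i = psi_fun (fls_const \<circ> \<alpha>) (fls_const \<circ> \<beta>) i fls_X"
definition Finf where "Finf i = psi_fun (fls_const \<circ> \<alpha>) (fls_const \<circ> \<beta>) i (inverse fls_X)"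
definition G0 where "G0 i = psi_star_fun (fls_const \<circ> \<alpha>) (fls_const \<circ> \<beta>) i fls_X"
definition Ginf where "Ginf i = psi_star_fun (fls_const \<circ> \<alpha>) (fls_const \<circ> \<beta>) i (inverse fls_X)"
definition U0 where "U0 = pow_ratio fls_X (fls_const \<circ> \<alpha>) (fls_const \<circ> \<beta>)"
definition Uinf where "Uinf = pow_ratio (inverse fls_X) (fls_const \<circ> \<alpha>) (fls_const \<circ> \<beta>)"

lemma one_minus_ne [simp]: "den (c::complex) \<noteq> 0"
  using regular_point.semi_ne[OF regular_point_X[of "\<lambda>_. c" "\<lambda>_. 0"]] by simp

lemma X_minus_ne [simp]: "nom (c::complex) \<noteq> 0"
  using regular_point.bar_ne[OF regular_point_X[of "\<lambda>_. 0" "\<lambda>_. c"]] by simp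

lemma X_mult_const_ne [simp]: "fls_X * fls_const (c::complex) \<noteq> 1"
  using one_minus_ne[of c] by (metis diff_self)

lemma X_ne_const [simp]: "fls_X \<noteq> fls_const (c::complex)"
  using X_minus_ne[of c] by (metis diff_self)

lemma fls_const_one_minus: "1 - fls_const (a::complex) * fls_const b = fls_const (1 - a * b)"
  by (simp add: fls_const_mult_const flip: fls_const_1 fls_minus_const)

lemma U_0 [simp]: "U0 0 = 1" "Uinf 0 = 1"
  by (simp_all add: U0_def Uinf_def)

lemma U_ne [simp]: "U0 k \<noteq> 0" "Uinf k \<noteq> 0"
  by (simp_all add: U0_def Uinf_def at_zero.pow_ratio_nonzero at_inf.pow_ratio_nonzero)

lemma U0_rec:
  "U0 k = U0 (k - 1) * nom (\<beta> k) / den (\<alpha> k)"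
  using at_zero.pow_ratio_rec[of k] by (simp add: U0_def)

lemma Uinf_rec:
  "Uinf k = Uinf (k - 1) * den (\<beta> k) / nom (\<alpha> k)"
  using at_inf.pow_ratio_rec[of k]
  unfolding o_apply times_divide_eq_right[symmetric] inverse_substitution(1)[OF fls_X_nonzero] Uinf_def .

lemma F0_eq: "F0 k = fls_X * U0 (k - 1) / den (\<alpha> k)"
  using at_zero.psi_fun_ratio[of k] by (simp add: U0_def F0_def)

lemma G0_eq:
  "G0 k = fls_const (1 - \<alpha> k * \<beta> k) / (U0 (k - 1) * nom (\<beta> k))"
  using at_zero.psi_star_fun_ratio[of k]
  unfolding o_apply fls_const_one_minus U0_def G0_def .

lemma Finf_eq: "Finf k = Uinf (k - 1) / nom (\<alpha> k)"
  using at_inf.psi_fun_ratio[of k]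
  unfolding o_apply inverse_substitution(2)[OF fls_X_nonzero] Uinf_def Finf_def .

lemma Ginf_eq:
  "Ginf k = fls_const (1 - \<alpha> k * \<beta> k) * fls_X / (Uinf (k - 1) * den (\<beta> k))"
  using at_inf.psi_star_fun_ratio[of k]
  unfolding o_apply fls_const_one_minus inverse_substitution(3)[OF fls_X_nonzero] Uinf_def Ginf_def .

lemma nonneg_frac: "fls_nonneg f \<Longrightarrow> fls_nonneg (f / den c)"
  using fls_nonneg_mult[OF _ fls_nonneg_geometric[of c], of f] by simp

lemmas nonneg_intros =
  fls_nonneg_mult fls_nonneg_diff nonneg_frac fls_nonneg_const fls_nonneg_X fls_nonneg_1

text \<open>Separately, \<open>Finf i\<close> and 1 / \<open>Uinf k\<close> can have poles at X = 0
  or in other factors of the denominator. For i \<le> k every \<open>nom\<close> in a denominator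
  cancels and only factors \<open>den\<close> remain there.\<close>

lemma nonneg_Finf_div_Uinf: "i \<le> k \<Longrightarrow> fls_nonneg (Finf i / Uinf k)"
proof (induction k rule: int_ge_induct)
  case base
  have "Finf i / Uinf i = 1 / den (\<beta> i)"
    by (simp add: Finf_eq Uinf_rec[of i])
  then show ?case by (simp add: nonneg_intros)
next
  case (step k)
  have "Finf i / Uinf (k + 1) = Finf i / Uinf k * nom (\<alpha> (k + 1)) / den (\<beta> (k + 1))"
    by (simp add: Uinf_rec[of "k + 1"])
  then show ?case using step.IH by (simp only:) (intro nonneg_intros)
qed

lemma nonneg_Uinf_mult_Ginf: "k \<le> j \<Longrightarrow> fls_nonneg (Uinf (k - 1) * Ginf j)"
proof (induction k rule: int_le_induct)
  case base
  have "Uinf (j - 1) * Ginf j = fls_const (1 - \<alpha> j * \<beta> j) * fls_X / den (\<beta> j)"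
    by (simp add: Ginf_eq)
  then show ?case by (simp only:) (intro nonneg_intros)
next
  case (step k)
  have "Uinf (k - 1 - 1) * Ginf j = Uinf (k - 1) * Ginf j * nom (\<alpha> (k - 1)) / den (\<beta> (k - 1))"
    by (simp add: Uinf_rec[of "k - 1"])
  then show ?case
    by (simp only:) (rule nonneg_frac fls_nonneg_mult[OF step.IH] fls_nonneg_diff fls_nonneg_X fls_nonneg_const)+
qed

lemma nonneg_U0: "0 \<le> k \<Longrightarrow> fls_nonneg (U0 k)"
proof (induction k rule: int_ge_induct)
  case (step k)
  have "U0 (k + 1) = U0 k * nom (\<beta> (k + 1)) / den (\<alpha> (k + 1))"
    by (simp add: U0_rec[of "k + 1"])
  then show ?case using step.IH by (simp only:) (intro nonneg_intros)
qed simp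

lemma nonneg_inverse_Uinf: "0 \<le> k \<Longrightarrow> fls_nonneg (1 / Uinf k)"
proof (induction k rule: int_ge_induct)
  case (step k)
  have "1 / Uinf (k + 1) = 1 / Uinf k * nom (\<alpha> (k + 1)) / den (\<beta> (k + 1))"
    by (simp add: Uinf_rec[of "k + 1"])
  then show ?case using step.IH by (simp only:) (intro nonneg_intros)
qed simp

lemma nonneg_Uinf: "k \<le> 0 \<Longrightarrow> fls_nonneg (Uinf k)"
proof (induction k rule: int_le_induct)
  case (step k)
  have "Uinf (k - 1) = Uinf k * nom (\<alpha> k) / den (\<beta> k)"
    by (simp add: Uinf_rec[of k])
  then show ?case using step.IH by (simp only:) (intro nonneg_intros)
qed simp

lemma nonneg_inverse_U0: "k \<le> 0 \<Longrightarrow> fls_nonneg (1 / U0 k)"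
proof (induction k rule: int_le_induct)
  case (step k)
  have "1 / U0 (k - 1) = 1 / U0 k * nom (\<beta> k) / den (\<alpha> k)"
    by (simp add: U0_rec[of k])
  then show ?case using step.IH by (simp only:) (intro nonneg_intros)
qed simp

lemma nonneg_F0: "1 \<le> k \<Longrightarrow> fls_nonneg (F0 k)"
  unfolding F0_eq by (intro nonneg_intros nonneg_U0) auto

lemma nonneg_Ginf: "1 \<le> k \<Longrightarrow> fls_nonneg (Ginf k)"
proof -
  assume "1 \<le> k"
  have "Ginf k = fls_const (1 - \<alpha> k * \<beta> k) * fls_X * (1 / Uinf (k - 1)) / den (\<beta> k)"
    by (simp add: Ginf_eq)
  then show ?thesis by (simp only:) (intro nonneg_intros nonneg_inverse_Uinf, use \<open>1 \<le> k\<close> in auto)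
qed

lemma nonneg_Finf: "k \<le> 0 \<Longrightarrow> fls_nonneg (Finf k)"
proof -
  assume "k \<le> 0"
  have "Finf k = Uinf k / den (\<beta> k)"
    by (simp add: Finf_eq Uinf_rec[of k])
  then show ?thesis by (simp only:) (intro nonneg_intros nonneg_Uinf \<open>k \<le> 0\<close>)
qed

lemma nonneg_G0: "k \<le> 0 \<Longrightarrow> fls_nonneg (G0 k)"
proof -
  assume "k \<le> 0"
  have "G0 k = fls_const (1 - \<alpha> k * \<beta> k) * (1 / U0 k) / den (\<alpha> k)"
    by (simp add: G0_eq U0_rec[of k])
  then show ?thesis by (simp only:) (intro nonneg_intros nonneg_inverse_U0 \<open>k \<le> 0\<close>)
qed

text \<open>The vacuum occupies the integers \<le> 0, so in the second vacuum formula only i = j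
  \<ge> 1 survives. As \<open>Ginf\<close> is a series in 1/w, its index k stands for the exponent
  -k of w.\<close>

lemma vacuum_pos:
  assumes "vacuum_formulas \<alpha> \<beta>"
  shows "((\<lambda>a. Ginf a $$ k * F0 a $$ l) has_sum (if k = l \<and> l \<ge> 1 then 1 else 0)) {1..}"
proof -
  have "((\<lambda>(i, j). psi_coeff \<alpha> \<beta> i l * psi_star_coeff \<alpha> \<beta> j (- k) *
      mel empty_partition (psi_star j \<circ> psi i) empty_partition)
      has_sum (if l \<ge> 1 \<and> - k = - l then 1 else 0)) UNIV"
    using assms unfolding vacuum_formulas_def by blast
  then have "((\<lambda>i. psi_coeff \<alpha> \<beta> i l * psi_star_coeff \<alpha> \<beta> i (- k) * mel empty_partition (psi_star i \<circ> psi i) empty_partition)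
      has_sum (if l \<ge> 1 \<and> - k = - l then 1 else 0)) {1..}"
    by (rule has_sum_diagonal[where f = "\<lambda>(i, j). _ i j", unfolded prod.case])
      (auto simp: mel_vacuum_psi_star_psi)
  also have "(if l \<ge> 1 \<and> - k = - l then 1 else 0) = (if k = l \<and> l \<ge> 1 then 1 else 0 :: complex)"
    by auto
  also have "((\<lambda>i. psi_coeff \<alpha> \<beta> i l * psi_star_coeff \<alpha> \<beta> i (- k) * mel empty_partition (psi_star i \<circ> psi i) empty_partition) has_sum \<dots>) {1..} \<longleftrightarrow> ?thesis"
    by (rule has_sum_cong) (auto simp: mel_vacuum_psi_star_psi psi_coeff_def psi_star_coeff_def F0_def Ginf_def)
  finally show ?thesis .
qed

lemma vacuum_nonpos:
  assumes "vacuum_formulas \<alpha> \<beta>"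
  shows "((\<lambda>a. Finf a $$ k * G0 a $$ l) has_sum (if k = l \<and> l \<ge> 0 then 1 else 0)) {..0}"
proof -
  have "((\<lambda>(i, j). psi_coeff \<alpha> \<beta> i (- k) * psi_star_coeff \<alpha> \<beta> j l *
      mel empty_partition (psi i \<circ> psi_star j) empty_partition)
      has_sum (if l \<ge> 0 \<and> - k = - l then 1 else 0)) UNIV"
    using assms unfolding vacuum_formulas_def by blast
  then have "((\<lambda>i. psi_coeff \<alpha> \<beta> i (- k) * psi_star_coeff \<alpha> \<beta> i l * mel empty_partition (psi i \<circ> psi_star i) empty_partition)
      has_sum (if l \<ge> 0 \<and> - k = - l then 1 else 0)) {..0}"
    by (rule has_sum_diagonal[where f = "\<lambda>(i, j). _ i j", unfolded prod.case])
      (auto simp: mel_vacuum_psi_psi_star)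
  also have "(if l \<ge> 0 \<and> - k = - l then 1 else 0) = (if k = l \<and> l \<ge> 0 then 1 else 0 :: complex)"
    by auto
  also have "((\<lambda>i. psi_coeff \<alpha> \<beta> i (- k) * psi_star_coeff \<alpha> \<beta> i l * mel empty_partition (psi i \<circ> psi_star i) empty_partition) has_sum \<dots>) {..0} \<longleftrightarrow> ?thesis"
    by (rule has_sum_cong) (auto simp: mel_vacuum_psi_psi_star psi_coeff_def psi_star_coeff_def Finf_def G0_def)
  finally show ?thesis .
qed

end

section \<open>Telescoping sums over the deformed basis\<close>

lemma has_sum_sum:
  fixes f :: "'i \<Rightarrow> 'a \<Rightarrow> 'b::topological_comm_monoid_add"
  assumes "\<And>i. i \<in> I \<Longrightarrow> (f i has_sum s i) A"
  shows "((\<lambda>x. \<Sum>i\<in>I. f i x) has_sum (\<Sum>i\<in>I. s i)) A"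
  using assms by (induction I rule: infinite_finite_induct) (auto intro: has_sum_add)

context deformation
begin

lemma diag_sum_one:
  "k \<le> int K \<Longrightarrow> diag_sum K 1 1 k l = (if k = l \<and> l \<ge> 0 then 1 else 0)"
proof -
  assume k: "k \<le> int K"
  have "diag_sum K 1 1 k l = (\<Sum>t\<le>K. if t = nat k then (if k = l \<and> l \<ge> 0 then 1 else 0) else 0)"
    unfolding diag_sum_def by (rule sum.cong) auto
  also have "\<dots> = (if k = l \<and> l \<ge> 0 then 1 else 0)"
    using k by (simp add: nat_le_iff)
  finally show ?thesis .
qed

text \<open>The remainder at level a - 1 is the summand for a plus the remainder at level a: in
  \<open>diag_sum_telescope\<close>, applied to ?P and ?Q, the products with \<open>den\<close> are
  the level a - 1 series and those with \<open>nom\<close> the level a series. The index shift by 1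
  comes from the factor X in \<open>Ginf a\<close> and \<open>F0 a\<close>.\<close>

lemma upper_step:
  assumes nn: "fls_nonneg (F / Uinf (a - 1))" and k: "k - 1 \<le> int K"
  shows "diag_sum K (F / Uinf (a - 1)) (G * U0 (a - 1)) (k - 1) (l - 1) =
    (F * Ginf a) $$ k * (G * F0 a) $$ l + diag_sum K (F / Uinf a) (G * U0 a) (k - 1) (l - 1)"
proof -
  let ?P = "F / Uinf (a - 1) / den (\<beta> a)"
  let ?Q = "G * U0 (a - 1) / den (\<alpha> a)"
  have "fls_nonneg ?P" by (intro nonneg_frac nn)
  note tel = diag_sum_telescope[OF this k, of "\<beta> a" "\<alpha> a" ?Q "l - 1"]
  have 1: "den (\<beta> a) * ?P = F / Uinf (a - 1)"
    "den (\<alpha> a) * ?Q = G * U0 (a - 1)"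
    "nom (\<alpha> a) * ?P = F / Uinf a"
    "nom (\<beta> a) * ?Q = G * U0 a"
    by (simp_all add: U0_rec[of a] Uinf_rec[of a])
  have "F * Ginf a = fls_const (1 - \<alpha> a * \<beta> a) * (fls_X * ?P)" "G * F0 a = fls_X * ?Q"
    by (simp_all add: Ginf_eq F0_eq)
  then have 2: "(F * Ginf a) $$ k = (1 - \<alpha> a * \<beta> a) * ?P $$ (k - 1)" "(G * F0 a) $$ l = ?Q $$ (l - 1)"
    by (simp_all only: fls_X_times_nth fls_mult_const_nth)
  show ?thesis using tel unfolding 1 2 by (simp add: algebra_simps)
qed

text \<open>The mirror image of \<open>upper_step\<close>, with levels running downwards. The
  indices are not shifted because \<open>Finf a\<close> and \<open>G0 a\<close> carry no factor
  X.\<close>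

lemma lower_step:
  assumes nn: "fls_nonneg (Uinf a * G)" and k: "k \<le> int K"
  shows "diag_sum K (Uinf a * G) (F / U0 a) k l =
    (Finf a * G) $$ k * (F * G0 a) $$ l + diag_sum K (Uinf (a - 1) * G) (F / U0 (a - 1)) k l"
proof -
  let ?P = "Uinf a * G / den (\<beta> a)"
  let ?Q = "F / U0 a / den (\<alpha> a)"
  have "fls_nonneg ?P" by (intro nonneg_frac nn)
  note tel = diag_sum_telescope[OF this k, of "\<beta> a" "\<alpha> a" ?Q "l"]
  have 1: "den (\<beta> a) * ?P = Uinf a * G"
    "den (\<alpha> a) * ?Q = F / U0 a"
    "nom (\<alpha> a) * ?P = Uinf (a - 1) * G"
    "nom (\<beta> a) * ?Q = F / U0 (a - 1)"
    by (simp_all add: U0_rec[of a] Uinf_rec[of a])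
  have "Finf a * G = ?P" "F * G0 a = fls_const (1 - \<alpha> a * \<beta> a) * ?Q"
    by (simp_all add: Finf_eq G0_eq U0_rec[of a] Uinf_rec[of a])
  then have 2: "(Finf a * G) $$ k = ?P $$ k" "(F * G0 a) $$ l = (1 - \<alpha> a * \<beta> a) * ?Q $$ l"
    by (simp_all only: fls_mult_const_nth)
  show ?thesis using tel unfolding 1 2 by (simp add: algebra_simps)
qed

text \<open>At level 0 the remainder is the diagonal sum of 1 and 1, which is exactly the value that
  the vacuum formula gives to the whole series. Each step removes one summand from both, so the
  remainder at every later level is the full tail.\<close>

lemma upper_vacuum:
  assumes vac: "vacuum_formulas \<alpha> \<beta>" and "0 \<le> M" and k: "k - 1 \<le> int K"
  shows "((\<lambda>a. Ginf a $$ k * F0 a $$ l) has_sum diag_sum K (1 / Uinf M) (U0 M) (k - 1) (l - 1)) {M<..}"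
  using \<open>0 \<le> M\<close>
proof (induction M rule: int_ge_induct)
  case base
  have "{0<..} = {1::int..}" by auto
  moreover have "diag_sum K (1 / Uinf 0) (U0 0) (k - 1) (l - 1) = (if k = l \<and> l \<ge> 1 then 1 else 0)"
    by (simp add: diag_sum_one[OF k])
  ultimately show ?case
    using vacuum_pos[OF vac, of k l] by (simp only:)
next
  case (step M)
  have "((\<lambda>a. Ginf a $$ k * F0 a $$ l) has_sum
      (diag_sum K (1 / Uinf M) (U0 M) (k - 1) (l - 1) - Ginf (M+1) $$ k * F0 (M+1) $$ l)) ({M<..} - {M + 1})"
    by (rule has_sum_Diff[OF step.IH]) (auto simp: has_sum_finite_iff)
  also have "{M<..} - {M + 1} = {M + 1<..}" by auto
  also have "diag_sum K (1 / Uinf M) (U0 M) (k - 1) (l - 1) - Ginf (M+1) $$ k * F0 (M+1) $$ l =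
      diag_sum K (1 / Uinf (M + 1)) (U0 (M + 1)) (k - 1) (l - 1)"
    using upper_step[of 1 "M + 1" k K 1 l] nonneg_inverse_Uinf[OF step.hyps] k by simp
  finally show ?case .
qed

lemma lower_vacuum:
  assumes vac: "vacuum_formulas \<alpha> \<beta>" and "M \<le> 0" and k: "k \<le> int K"
  shows "((\<lambda>a. Finf a $$ k * G0 a $$ l) has_sum diag_sum K (Uinf M) (1 / U0 M) k l) {..M}"
  using \<open>M \<le> 0\<close>
proof (induction M rule: int_le_induct)
  case base
  show ?case
    using vacuum_nonpos[OF vac, of k l] by (simp add: diag_sum_one[OF k])
next
  case (step M)
  have "((\<lambda>a. Finf a $$ k * G0 a $$ l) has_sum
      (diag_sum K (Uinf M) (1 / U0 M) k l - Finf M $$ k * G0 M $$ l)) ({..M} - {M})"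
    by (rule has_sum_Diff[OF step.IH]) (auto simp: has_sum_finite_iff)
  also have "{..M} - {M} = {..M - 1}" by auto
  also have "diag_sum K (Uinf M) (1 / U0 M) k l - Finf M $$ k * G0 M $$ l =
      diag_sum K (Uinf (M - 1)) (1 / U0 (M - 1)) k l"
    using lower_step[of M 1 k K 1 l] nonneg_Uinf[OF step.hyps] k by simp
  finally show ?case .
qed

lemma fls_lower_bound: obtains d where "\<And>n. n < d \<Longrightarrow> (f :: complex fls) $$ n = 0"
  by (meson fls_eq0_below_subdegree)

text \<open>Both convolutions have finite ranges independent of a, so the sum over a can be taken
  inside them.\<close>

lemma has_sum_window:
  fixes g h :: "int \<Rightarrow> complex fls"
  assumes F: "\<And>n. n < d \<Longrightarrow> F $$ n = 0" and G: "\<And>n. n < e \<Longrightarrow> G $$ n = 0"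
    and g: "\<And>a. a \<in> A \<Longrightarrow> fls_nonneg (g a)" and h: "\<And>a. a \<in> A \<Longrightarrow> fls_nonneg (h a)"
    and sums: "\<And>k' l'. k' \<le> k - d \<Longrightarrow> ((\<lambda>a. g a $$ k' * h a $$ l') has_sum S k' l') A"
  shows "((\<lambda>a. (F * g a) $$ k * (G * h a) $$ l) has_sum
    (\<Sum>m=d..k. \<Sum>n=e..l. F $$ m * G $$ n * S (k - m) (l - n))) A"
proof -
  have "((\<lambda>a. \<Sum>m=d..k. \<Sum>n=e..l. F $$ m * G $$ n * (g a $$ (k - m) * h a $$ (l - n))) has_sum
    (\<Sum>m=d..k. \<Sum>n=e..l. F $$ m * G $$ n * S (k - m) (l - n))) A"
    by (intro has_sum_sum has_sum_cmult_right sums) auto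
  also have "?this \<longleftrightarrow> ?thesis"
  proof (rule has_sum_cong)
    fix a assume a: "a \<in> A"
    show "(\<Sum>m=d..k. \<Sum>n=e..l. F $$ m * G $$ n * (g a $$ (k - m) * h a $$ (l - n))) =
        (F * g a) $$ k * (G * h a) $$ l"
      by (subst (1 2) fls_mult_nth_window[OF _ _ order_refl])
        (auto simp: F G g[OF a] h[OF a] sum_product mult_ac)
  qed
  finally show ?thesis .
qed

lemma upper_sum:
  assumes vac: "vacuum_formulas \<alpha> \<beta>" and "i \<le> M" "j \<le> M"
  shows "\<exists>K0. \<forall>K\<ge>K0. ((\<lambda>a. (Finf i * Ginf a) $$ k * (G0 j * F0 a) $$ l) has_sum
    diag_sum K (Finf i / Uinf M) (G0 j * U0 M) (k - 1) (l - 1)) {M<..}"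
proof -
  let ?f = "\<lambda>a. (Finf i * Ginf a) $$ k * (G0 j * F0 a) $$ l"
  obtain d where d: "\<And>n. n < d \<Longrightarrow> Finf i $$ n = 0" using fls_lower_bound by blast
  obtain e where e: "\<And>n. n < e \<Longrightarrow> G0 j $$ n = 0" using fls_lower_bound by blast
  \<comment> \<open>\<open>Ginf a\<close> and \<open>F0 a\<close> are known to have no negative
    powers only for a \<ge> 1, so the tail starts above some N \<ge> 0.\<close>
  define N where "N = max M 0"
  have N: "N \<ge> 0" "N \<ge> M" by (auto simp: N_def)
  have "(?f has_sum
    diag_sum K (Finf i / Uinf M) (G0 j * U0 M) (k - 1) (l - 1)) {M<..}"
    \<comment> \<open>Convolution with \<open>Finf i\<close>, whose exponents start at d, produces
      indices up to k - d, for which \<open>upper_vacuum\<close> needs room;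
      \<open>upper_step\<close> needs room for k.\<close>
    if K: "K \<ge> nat (max (k - d) k)" for K
  proof -
    have "(?f has_sum
      (\<Sum>m=d..k. \<Sum>n=e..l. Finf i $$ m * G0 j $$ n *
        diag_sum K (1 / Uinf N) (U0 N) (k - m - 1) (l - n - 1))) {N<..}"
      by (rule has_sum_window[where S = "\<lambda>k l. diag_sum K (1 / Uinf N) (U0 N) (k - 1) (l - 1)"])
        (use N K in \<open>auto intro!: d e nonneg_Ginf nonneg_F0 upper_vacuum[OF vac]\<close>)
    also have "(\<Sum>m=d..k. \<Sum>n=e..l. Finf i $$ m * G0 j $$ n *
        diag_sum K (1 / Uinf N) (U0 N) (k - m - 1) (l - n - 1)) =
        diag_sum K (Finf i / Uinf N) (G0 j * U0 N) (k - 1) (l - 1)"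
    proof -
      have "Finf i * (fls_X * (1 / Uinf N)) = fls_X * (Finf i / Uinf N)"
        "G0 j * (fls_X * U0 N) = fls_X * (G0 j * U0 N)"
        by (simp_all add: mult_ac)
      then show ?thesis
        using diag_sum_mult[OF d e fls_nonneg_mult[OF fls_nonneg_X nonneg_inverse_Uinf[OF N(1)]]
            fls_nonneg_mult[OF fls_nonneg_X nonneg_U0[OF N(1)]], where K = K and k = k and l = l]
        by (simp only: diag_sum_shift)
    qed
    finally have sum_N: "(?f has_sum
        diag_sum K (Finf i / Uinf N) (G0 j * U0 N) (k - 1) (l - 1)) {N<..}" .
    have "M' \<ge> max i j \<Longrightarrow> (?f has_sum
        diag_sum K (Finf i / Uinf M') (G0 j * U0 M') (k - 1) (l - 1)) {M'<..}" if "M' \<le> N" for M'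
      using that
    proof (induction M' rule: int_le_induct)
      case base
      show ?case by (rule sum_N)
    next
      case (step a)
      have "(?f has_sum
          ((Finf i * Ginf a) $$ k * (G0 j * F0 a) $$ l +
          diag_sum K (Finf i / Uinf a) (G0 j * U0 a) (k - 1) (l - 1))) (insert a {a<..})"
        by (rule has_sum_insert) (use step in auto)
      also have "insert a {a<..} = {a - 1<..}" by auto
      also have "(Finf i * Ginf a) $$ k * (G0 j * F0 a) $$ l +
          diag_sum K (Finf i / Uinf a) (G0 j * U0 a) (k - 1) (l - 1) =
          diag_sum K (Finf i / Uinf (a - 1)) (G0 j * U0 (a - 1)) (k - 1) (l - 1)"
        by (rule upper_step[symmetric], rule nonneg_Finf_div_Uinf) (use step K in auto)
      finally show ?case .
    qed
    from this[of M] show ?thesis using assms N by auto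
  qed
  then show ?thesis by blast
qed

lemma lower_sum:
  assumes vac: "vacuum_formulas \<alpha> \<beta>" and "M < i" "M < j"
  shows "\<exists>K0. \<forall>K\<ge>K0. ((\<lambda>a. (Ginf j * Finf a) $$ k * (F0 i * G0 a) $$ l) has_sum
    diag_sum K (Uinf M * Ginf j) (F0 i / U0 M) k l) {..M}"
proof -
  let ?f = "\<lambda>a. (Ginf j * Finf a) $$ k * (F0 i * G0 a) $$ l"
  obtain d where d: "\<And>n. n < d \<Longrightarrow> Ginf j $$ n = 0" using fls_lower_bound by blast
  obtain e where e: "\<And>n. n < e \<Longrightarrow> F0 i $$ n = 0" using fls_lower_bound by blast
  define N where "N = min M 0"
  have N: "N \<le> 0" "N \<le> M" by (auto simp: N_def)
  have "(?f has_sum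
    diag_sum K (Uinf M * Ginf j) (F0 i / U0 M) k l) {..M}"
    if K: "K \<ge> nat (max (k - d) k)" for K
  proof -
    have "(?f has_sum
      (\<Sum>m=d..k. \<Sum>n=e..l. Ginf j $$ m * F0 i $$ n *
        diag_sum K (Uinf N) (1 / U0 N) (k - m) (l - n))) {..N}"
      by (rule has_sum_window)
        (use N K in \<open>auto intro!: d e nonneg_Finf nonneg_G0 lower_vacuum[OF vac]\<close>)
    also have "(\<Sum>m=d..k. \<Sum>n=e..l. Ginf j $$ m * F0 i $$ n *
        diag_sum K (Uinf N) (1 / U0 N) (k - m) (l - n)) =
        diag_sum K (Uinf N * Ginf j) (F0 i / U0 N) k l"
      using diag_sum_mult[OF d e nonneg_Uinf[OF N(1)] nonneg_inverse_U0[OF N(1)], where K = K and k = k and l = l]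
      by (simp add: mult.commute)
    finally have sum_N: "(?f has_sum
        diag_sum K (Uinf N * Ginf j) (F0 i / U0 N) k l) {..N}" .
    have "M' < min i j \<Longrightarrow> (?f has_sum
        diag_sum K (Uinf M' * Ginf j) (F0 i / U0 M') k l) {..M'}" if "N \<le> M'" for M'
      using that
    proof (induction M' rule: int_ge_induct)
      case base
      show ?case by (rule sum_N)
    next
      case (step a)
      have "(?f has_sum
          ((Ginf j * Finf (a + 1)) $$ k * (F0 i * G0 (a + 1)) $$ l +
          diag_sum K (Uinf a * Ginf j) (F0 i / U0 a) k l)) (insert (a + 1) {..a})"
        by (rule has_sum_insert) (use step in auto)
      also have "insert (a + 1) {..a} = {..a + 1}" by auto
      also have "(Ginf j * Finf (a + 1)) $$ k * (F0 i * G0 (a + 1)) $$ l +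
          diag_sum K (Uinf a * Ginf j) (F0 i / U0 a) k l =
          diag_sum K (Uinf (a + 1) * Ginf j) (F0 i / U0 (a + 1)) k l"
        using lower_step[of "a + 1" "Ginf j" k K "F0 i" l] nonneg_Uinf_mult_Ginf[of "a + 2" j] step.prems K
        by (simp add: mult.commute[of "Ginf j"] add.commute[of 1 a])
      finally show ?case .
    qed
    from this[of M] show ?thesis using assms N by auto
  qed
  then show ?thesis by blast
qed

text \<open>The diagonal needs its own clause: with \<alpha> = \<open>\<alpha> i\<close> and \<beta>
  = \<open>\<beta> i\<close>, the product of \<open>Finf i\<close> and \<open>Ginf i\<close> is 1/(1
  - \<beta>X) + \<alpha>/(X - \<alpha>), with poles on both sides of the annulus. The first part
  yields \<beta>^k, the second, expanded in z, the powers \<alpha>^l of \<open>Aminus\<close>. For i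
  < j only factors \<open>den\<close> remain in the denominator.\<close>

definition Aplus :: "nat \<Rightarrow> int \<Rightarrow> int \<Rightarrow> complex" where
  "Aplus k i j = (if i = j then \<beta> i ^ k else if i < j then (Finf i * Ginf j) $$ int k else 0)"

definition Aminus :: "nat \<Rightarrow> int \<Rightarrow> int \<Rightarrow> complex" where
  "Aminus l i j = (if i = j then \<alpha> i ^ l else if j < i then (F0 i * G0 j) $$ int l else 0)"

lemma diag_sum_geometric':
  assumes "0 \<le> l" "l \<le> int K"
  shows "diag_sum K (1 / den a) (nom a * f) l k =
    f $$ (k - l - 1) - a ^ nat (l + 1) * f $$ k"
  using diag_sum_geometric[OF assms] diag_sum_commute by metis

text \<open>Both boundary terms of the telescoping sums for the off-diagonal entry \<open>(i, j)\<close> equal the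
  coefficient of \<open>A\<^sup>k\<^sup>-\<^sup>l\<close>.\<close>

lemma upper_total:
  assumes k: "k \<ge> 1" and l: "l \<ge> 1" and K: "K \<ge> k + l"
  shows "Aplus k i (max i j) * Aminus l (max i j) j +
      diag_sum K (Finf i / Uinf (max i j)) (G0 j * U0 (max i j)) (int k - 1) (int l - 1) =
    (if i < j then (Finf i * Ginf j) $$ (int k - int l)
     else if j < i then (F0 i * G0 j) $$ (int l - int k)
     else \<alpha> i ^ l * \<beta> i ^ k + (1 - \<alpha> i * \<beta> i) *
       diag_sum K (1 / den (\<beta> i)) (1 / den (\<alpha> i)) (int k - 1) (int l - 1))"
proof -
  have diag: "Finf i / Uinf i = 1 / den (\<beta> i)"
    "G0 j * U0 j = fls_const (1 - \<alpha> j * \<beta> j) * (1 / den (\<alpha> j))"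
    by (simp_all add: Finf_eq G0_eq Uinf_rec[of i] U0_rec[of j])
  consider "i < j" | "j < i" | "i = j" by linarith
  then show ?thesis
  proof cases
    case 1
    \<comment> \<open>Dividing out the factor X of \<open>Ginf j\<close> brings the boundary term
      into the form of \<open>diag_sum_geometric\<close>; reading off coefficients of ?R restores
      the index.\<close>
    let ?R = "inverse fls_X * (Finf i * Ginf j)"
    have "fls_const (1 - \<alpha> j * \<beta> j) * (Finf i / Uinf j) = nom (\<alpha> j) * ?R"
      by (simp add: Ginf_eq Uinf_rec[of j] del: fls_inverse_X)
    then have "diag_sum K (Finf i / Uinf j) (G0 j * U0 j) (int k - 1) (int l - 1) =
        diag_sum K (nom (\<alpha> j) * ?R) (1 / den (\<alpha> j)) (int k - 1) (int l - 1)"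
      by (metis diag(2) diag_sum_const)
    also have "\<dots> = ?R $$ (int k - int l - 1) - \<alpha> j ^ l * ?R $$ (int k - 1)"
      using diag_sum_geometric[of "int l - 1" K "\<alpha> j" ?R "int k - 1"] l K by (simp add: algebra_simps)
    also have "\<dots> = (Finf i * Ginf j) $$ (int k - int l) - \<alpha> j ^ l * (Finf i * Ginf j) $$ int k"
      by (simp only: fls_inverse_X_times_nth) simp
    finally show ?thesis using 1 by (simp add: Aplus_def Aminus_def)
  next
    case 2
    let ?R = "inverse fls_X * (F0 i * G0 j)"
    have "G0 j * U0 i = nom (\<beta> i) * ?R"
      by (simp add: F0_eq U0_rec[of i] del: fls_inverse_X)
    then have "diag_sum K (Finf i / Uinf i) (G0 j * U0 i) (int k - 1) (int l - 1) =
        diag_sum K (1 / den (\<beta> i)) (nom (\<beta> i) * ?R) (int k - 1) (int l - 1)"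
      by (simp only: diag)
    also have "\<dots> = ?R $$ (int l - int k - 1) - \<beta> i ^ k * ?R $$ (int l - 1)"
      using diag_sum_geometric'[of "int k - 1" K "\<beta> i" ?R "int l - 1"] k K by (simp add: algebra_simps)
    also have "\<dots> = (F0 i * G0 j) $$ (int l - int k) - \<beta> i ^ k * (F0 i * G0 j) $$ int l"
      by (simp only: fls_inverse_X_times_nth) simp
    finally show ?thesis using 2 by (simp add: Aplus_def Aminus_def)
  next
    case 3
    then show ?thesis unfolding \<open>i = j\<close> diag[unfolded \<open>i = j\<close>] max.idem diag_sum_const
      by (simp add: Aplus_def Aminus_def)
  qed
qed

lemma lower_total:
  assumes k: "k \<ge> 1" and l: "l \<ge> 1" and K: "K \<ge> k + l"
  shows "Aplus k (min i j) j * Aminus l i (min i j) +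
      diag_sum K (Uinf (min i j - 1) * Ginf j) (F0 i / U0 (min i j - 1)) (int k) (int l) =
    (if i < j then (Finf i * Ginf j) $$ (int k - int l)
     else if j < i then (F0 i * G0 j) $$ (int l - int k)
     else \<alpha> i ^ l * \<beta> i ^ k + (1 - \<alpha> i * \<beta> i) *
       diag_sum K (1 / den (\<beta> i)) (1 / den (\<alpha> i)) (int k - 1) (int l - 1))"
proof -
  have diag: "Uinf (j - 1) * Ginf j = fls_const (1 - \<alpha> j * \<beta> j) * (fls_X * (1 / den (\<beta> j)))"
    "F0 i / U0 (i - 1) = fls_X * (1 / den (\<alpha> i))"
    by (simp_all add: Ginf_eq F0_eq)
  consider "i < j" | "j < i" | "i = j" by linarith
  then show ?thesis
  proof cases
    case 1
    let ?R = "Finf i * Ginf j"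
    have "Uinf (i - 1) * Ginf j = nom (\<alpha> i) * ?R"
      by (simp add: Finf_eq)
    then have "diag_sum K (Uinf (i - 1) * Ginf j) (F0 i / U0 (i - 1)) (int k) (int l) =
        diag_sum K (nom (\<alpha> i) * ?R) (1 / den (\<alpha> i)) (int k) (int l - 1)"
      by (simp only: diag diag_sum_shift)
    also have "\<dots> = ?R $$ (int k - int l) - \<alpha> i ^ l * ?R $$ int k"
      using diag_sum_geometric[of "int l - 1" K "\<alpha> i" ?R "int k"] l K by (simp add: algebra_simps)
    finally show ?thesis using 1 by (simp add: Aplus_def Aminus_def)
  next
    case 2
    let ?R = "F0 i * G0 j"
    have "fls_const (1 - \<alpha> j * \<beta> j) * (F0 i / U0 (j - 1)) = nom (\<beta> j) * ?R"
      by (simp add: G0_eq)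
    then have "diag_sum K (Uinf (j - 1) * Ginf j) (F0 i / U0 (j - 1)) (int k) (int l) =
        diag_sum K (1 / den (\<beta> j)) (nom (\<beta> j) * ?R) (int k - 1) (int l)"
      by (metis diag(1) diag_sum_const diag_sum_shift(1))
    also have "\<dots> = ?R $$ (int l - int k) - \<beta> j ^ k * ?R $$ int l"
      using diag_sum_geometric'[of "int k - 1" K "\<beta> j" ?R "int l"] k K by (simp add: algebra_simps)
    finally show ?thesis using 2 by (simp add: Aplus_def Aminus_def)
  next
    case 3
    then show ?thesis unfolding \<open>i = j\<close> diag[unfolded \<open>i = j\<close>] min.idem diag_sum_const diag_sum_shift
      by (simp add: Aplus_def Aminus_def)
  qed
qed

text \<open>Both matrices are triangular, in opposite senses, so only a \<ge> max i j contributes in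
  one order and only a \<le> min i j in the other. The extreme a involves a diagonal entry and is
  split off; the rest is a telescoping sum.\<close>

lemma A_commute:
  assumes vac: "vacuum_formulas \<alpha> \<beta>" and k: "k \<ge> 1" and l: "l \<ge> 1"
  shows "\<exists>s. ((\<lambda>a. Aplus k i a * Aminus l a j) has_sum s) UNIV \<and>
    ((\<lambda>a. Aminus l i a * Aplus k a j) has_sum s) UNIV"
proof -
  define M where "M = max i j"
  define m where "m = min i j"
  let ?fu = "\<lambda>a. (Finf i * Ginf a) $$ int k * (G0 j * F0 a) $$ int l"
  let ?fd = "\<lambda>a. (Ginf j * Finf a) $$ int k * (F0 i * G0 a) $$ int l"
  let ?pu = "\<lambda>a. Aplus k i a * Aminus l a j"
  let ?pd = "\<lambda>a. Aminus l i a * Aplus k a j"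
  let ?u = "\<lambda>K. diag_sum K (Finf i / Uinf M) (G0 j * U0 M) (int k - 1) (int l - 1)"
  let ?d = "\<lambda>K. diag_sum K (Uinf (m - 1) * Ginf j) (F0 i / U0 (m - 1)) (int k) (int l)"
  obtain K1 where K1: "\<And>K. K \<ge> K1 \<Longrightarrow> (?fu has_sum
    ?u K) {M<..}"
    using upper_sum[OF vac, of i M j k l] by (auto simp: M_def)
  have m: "m - 1 < i" "m - 1 < j" by (auto simp: m_def)
  obtain K2 where K2: "\<And>K. K \<ge> K2 \<Longrightarrow> (?fd has_sum
    ?d K) {..m - 1}"
    using lower_sum[OF vac m, of k l] by blast
  \<comment> \<open>One truncation that is valid for both telescoping sums; k + l is what the
    evaluation of their boundary terms requires.\<close>
  define K where "K = max (max K1 K2) (k + l)"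
  have "(?pu has_sum (Aplus k i M * Aminus l M j +
      ?u K)) (insert M {M<..})"
  proof (rule has_sum_insert)
    have "(?pu has_sum s) {M<..} \<longleftrightarrow>
      (?fu has_sum s) {M<..}" for s
      by (rule has_sum_cong) (auto simp: M_def Aplus_def Aminus_def mult.commute)
    then show "(?pu has_sum
        ?u K) {M<..}"
      using K1[of K] by (simp add: K_def)
  qed auto
  also have "?this \<longleftrightarrow> (?pu has_sum (Aplus k i M * Aminus l M j +
      ?u K)) UNIV"
    by (rule has_sum_cong_neutral) (auto simp: M_def Aplus_def Aminus_def)
  finally have upper: \<dots> .
  have "(?pd has_sum (Aminus l i m * Aplus k m j +
      ?d K)) (insert m {..m - 1})"
  proof (rule has_sum_insert)
    have "(?pd has_sum s) {..m - 1} \<longleftrightarrow>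
      (?fd has_sum s) {..m - 1}" for s
      by (rule has_sum_cong) (auto simp: m_def Aplus_def Aminus_def mult.commute)
    then show "(?pd has_sum
        ?d K) {..m - 1}"
      using K2[of K] by (simp add: K_def)
  qed auto
  also have "?this \<longleftrightarrow> (?pd has_sum (Aminus l i m * Aplus k m j +
      ?d K)) UNIV"
    by (rule has_sum_cong_neutral) (auto simp: m_def Aplus_def Aminus_def)
  finally have lower: \<dots> .
  have "K \<ge> k + l" by (simp add: K_def)
  then have "Aplus k i M * Aminus l M j +
      ?u K =
      Aminus l i m * Aplus k m j +
      ?d K"
    using upper_total[OF k l, of K i j] lower_total[OF k l, of K i j]
    by (simp add: M_def m_def mult.commute)
  with upper lower show ?thesis by auto
qed

end

section \<open>Coefficients of the currents\<close>

text \<open>Summable complex families are absolutely summable, hence so is the family of products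
  over the rectangle.\<close>

lemma has_sum_mult_Times:
  fixes f :: "'i \<Rightarrow> complex" and g :: "'j \<Rightarrow> complex"
  assumes f: "(f has_sum a) A" and g: "(g has_sum b) B"
  shows "((\<lambda>(i, j). f i * g j) has_sum a * b) (A \<times> B)"
proof -
  have "(\<lambda>(i, j). f i * g j) abs_summable_on (A \<times> B)"
    unfolding abs_summable_on_Sigma_iff
    using has_sum_imp_summable[OF f] has_sum_imp_summable[OF g]
    by (auto simp: norm_mult summable_on_iff_abs_summable_on_complex infsum_cmult_right'
         abs_mult infsum_nonneg
         intro!: summable_on_cmult_left summable_on_cmult_right)
  then have "(\<lambda>(i, j). f i * g j) summable_on (A \<times> B)"
    by (rule abs_summable_summable)
  then obtain s where s: "((\<lambda>(i, j). f i * g j) has_sum s) (A \<times> B)"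
    by (auto simp: summable_on_def)
  have "((\<lambda>i. f i * b) has_sum s) A"
    by (rule has_sum_Sigma'[OF s]) (simp add: has_sum_cmult_right g)
  with has_sum_cmult_left[OF f, of b] have "s = a * b"
    using has_sum_unique by blast
  with s show ?thesis by simp
qed

section \<open>Generating functions of elementary and complete symmetric polynomials\<close>

lemma prod_fps_const: "(\<Prod>x\<in>A. fps_const (f x)) = fps_const (\<Prod>x\<in>A. f x)"
  for f :: "'a \<Rightarrow> 'b::comm_ring_1"
  by (induction A rule: infinite_finite_induct) (simp_all add: fps_const_mult)

lemma esym_sum_Pow:
  assumes "finite J"
  shows "(\<Prod>a\<in>J. fps_X + fps_const (y a)) $ t = (if t \<le> card J then esym (card J - t) J y else 0)"
proof -
  have "(\<Prod>a\<in>J. fps_X + fps_const (y a)) = (\<Sum>S\<in>Pow J. fps_const (\<Prod>a\<in>S. y a) * fps_X ^ (card J - card S))"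
    unfolding add.commute[of fps_X] prod_add[OF assms]
  proof (rule sum.cong[OF refl])
    fix S assume "S \<in> Pow J"
    then have "finite S" "card (J - S) = card J - card S"
      using assms by (auto simp: card_Diff_subset finite_subset)
    then show "(\<Prod>x\<in>S. fps_const (y x)) * (\<Prod>x\<in>J - S. fps_X) =
        fps_const (\<Prod>a\<in>S. y a) * fps_X ^ (card J - card S)"
      by (simp add: prod_fps_const)
  qed
  then have "(\<Prod>a\<in>J. fps_X + fps_const (y a)) $ t =
      (\<Sum>S\<in>Pow J. if card J - card S = t then \<Prod>a\<in>S. y a else 0)"
    by (simp add: fps_sum_nth if_distrib eq_commute cong: if_cong)
  also have "\<dots> = (\<Sum>S | S \<subseteq> J \<and> card J - card S = t. \<Prod>a\<in>S. y a)"
    using assms by (intro sum.mono_neutral_cong_right) auto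
  also have "\<dots> = (if t \<le> card J then esym (card J - t) J y else 0)"
  proof (cases "t \<le> card J")
    case True
    then have "{S. S \<subseteq> J \<and> card J - card S = t} = {S. S \<subseteq> J \<and> card S = card J - t}"
      using assms by (auto dest: card_mono)
    with True show ?thesis by (simp add: esym_def)
  next
    case False
    then have "{S. S \<subseteq> J \<and> card J - card S = t} = {}" by auto
    then show ?thesis using False by (simp only: sum.empty if_False)
  qed
  finally show ?thesis .
qed

lemma hsym_insert:
  assumes "finite I" "a \<notin> I"
  shows "hsym n (insert a I) x = (\<Sum>m\<le>n. x a ^ m * hsym (n - m) I x)"
proof -
  have "hsym n (insert a I) x = (\<Sum>(m, M)\<in>(SIGMA m:{0..n}. multisets_of_size I (n - m)).
      \<Prod>i\<in>#(M + replicate_mset m a). x i)"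
    unfolding hsym_def
    by (subst sum.reindex_bij_betw[OF bij_betw_multisets_of_size_insert[OF assms(2)], symmetric])
      (simp add: case_prod_unfold)
  also have "\<dots> = (\<Sum>m\<in>{0..n}. \<Sum>M\<in>multisets_of_size I (n - m). \<Prod>i\<in>#(M + replicate_mset m a). x i)"
    by (rule sum.Sigma[symmetric]) (auto intro: finite_multisets_of_size assms)
  also have "\<dots> = (\<Sum>m\<le>n. x a ^ m * hsym (n - m) I x)"
    by (simp add: hsym_def sum_distrib_left atLeast0AtMost mult.commute)
  finally show ?thesis .
qed

lemma hsym_generating:
  assumes "finite I"
  shows "(1 / (\<Prod>a\<in>I. den (x a))) = fps_to_fls (Abs_fps (\<lambda>s. hsym s I x))"
  using assms
proof (induction I rule: finite_induct)
  case empty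
  have "Abs_fps (\<lambda>s. hsym s {} x) = 1"
    by (rule fps_ext) (auto simp: hsym_def)
  then show ?case by simp
next
  case (insert a I)
  have "1 / (\<Prod>a\<in>insert a I. den (x a)) =
      (1 / den (x a)) * (1 / (\<Prod>a\<in>I. den (x a)))"
    using insert.hyps by simp
  also have "\<dots> = fps_to_fls (Abs_fps (\<lambda>n. x a ^ n) * Abs_fps (\<lambda>s. hsym s I x))"
    by (simp add: insert.IH fls_geometric fls_times_fps_to_fls)
  also have "Abs_fps (\<lambda>n. x a ^ n) * Abs_fps (\<lambda>s. hsym s I x) = Abs_fps (\<lambda>s. hsym s (insert a I) x)"
    by (rule fps_ext) (simp add: hsym_insert insert.hyps fps_mult_nth atLeast0AtMost)
  finally show ?case .
qed

text \<open>In the numerator e_r(-y) stands with X^(card J - r), in the inverse denominator h_s(x)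
  stands with X^s; with the extra factor X, exponent k forces r - s = card J + 1 - k.\<close>

lemma esym_hsym_coeff:
  assumes "finite I" "finite J" and k: "k \<ge> 1"
  shows "(fls_X * (\<Prod>a\<in>J. nom (y a)) / (\<Prod>a\<in>I. den (x a))) $$ int k =
    (\<Sum>(r, s) | int r - int s = int (card J) + 1 - int k \<and> r \<le> card J.
       esym r J (\<lambda>a. - y a) * hsym s I x)"
proof -
  define n where "n = card J"
  have "(\<Prod>a\<in>J. nom (y a)) = fps_to_fls (\<Prod>a\<in>J. fps_X + fps_const (- y a))"
    using \<open>finite J\<close>
    by (induction J rule: finite_induct) (simp_all add: fls_times_fps_to_fls flip: fls_minus_const)
  then have "fls_X * (\<Prod>a\<in>J. nom (y a)) / (\<Prod>a\<in>I. den (x a)) =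
      fls_X * fps_to_fls ((\<Prod>a\<in>J. fps_X + fps_const (- y a)) * Abs_fps (\<lambda>s. hsym s I x))"
    by (simp only: fls_times_fps_to_fls hsym_generating[OF assms(1), of x, symmetric] mult.assoc
        times_divide_eq_right mult_1_right)
  then have "(fls_X * (\<Prod>a\<in>J. nom (y a)) / (\<Prod>a\<in>I. den (x a))) $$ int k =
      ((\<Prod>a\<in>J. fps_X + fps_const (- y a)) * Abs_fps (\<lambda>s. hsym s I x)) $ (k - 1)"
    using k by (simp add: fls_X_times_nth of_nat_diff nat_diff_distrib')
  also have "\<dots> = (\<Sum>t=0..k - 1. if t \<le> n then esym (n - t) J (\<lambda>a. - y a) * hsym (k - 1 - t) I x else 0)"
    unfolding fps_mult_nth esym_sum_Pow[OF assms(2)] by (rule sum.cong) (auto simp: n_def)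
  also have "\<dots> = (\<Sum>t | t \<le> k - 1 \<and> t \<le> n. esym (n - t) J (\<lambda>a. - y a) * hsym (k - 1 - t) I x)"
    by (rule sum.mono_neutral_cong_right) auto
  also have "\<dots> = (\<Sum>(r, s) | int r - int s = int n + 1 - int k \<and> r \<le> n.
       esym r J (\<lambda>a. - y a) * hsym s I x)"
    by (rule sum.reindex_bij_witness[of _ "\<lambda>(r, s). n - r" "\<lambda>t. (n - t, k - 1 - t)"])
      (use k in auto)
  finally show ?thesis by (simp add: n_def)
qed

context deformation
begin

lemma Finf_div_Uinf_prod:
  "i \<le> k \<Longrightarrow> Finf i / Uinf k =
    (\<Prod>a\<in>{i+1..k}. nom (\<alpha> a)) / (\<Prod>a\<in>{i..k}. den (\<beta> a))"
proof (induction k rule: int_ge_induct)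
  case base
  show ?case by (simp add: Finf_eq Uinf_rec[of i])
next
  case (step k)
  have "{i+1..k+1} = insert (k+1) {i+1..k}" "{i..k+1} = insert (k+1) {i..k}" using step.hyps by auto
  moreover have "Finf i / Uinf (k + 1) = Finf i / Uinf k * nom (\<alpha> (k + 1)) / den (\<beta> (k + 1))"
    by (simp add: Uinf_rec[of "k + 1"])
  ultimately show ?case using step.IH by (simp add: mult_ac)
qed

lemma U0_mult_G0_prod:
  "j \<le> k \<Longrightarrow> U0 k * G0 j = fls_const (1 - \<alpha> j * \<beta> j) *
    ((\<Prod>a\<in>{j+1..k}. nom (\<beta> a)) / (\<Prod>a\<in>{j..k}. den (\<alpha> a)))"
proof (induction k rule: int_ge_induct)
  case base
  show ?case by (simp add: G0_eq U0_rec[of j])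
next
  case (step k)
  have "{j+1..k+1} = insert (k+1) {j+1..k}" "{j..k+1} = insert (k+1) {j..k}" using step.hyps by auto
  moreover have "U0 (k + 1) * G0 j = U0 k * G0 j * nom (\<beta> (k + 1)) / den (\<alpha> (k + 1))"
    by (simp add: U0_rec[of "k + 1"])
  ultimately show ?case using step.IH by simp (simp add: mult_ac)
qed

text \<open>For i < j the product of \<open>Finf i\<close> and \<open>Ginf j\<close> is, up to the
  scalar and a factor X, the product of \<open>nom\<close> strictly between i and j over the product
  of \<open>den\<close> from i to j inclusive; these are the variable ranges of the e- and
  h-polynomials in \<open>current_coeff\<close>.\<close>

lemma current_coeff_plus:
  assumes "k \<ge> 1"
  shows "current_coeff \<alpha> \<beta> (int k) i j = Aplus k i j"
proof (cases "i < j")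
  case True
  then have "{i..j} = insert j {i..j-1}" "card {i+1..j-1} = nat (j - i - 1)" by auto
  have "Finf i * Ginf j = (Finf i / Uinf (j - 1)) * (fls_const (1 - \<alpha> j * \<beta> j) * fls_X / den (\<beta> j))"
    by (simp add: Ginf_eq)
  also have "\<dots> = fls_const (1 - \<alpha> j * \<beta> j) * (fls_X *
      (\<Prod>a\<in>{i+1..j-1}. nom (\<alpha> a)) / (\<Prod>a\<in>{i..j}. den (\<beta> a)))"
    using True by (subst Finf_div_Uinf_prod) (simp_all add: \<open>{i..j} = _\<close> mult_ac)
  finally have "(Finf i * Ginf j) $$ int k = (1 - \<alpha> j * \<beta> j) *
    (\<Sum>(r, s) | int r - int s = int (nat (j - i - 1)) + 1 - int k \<and> r \<le> nat (j - i - 1).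
             esym r {i+1..j-1} (\<lambda>a. - \<alpha> a) * hsym s {i..j} \<beta>)"
    using esym_hsym_coeff[of "{i..j}" "{i+1..j-1}" k \<alpha> \<beta>] assms
    by (simp only: fls_mult_const_nth \<open>card _ = _\<close> finite_atLeastAtMost_int simp_thms)
  moreover have "{(r, s). int r - int s = int (nat (j - i - 1)) + 1 - int k \<and> r \<le> nat (j - i - 1)} =
      {(r, s). int r - int s = j - i - int k \<and> int r \<le> j - i - 1}"
    using True by auto
  ultimately show ?thesis using True assms by (simp add: Aplus_def current_coeff_def)
qed (use assms in \<open>auto simp: Aplus_def current_coeff_def\<close>)

lemma current_coeff_minus:
  assumes "k \<ge> 1"
  shows "current_coeff \<alpha> \<beta> (- int k) i j = Aminus k i j"
proof (cases "j < i")
  case True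
  then have "{j..i} = insert i {j..i-1}" "card {j+1..i-1} = nat (i - j - 1)" by auto
  have "F0 i * G0 j = (U0 (i - 1) * G0 j) * (fls_X / den (\<alpha> i))"
    by (simp add: F0_eq)
  also have "\<dots> = fls_const (1 - \<alpha> j * \<beta> j) * (fls_X *
      (\<Prod>a\<in>{j+1..i-1}. nom (\<beta> a)) / (\<Prod>a\<in>{j..i}. den (\<alpha> a)))"
    using True by (subst U0_mult_G0_prod) (simp_all add: \<open>{j..i} = _\<close> mult_ac)
  finally have "(F0 i * G0 j) $$ int k = (1 - \<alpha> j * \<beta> j) *
    (\<Sum>(r, s) | int r - int s = int (nat (i - j - 1)) + 1 - int k \<and> r \<le> nat (i - j - 1).
             esym r {j+1..i-1} (\<lambda>a. - \<beta> a) * hsym s {j..i} \<alpha>)"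
    using esym_hsym_coeff[of "{j..i}" "{j+1..i-1}" k \<beta> \<alpha>] assms
    by (simp only: fls_mult_const_nth \<open>card _ = _\<close> finite_atLeastAtMost_int simp_thms)
  also have "(\<Sum>(r, s) | int r - int s = int (nat (i - j - 1)) + 1 - int k \<and> r \<le> nat (i - j - 1).
             esym r {j+1..i-1} (\<lambda>a. - \<beta> a) * hsym s {j..i} \<alpha>) =
     (\<Sum>(r, s) | int r - int s = j - i - - int k \<and> int s \<le> i - j - 1.
             hsym r {j..i} \<alpha> * esym s {j+1..i-1} (\<lambda>a. - \<beta> a))"
    \<comment> \<open>In the negative currents r belongs to h and s to e, so the two indices change
      places.\<close>
    by (rule sum.reindex_bij_witness[of _ "\<lambda>(r, s). (s, r)" "\<lambda>(r, s). (s, r)"]) (use True in auto)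
  finally show ?thesis using True assms by (simp add: Aminus_def current_coeff_def)
qed (use assms in \<open>auto simp: Aminus_def current_coeff_def\<close>)

lemma Aplus_eq_0: "j < i \<Longrightarrow> Aplus k i j = 0"
  and Aminus_eq_0: "i < j \<Longrightarrow> Aminus k i j = 0"
  by (simp_all add: Aplus_def Aminus_def)

text \<open>The central term of the commutator, produced by normal ordering.\<close>

lemma A_cocycle:
  assumes vac: "vacuum_formulas \<alpha> \<beta>"
  shows "((\<lambda>(i, j). Aplus k i j * Aminus l j i) has_sum (if k = l then of_nat k else 0)) ({..0} \<times> {1..})"
proof -
  define f where "f m n i = Finf i $$ m * G0 i $$ n" for m n i
  define g where "g m n j = Ginf j $$ m * F0 j $$ n" for m n j
  have f: "(f m n has_sum (if m = n \<and> n \<ge> 0 then 1 else 0)) {..0}" for m n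
    unfolding f_def by (rule vacuum_nonpos[OF vac])
  have g: "(g m n has_sum (if m = n \<and> n \<ge> 1 then 1 else 0)) {1..}" for m n
    unfolding g_def by (rule vacuum_pos[OF vac])
  have fg: "((\<lambda>(i, j). f m n i * g m' n' j) has_sum
      ((if m = n \<and> n \<ge> 0 then 1 else 0) * (if m' = n' \<and> n' \<ge> 1 then 1 else 0))) ({..0} \<times> {1..})" for m n m' n'
    by (rule has_sum_mult_Times[OF f g])
  \<comment> \<open>For i \<le> 0 < j all four field series have no negative powers. Both entries
    are then finite convolutions, and each of their terms factors into a vacuum sum over i times a
    vacuum sum over j.\<close>
  let ?s = "\<Sum>m=0..int k. \<Sum>n=0..int l. (if m = n \<and> n \<ge> 0 then 1 else 0) *
    (if int k - m = int l - n \<and> int l - n \<ge> 1 then 1 else 0) :: complex"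
  have "((\<lambda>(i, j). \<Sum>m=0..int k. \<Sum>n=0..int l. f m n i * g (int k - m) (int l - n) j) has_sum
    ?s) ({..0} \<times> {1..})"
    unfolding case_prod_unfold
    by (intro has_sum_sum fg[unfolded case_prod_unfold])
  also have "?this \<longleftrightarrow> ((\<lambda>(i, j). Aplus k i j * Aminus l j i) has_sum
    ?s) ({..0} \<times> {1..})"
  proof (rule has_sum_cong, clarify)
    fix i j :: int assume ij: "i \<le> 0" "1 \<le> j"
    have "Aplus k i j = (\<Sum>m=0..int k. Finf i $$ m * Ginf j $$ (int k - m))"
      using ij fls_mult_nth_window[of 0 "Finf i" "Ginf j" "int k" "int k"] nonneg_Finf[of i] nonneg_Ginf[of j]
      by (simp add: Aplus_def fls_nonneg_def)
    moreover have "Aminus l j i = (\<Sum>n=0..int l. G0 i $$ n * F0 j $$ (int l - n))"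
      using ij fls_mult_nth_window[of 0 "G0 i" "F0 j" "int l" "int l"] nonneg_G0[of i] nonneg_F0[of j]
      by (simp add: Aminus_def fls_nonneg_def mult.commute)
    ultimately show "(\<Sum>m=0..int k. \<Sum>n=0..int l. f m n i * g (int k - m) (int l - n) j) =
        Aplus k i j * Aminus l j i"
      by (simp add: sum_product f_def g_def mult_ac)
  qed
  also have "?s = (if k = l then of_nat k else 0 :: complex)"
  proof -
    \<comment> \<open>The conditions force n = m and k = l. The sum over j > 0 vanishes below
      exponent 1, which excludes m = k and leaves the k values 0, ..., k - 1.\<close>
    have "?s =
       (\<Sum>m=0..int k. \<Sum>n=0..int l. if n = m then (if k = l \<and> m < int k then 1 else 0) else (0::complex))"
      by (intro sum.cong) auto
    also have "\<dots> = (\<Sum>m=0..int k. if m \<le> int l then (if k = l \<and> m < int k then 1 else 0) else 0)"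
      by (rule sum.cong) auto
    also have "\<dots> = (\<Sum>m\<in>(if k = l then {0..<int k} else {}). 1)"
      by (rule sum.mono_neutral_cong_right) (auto split: if_splits)
    finally show ?thesis by simp
  qed
  finally show ?thesis .
qed

end

section \<open>Canonical anticommutation relations\<close>

definition up_finite :: "int set \<Rightarrow> bool"
  where "up_finite S \<longleftrightarrow> (\<forall>t. finite {s \<in> S. t < s})"

lemma up_finite_insert [simp]: "up_finite S \<Longrightarrow> up_finite (insert i S)"
proof -
  assume S: "up_finite S"
  have "{s \<in> insert i S. t < s} \<subseteq> insert i {s \<in> S. t < s}" for t by auto
  with S show ?thesis
    unfolding up_finite_def by (meson finite_insert finite_subset)
qed

lemma up_finite_Diff [simp]: "up_finite S \<Longrightarrow> up_finite (S - {i})"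
proof -
  assume S: "up_finite S"
  have "{s \<in> S - {i}. t < s} \<subseteq> {s \<in> S. t < s}" for t by auto
  with S show ?thesis
    unfolding up_finite_def by (meson finite_subset)
qed

definition wsign :: "int \<Rightarrow> int set \<Rightarrow> complex"
  where "wsign i S = (-1) ^ card {s \<in> S. i < s}"

lemma wsign_square: "wsign i S * wsign i S = 1"
  by (simp add: wsign_def flip: power_add mult_2)

lemma wsign_insert:
  assumes "up_finite S" "j \<notin> S"
  shows "wsign i (insert j S) = (if i < j then - wsign i S else wsign i S)"
proof (cases "i < j")
  case True
  then have "{s \<in> insert j S. i < s} = insert j {s \<in> S. i < s}" by auto
  with True assms show ?thesis by (simp add: wsign_def up_finite_def)
next
  case False
  then have "{s \<in> insert j S. i < s} = {s \<in> S. i < s}" by auto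
  with False show ?thesis by (simp add: wsign_def)
qed

lemma wsign_Diff:
  assumes "up_finite S" "j \<in> S"
  shows "wsign i (S - {j}) = (if i < j then - wsign i S else wsign i S)"
  using wsign_insert[of "S - {j}" j i] assms by (simp add: insert_absorb)

lemma psi_eq: "psi j f S = (if j \<in> S then wsign j S * f (S - {j}) else 0)"
  by (simp add: psi_def wsign_def)

lemma psi_star_eq: "psi_star j f S = (if j \<notin> S then wsign j S * f (insert j S) else 0)"
  by (simp add: psi_star_def wsign_def)

text \<open>The sign of a wedge is meaningful only for sets with finitely many elements above each
  integer, so the canonical anticommutation relations are stated at such sets.\<close>

lemma psi_anticommute:
  assumes "up_finite S"
  shows "psi i (psi j f) S = - psi j (psi i f) S"
proof (cases "i = j \<or> i \<notin> S \<or> j \<notin> S")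
  case False
  then have "S - {i} - {j} = S - {j} - {i}" by auto
  with False assms show ?thesis
    by (cases i j rule: linorder_cases) (auto simp: psi_eq wsign_Diff)
qed (auto simp: psi_eq)

lemma psi_star_anticommute:
  assumes "up_finite S"
  shows "psi_star i (psi_star j f) S = - psi_star j (psi_star i f) S"
proof (cases "i = j \<or> i \<in> S \<or> j \<in> S")
  case False
  then have "insert i (insert j S) = insert j (insert i S)" by auto
  with False assms show ?thesis
    by (cases i j rule: linorder_cases) (auto simp: psi_star_eq wsign_insert)
qed (auto simp: psi_star_eq)

lemma psi_star_psi:
  assumes "up_finite S"
  shows "psi_star j (psi i f) S = (if i = j then f S else 0) - psi i (psi_star j f) S"
proof (cases "i = j")
  case True
  with assms show ?thesis
    by (cases "i \<in> S")
      (auto simp: psi_eq psi_star_eq wsign_insert wsign_Diff insert_absorb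
        wsign_square mult.assoc[symmetric])
next
  case False
  then have "i \<in> S \<Longrightarrow> insert j S - {i} = insert j (S - {i})" by auto
  with False assms show ?thesis
    by (cases i j rule: linorder_cases)
      (auto simp: psi_eq psi_star_eq wsign_insert wsign_Diff)
qed

text \<open>The anticommutation relations hold at \<open>up_finite\<close> sets only, so they are
  not equations between functions and cannot be rewritten under an operator; this transfers them
  there.\<close>

lemma psi_cong:
  assumes "up_finite S" "\<And>T. up_finite T \<Longrightarrow> f T = g T"
  shows "psi i f S = psi i g S"
  using assms by (simp add: psi_eq)

lemma psi_star_cong:
  assumes "up_finite S" "\<And>T. up_finite T \<Longrightarrow> f T = g T"
  shows "psi_star i f S = psi_star i g S"
  using assms by (simp add: psi_star_eq)

lemma psi_linear:
  "psi i (\<lambda>S. f S - g S) S = psi i f S - psi i g S"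
  "psi i (\<lambda>S. - f S) S = - psi i f S"
  "psi i (\<lambda>S. c * f S) S = c * psi i f S"
  "psi i (\<lambda>S. if b then f S else 0) S = (if b then psi i f S else 0)"
  by (auto simp: psi_eq algebra_simps)

lemma psi_star_linear:
  "psi_star i (\<lambda>S. f S - g S) S = psi_star i f S - psi_star i g S"
  "psi_star i (\<lambda>S. - f S) S = - psi_star i f S"
  "psi_star i (\<lambda>S. c * f S) S = c * psi_star i f S"
  by (auto simp: psi_star_eq algebra_simps)

text \<open>Moving the second creation operator to the left in each product leaves a contraction and
  a quartic term; the two quartic terms differ by exchanging both pairs, hence by two signs, and
  cancel.\<close>

lemma bilinear_commutator:
  assumes S: "up_finite S"
  shows "psi i (psi_star j (psi k (psi_star l f))) S - psi k (psi_star l (psi i (psi_star j f))) S =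
    (if j = k then psi i (psi_star l f) S else 0) - (if i = l then psi k (psi_star j f) S else 0)"
proof -
  have *: "psi i (psi_star j (psi k g)) S = (if j = k then psi i g S else 0) - psi i (psi k (psi_star j g)) S"
    for i j k g
  proof -
    have "psi i (psi_star j (psi k g)) S = psi i (\<lambda>T. (if k = j then g T else 0) - psi k (psi_star j g) T) S"
      by (rule psi_cong[OF S psi_star_psi])
    then show ?thesis by (simp add: psi_linear eq_commute[of j k])
  qed
  have "psi i (psi k (psi_star j (psi_star l f))) S = - psi k (psi i (psi_star j (psi_star l f))) S"
    by (rule psi_anticommute[OF S])
  also have "psi k (psi i (psi_star j (psi_star l f))) S = psi k (\<lambda>T. - psi i (psi_star l (psi_star j f)) T) S"
  proof (rule psi_cong[OF S])
    fix T assume T: "up_finite T"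
    have "psi i (psi_star j (psi_star l f)) T = psi i (\<lambda>U. - psi_star l (psi_star j f) U) T"
      by (rule psi_cong[OF T psi_star_anticommute])
    then show "psi i (psi_star j (psi_star l f)) T = - psi i (psi_star l (psi_star j f)) T"
      by (simp add: psi_linear)
  qed
  finally have "psi i (psi k (psi_star j (psi_star l f))) S = psi k (psi i (psi_star l (psi_star j f))) S"
    by (simp add: psi_linear)
  then show ?thesis by (simp add: * eq_commute[of i l])
qed

lemma normal_ordered_eq:
  assumes "up_finite S"
  shows "normal_ordered i j f S = psi i (psi_star j f) S - (if i = j \<and> i \<le> 0 then f S else 0)"
  using psi_star_psi[OF assms, of j i f] by (auto simp: normal_ordered_def)

lemma normal_ordered_cong:
  assumes "up_finite S" "\<And>T. up_finite T \<Longrightarrow> f T = g T"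
  shows "normal_ordered i j f S = normal_ordered i j g S"
proof -
  have "psi i (psi_star j f) S = psi i (psi_star j g) S"
    by (rule psi_cong[OF assms(1) psi_star_cong[OF _ assms(2)]])
  with assms show ?thesis by (simp add: normal_ordered_eq)
qed

lemma normal_ordered_cmult:
  "normal_ordered i j (\<lambda>S. c * f S) S = c * normal_ordered i j f S"
proof -
  have "psi i (\<lambda>S. c * f S) = (\<lambda>S. c * psi i f S)" "psi_star j (\<lambda>S. c * f S) = (\<lambda>S. c * psi_star j f S)"
    for f :: fock
    by (auto simp: psi_linear psi_star_linear)
  then show ?thesis by (simp add: normal_ordered_def)
qed

text \<open>Normal ordering subtracts scalars, which drop out of the commutator on the left, but the
  bilinears on the right must be normally ordered again. The two scalars arising there do not cancel
  and form the last term.\<close>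

lemma normal_ordered_commutator:
  assumes S: "up_finite S"
  shows "normal_ordered i j (normal_ordered k l f) S - normal_ordered k l (normal_ordered i j f) S =
    (if j = k then normal_ordered i l f S else 0) - (if i = l then normal_ordered k j f S else 0) +
    (if j = k \<and> i = l then (of_bool (i \<le> 0) - of_bool (j \<le> 0)) * f S else 0)"
proof -
  have *: "normal_ordered i j (normal_ordered k l f) S =
      psi i (psi_star j (psi k (psi_star l f))) S - (if k = l \<and> k \<le> 0 then psi i (psi_star j f) S else 0)
      - (if i = j \<and> i \<le> 0 then psi k (psi_star l f) S else 0)
      + (if i = j \<and> i \<le> 0 \<and> k = l \<and> k \<le> 0 then f S else 0)" for i j k l
  proof -
    have "normal_ordered i j (normal_ordered k l f) S =
        normal_ordered i j (\<lambda>S. psi k (psi_star l f) S - (if k = l \<and> k \<le> 0 then f S else 0)) S"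
      by (rule normal_ordered_cong[OF S normal_ordered_eq])
    also have "\<dots> = psi i (psi_star j (\<lambda>S. psi k (psi_star l f) S - (if k = l \<and> k \<le> 0 then f S else 0))) S
        - (if i = j \<and> i \<le> 0 then psi k (psi_star l f) S - (if k = l \<and> k \<le> 0 then f S else 0) else 0)"
      by (rule normal_ordered_eq[OF S])
    also have "psi_star j (\<lambda>S. psi k (psi_star l f) S - (if k = l \<and> k \<le> 0 then f S else 0)) =
        (\<lambda>S. psi_star j (psi k (psi_star l f)) S - (if k = l \<and> k \<le> 0 then psi_star j f S else 0))"
      by (auto simp: psi_star_linear psi_star_eq)
    finally show ?thesis by (auto simp: psi_linear)
  qed
  \<comment> \<open>A purely scalar identity with the bilinears abstracted to M, so that the case
    split on j = k and i = l does not involve Fock space.\<close>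
  have "A - (if k = l \<and> k \<le> 0 then M i j else 0) - (if i = j \<and> i \<le> 0 then M k l else 0) + c
      - (B - (if i = j \<and> i \<le> 0 then M k l else 0) - (if k = l \<and> k \<le> 0 then M i j else 0) + c') =
    (if j = k then M i l - (if i = l \<and> i \<le> 0 then x else 0) else 0) -
    (if i = l then M k j - (if k = j \<and> k \<le> 0 then x else 0) else 0) +
    (if j = k \<and> i = l then (of_bool (i \<le> 0) - of_bool (j \<le> 0)) * x else 0)"
    if "A - B = (if j = k then M i l else 0) - (if i = l then M k j else 0)" "c = c'"
    for A B c c' x :: complex and M :: "int \<Rightarrow> int \<Rightarrow> complex"
  proof -
    have "A = B + (if j = k then M i l else 0) - (if i = l then M k j else 0)"
      using that(1) by (simp add: algebra_simps)
    with that(2) show ?thesis by (cases "j = k"; cases "i = l") simp_all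
  qed
  from this[where M = "\<lambda>i j. psi i (psi_star j f) S" and x = "f S", OF bilinear_commutator[OF S] refl]
  show ?thesis
    unfolding * unfolding normal_ordered_eq[OF S]
    by (simp only: conj_commute conj_left_commute)
qed

section \<open>Maya diagrams\<close>

lemma partitionsE:
  assumes "lam \<in> partitions"
  obtains L where "\<And>i. i \<ge> L \<Longrightarrow> lam i = 0" "\<And>i j. i \<le> j \<Longrightarrow> lam j \<le> lam i"
proof -
  from assms have fin: "finite {i. lam i \<noteq> 0}" and anti: "antimono lam"
    by (auto simp: partitions_def)
  from fin obtain L where "\<forall>i\<in>{i. lam i \<noteq> 0}. i < L"
    by (meson finite_nat_set_iff_bounded)
  then have "lam i = 0" if "i \<ge> L" for i using that by (metis linorder_not_le mem_Collect_eq)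
  moreover have "i \<le> j \<Longrightarrow> lam j \<le> lam i" for i j using anti by (simp add: antimonoD)
  ultimately show ?thesis using that by blast
qed

text \<open>Of the 2N integers in the window, the vacuum occupies N. Asking for this count at all
  large N makes the condition independent of the window and stable under moving one
  particle.\<close>

definition charge_zero :: "int set \<Rightarrow> bool"
  where "charge_zero S \<longleftrightarrow> (\<exists>N0. \<forall>N\<ge>N0. {..- int N} \<subseteq> S \<and> S \<subseteq> {..int N} \<and>
    card (S \<inter> {- int N<..int N}) = N)"

lemma charge_zero_maya:
  assumes "lam \<in> partitions"
  shows "charge_zero (maya lam)"
proof -
  let ?a = "\<lambda>i. int (lam i) - int i"
  obtain L where L: "\<And>i. i \<ge> L \<Longrightarrow> lam i = 0" and anti: "\<And>i j. i \<le> j \<Longrightarrow> lam j \<le> lam i"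
    using partitionsE[OF assms] by blast
  have "{..- int N} \<subseteq> maya lam \<and> maya lam \<subseteq> {..int N} \<and> card (maya lam \<inter> {- int N<..int N}) = N"
    if N: "N \<ge> max L (lam 0)" for N
  proof (intro conjI subsetI)
    fix s assume "s \<in> {..- int N}"
    then have "s = int (lam (nat (- s))) - int (nat (- s))" using N by (subst L) auto
    then show "s \<in> maya lam" unfolding maya_def by blast
  next
    fix s assume "s \<in> maya lam"
    then obtain i where "s = int (lam i) - int i" by (auto simp: maya_def)
    with anti[of 0 i] N show "s \<in> {..int N}" by auto
  next
    have "maya lam \<inter> {- int N<..int N} = ?a ` {..<N}"
    proof (intro equalityI subsetI)
      fix s assume "s \<in> maya lam \<inter> {- int N<..int N}"
      then obtain i where i: "s = int (lam i) - int i" "s > - int N" by (auto simp: maya_def)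
      then have "i < N" using L[of i] N by (cases "i < N") auto
      with i show "s \<in> ?a ` {..<N}" by blast
    next
      fix s assume "s \<in> ?a ` {..<N}"
      then obtain i where i: "s = int (lam i) - int i" "i < N" by auto
      with anti[of 0 i] N show "s \<in> maya lam \<inter> {- int N<..int N}" by (auto simp: maya_def)
    qed
    moreover have "inj_on ?a {..<N}"
    proof (rule linorder_inj_onI)
      fix i j :: nat assume "i < j"
      with anti[of i j] show "int (lam i) - int i \<noteq> int (lam j) - int j" by simp
    qed auto
    ultimately show "card (maya lam \<inter> {- int N<..int N}) = N" by (simp add: card_image)
  qed
  then show ?thesis unfolding charge_zero_def by blast
qed

text \<open>Everything up to -N is occupied, and exactly N occupied positions x_0 > x_1 > ... lie
  above. Put x_i + i for the parts; strict decrease of the positions makes the parts weakly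
  decreasing.\<close>

lemma maya_charge_zero:
  assumes "charge_zero S"
  shows "\<exists>lam\<in>partitions. maya lam = S"
proof -
  obtain N where N: "{..- int N} \<subseteq> S" "S \<subseteq> {..int N}" "card (S \<inter> {- int N<..int N}) = N"
    using assms unfolding charge_zero_def by blast
  define F where "F = S \<inter> {- int N<..int N}"
  have F: "finite F" "card F = N" using N by (auto simp: F_def)
  define xs where "xs = rev (sorted_list_of_set F)"
  have len: "length xs = N" by (simp add: xs_def F)
  have set: "set xs = F" by (simp add: xs_def F)
  have dec: "xs ! j < xs ! i" if "i < j" "j < N" for i j
  proof -
    have "sorted_wrt (<) (sorted_list_of_set F)" by (rule strict_sorted_list_of_set)
    then have "sorted_wrt (>) xs" by (simp add: xs_def sorted_wrt_rev)
    with that show ?thesis by (simp add: sorted_wrt_iff_nth_less len)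
  qed
  have dec': "xs ! j + int j \<le> xs ! i + int i" if "i \<le> j" "j < N" for i j
    using that
  proof (induction j rule: dec_induct)
    case (step n)
    with dec[of n "Suc n"] show ?case by auto
  qed simp
  \<comment> \<open>The smallest of the N positions exceeds -N, so the last part is nonnegative, and
    the parts do not decrease towards smaller i.\<close>
  have low: "xs ! i + int i \<ge> 0" if "i < N" for i
  proof -
    have "xs ! (N - 1) \<in> F" using that len set by (metis Suc_pred' diff_less less_nat_zero_code nth_mem less_one neq0_conv)
    then have "xs ! (N - 1) > - int N" by (auto simp: F_def)
    moreover have "xs ! (N - 1) + int (N - 1) \<le> xs ! i + int i"
      by (rule dec') (use that in auto)
    ultimately show ?thesis using that by linarith
  qed
  define lam where "lam i = (if i < N then nat (xs ! i + int i) else 0)" for i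
  have "antimono lam"
  proof (rule antimonoI)
    fix i j :: nat assume "i \<le> j"
    then show "lam j \<le> lam i"
      using nat_mono[OF dec'[of i j]] by (cases "j < N") (simp_all add: lam_def)
  qed
  moreover have "{i. lam i \<noteq> 0} \<subseteq> {..<N}" by (auto simp: lam_def)
  ultimately have "lam \<in> partitions" by (auto simp: partitions_def intro: finite_subset)
  moreover have "maya lam = S"
  proof -
    let ?a = "\<lambda>i. int (lam i) - int i"
    have "UNIV = {..<N} \<union> {N..}" by auto
    then have "range ?a = ?a ` {..<N} \<union> ?a ` {N..}"
      by (metis image_Un)
    also have "?a ` {..<N} = (\<lambda>i. xs ! i) ` {..<N}"
      by (rule image_cong) (use low in \<open>auto simp: lam_def\<close>)
    also have "\<dots> = F" unfolding set[symmetric] set_conv_nth len by auto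
    also have "?a ` {N..} = {..- int N}"
    proof (intro equalityI subsetI)
      fix s assume "s \<in> {..- int N}"
      then show "s \<in> ?a ` {N..}"
        by (intro image_eqI[of _ _ "nat (- s)"]) (auto simp: lam_def)
    qed (auto simp: lam_def)
    also have "F \<union> {..- int N} = S"
      using N by (auto simp: F_def)
    finally show ?thesis by (simp add: maya_def)
  qed
  ultimately show ?thesis by blast
qed

lemma charge_zero_move:
  assumes "charge_zero S" "l \<in> S" "k \<notin> S"
  shows "charge_zero (insert k (S - {l}))"
proof -
  obtain N0 where N0: "\<And>N. N \<ge> N0 \<Longrightarrow> {..- int N} \<subseteq> S \<and> S \<subseteq> {..int N} \<and>
    card (S \<inter> {- int N<..int N}) = N"
    using assms unfolding charge_zero_def by blast
  have "{..- int N} \<subseteq> insert k (S - {l}) \<and> insert k (S - {l}) \<subseteq> {..int N} \<and>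
    card (insert k (S - {l}) \<inter> {- int N<..int N}) = N"
    if N: "N \<ge> Max {N0, Suc (nat \<bar>k\<bar>), Suc (nat \<bar>l\<bar>)}" for N
  proof -
    have N': "N \<ge> N0" "- int N < k" "k < int N" "- int N < l" "l < int N" using N by auto
    let ?F = "S \<inter> {- int N<..int N}"
    have "insert k (S - {l}) \<inter> {- int N<..int N} = insert k (?F - {l})" using N' by auto
    moreover have "finite ?F" "l \<in> ?F" "k \<notin> ?F" using assms N' by auto
    then have "card (insert k (?F - {l})) = card ?F"
      using card_Suc_Diff1 by (metis card_insert_disjoint Diff_iff finite_Diff)
    ultimately show ?thesis using N0[OF N'(1)] N' by auto
  qed
  then show ?thesis unfolding charge_zero_def by blast
qed

lemma up_finite_charge_zero:
  assumes "charge_zero S" shows "up_finite S"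
proof -
  obtain N where "S \<subseteq> {..int N}" using assms unfolding charge_zero_def by blast
  then have "{s \<in> S. t < s} \<subseteq> {t..int N}" for t by auto
  then show ?thesis unfolding up_finite_def by (meson finite_atLeastAtMost_int finite_subset)
qed

lemmas up_finite_maya = up_finite_charge_zero[OF charge_zero_maya]

text \<open>The positions attached to a partition decrease strictly, and a strictly decreasing
  sequence is determined by its range.\<close>

lemma inj_on_maya: "inj_on maya partitions"
proof (rule inj_onI)
  fix lam mu assume "lam \<in> partitions" "mu \<in> partitions" and eq: "maya lam = maya mu"
  then have anti: "i \<le> j \<Longrightarrow> lam j \<le> lam i" "i \<le> j \<Longrightarrow> mu j \<le> mu i" for i j
    by (auto simp: partitions_def antimonoD)
  define a where "a i = int (lam i) - int i" for i
  define b where "b i = int (mu i) - int i" for i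
  have dec: "i < j \<Longrightarrow> a j < a i" "i < j \<Longrightarrow> b j < b i" for i j
    using anti[of i j] by (auto simp: a_def b_def)
  have range: "range a = range b" using eq by (simp add: maya_def a_def b_def)
  have "a i = b i" for i
  proof (induction i rule: less_induct)
    case (less i)
    obtain m where m: "a i = b m" using range by (metis rangeI imageE)
    obtain n where n: "b i = a n" using range by (metis rangeI imageE)
    have "\<not> m < i" using less.IH[of m] m dec(1)[of m i] by force
    moreover have "\<not> n < i" using less.IH[of n] n dec(2)[of n i] by force
    ultimately have "b m \<le> b i" "a n \<le> a i" using dec by (metis le_less_linear nat_neq_iff order.order_iff_strict)+
    then show ?case using m n by simp
  qed
  then show "lam = mu" by (auto simp: a_def b_def fun_eq_iff)
qed

lemma ket_eq: "nu \<in> partitions \<Longrightarrow> mu \<in> partitions \<Longrightarrow> ket nu (maya mu) = (if mu = nu then 1 else 0)"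
  using inj_on_maya by (auto simp: ket_def inj_on_def)

text \<open>The only wedge occurring in \<open>:\<psi>\<^sub>k\<psi>\<^sub>l\<^sup>*:\<close> applied to the wedge \<open>S\<close>.\<close>

definition move :: "int \<Rightarrow> int \<Rightarrow> int set \<Rightarrow> int set"
  where "move k l S = (if k = l then S else insert k (S - {l}))"

text \<open>For k = l the operator is the occupation number minus that of the vacuum, so it is
  nonzero only where the diagram differs from the vacuum; this keeps the later sums over diagonal
  bilinears finite.\<close>

lemma normal_ordered_ket:
  assumes "up_finite T" "normal_ordered k l (ket nu) T \<noteq> 0"
  shows "T = move k l (maya nu)"
    and "if k = l then k \<in> maya nu \<longleftrightarrow> k > 0 else l \<in> maya nu \<and> k \<notin> maya nu"
proof -
  have "T = move k l (maya nu) \<and> (if k = l then k \<in> maya nu \<longleftrightarrow> k > 0 else l \<in> maya nu \<and> k \<notin> maya nu)"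
  proof (cases "k = l")
    case True
    have "normal_ordered k k (ket nu) T = ((if k \<in> T then 1 else 0) - (if k \<le> 0 then 1 else 0)) * ket nu T"
      using assms(1)
      by (auto simp: normal_ordered_eq psi_eq psi_star_eq wsign_Diff insert_absorb
          wsign_square mult.assoc[symmetric])
    with assms(2) True have "T = maya nu" "k \<in> T \<longleftrightarrow> k > 0"
      by (auto simp: ket_def split: if_splits)
    with True show ?thesis by (simp add: move_def)
  next
    case False
    with assms have "k \<in> T" "l \<notin> T" "insert l (T - {k}) = maya nu"
      by (auto simp: normal_ordered_eq psi_eq psi_star_eq ket_def split: if_splits)
    with False show ?thesis by (auto simp: move_def)
  qed
  then show "T = move k l (maya nu)"
    "if k = l then k \<in> maya nu \<longleftrightarrow> k > 0 else l \<in> maya nu \<and> k \<notin> maya nu" by auto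
qed

abbreviation bilin :: "int \<times> int \<Rightarrow> (nat \<Rightarrow> nat) \<Rightarrow> (nat \<Rightarrow> nat) \<Rightarrow> complex"
  where "bilin p mu nu \<equiv> mel mu (normal_ordered (fst p) (snd p)) nu"

lemma bilin_nonzero:
  assumes "mu \<in> partitions" "bilin p mu nu \<noteq> 0"
  shows "maya mu = move (fst p) (snd p) (maya nu)"
    and "if fst p = snd p then fst p \<in> maya nu \<longleftrightarrow> fst p > 0 else snd p \<in> maya nu \<and> fst p \<notin> maya nu"
  using normal_ordered_ket[OF up_finite_maya[OF assms(1)]] assms(2) by (auto simp: mel_def)

lemma bilin_unique:
  assumes "mu \<in> partitions" "mu' \<in> partitions" "bilin p mu nu \<noteq> 0" "bilin p mu' nu \<noteq> 0"
  shows "mu = mu'"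
  using bilin_nonzero(1)[OF assms(1,3)] bilin_nonzero(1)[OF assms(2,4)] inj_on_maya assms(1,2)
  by (auto simp: inj_on_def)

text \<open>Resolution of the identity in charge 0: a bilinear sends a basis wedge to a multiple of
  at most one wedge, again of charge 0 and therefore attached to a partition. So at most one rho
  contributes.\<close>

lemma bilin_product:
  assumes mu: "mu \<in> partitions" and nu: "nu \<in> partitions"
  shows "((\<lambda>rho. bilin p mu rho * bilin q rho nu) has_sum
    normal_ordered (fst p) (snd p) (normal_ordered (fst q) (snd q) (ket nu)) (maya mu)) partitions"
proof (cases "\<exists>rho\<in>partitions. bilin q rho nu \<noteq> 0")
  case True
  then obtain rho where rho: "rho \<in> partitions" "bilin q rho nu \<noteq> 0" by blast
  have "normal_ordered (fst q) (snd q) (ket nu) T = bilin q rho nu * ket rho T" if "up_finite T" for T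
  proof (cases "normal_ordered (fst q) (snd q) (ket nu) T = 0")
    case True
    with rho show ?thesis by (auto simp: ket_def mel_def)
  next
    case False
    then have "T = maya rho"
      using normal_ordered_ket(1)[OF that False] bilin_nonzero(1)[OF rho] by simp
    then show ?thesis by (simp add: ket_def mel_def)
  qed
  then have "normal_ordered (fst p) (snd p) (normal_ordered (fst q) (snd q) (ket nu)) (maya mu) =
      bilin q rho nu * bilin p mu rho"
    unfolding mel_def[of mu] normal_ordered_cmult[symmetric]
    by (intro normal_ordered_cong up_finite_maya mu)
  moreover have "((\<lambda>rho'. bilin p mu rho' * bilin q rho' nu) has_sum
      (\<Sum>rho'\<in>{rho}. bilin p mu rho' * bilin q rho' nu)) partitions"
  proof (rule has_sum_finite_neutralI)
    fix rho' assume "rho' \<in> partitions - {rho}"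
    then have "bilin q rho' nu = 0"
      using bilin_unique[OF rho(1) _ rho(2)] by blast
    then show "bilin p mu rho' * bilin q rho' nu = 0" by simp
  qed (use rho in auto)
  ultimately show ?thesis by (simp add: mult.commute)
next
  case False
  note none = this
  have "normal_ordered (fst q) (snd q) (ket nu) T = 0" if T: "up_finite T" for T
  proof (rule ccontr)
    assume nz: "normal_ordered (fst q) (snd q) (ket nu) T \<noteq> 0"
    note * = normal_ordered_ket[OF T nz]
    have "charge_zero T"
    proof (cases "fst q = snd q")
      case True
      with *(1) show ?thesis using charge_zero_maya[OF nu] by (simp add: move_def)
    next
      case False
      with * show ?thesis using charge_zero_move[OF charge_zero_maya[OF nu]] by (simp add: move_def)
    qed
    then obtain rho where "rho \<in> partitions" "maya rho = T" using maya_charge_zero by blast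
    with nz none show False by (auto simp: mel_def)
  qed
  then have "normal_ordered (fst p) (snd p) (normal_ordered (fst q) (snd q) (ket nu)) (maya mu) =
      normal_ordered (fst p) (snd p) (\<lambda>S. 0 * ket nu S) (maya mu)"
    by (intro normal_ordered_cong up_finite_maya mu) simp
  also have "\<dots> = 0" by (subst normal_ordered_cmult) simp
  finally show ?thesis using False by (auto intro!: has_sum_0)
qed

section \<open>Commutators of currents\<close>

lemma charge_zero_bounds:
  assumes "charge_zero S"
  obtains N where "{..- int N} \<subseteq> S" "S \<subseteq> {..int N}"
proof -
  from assms obtain N0 where "\<forall>N\<ge>N0. {..- int N} \<subseteq> S \<and> S \<subseteq> {..int N} \<and>
    card (S \<inter> {- int N<..int N}) = N"
    unfolding charge_zero_def ..
  then have "{..- int N0} \<subseteq> S" "S \<subseteq> {..int N0}" by auto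
  then show ?thesis by (rule that)
qed

lemma finite_charge_zero_Diff:
  assumes "charge_zero S" "charge_zero T"
  shows "finite (S - T)"
proof -
  obtain M where M: "S \<subseteq> {..int M}" using charge_zero_bounds[OF assms(1)] .
  obtain N where N: "{..- int N} \<subseteq> T" using charge_zero_bounds[OF assms(2)] .
  have "S - T \<subseteq> {- int N..int M}"
  proof
    fix x assume "x \<in> S - T"
    then have "x \<in> {..int M}" "x \<notin> {..- int N}" using M N by blast+
    then show "x \<in> {- int N..int M}" by simp
  qed
  then show ?thesis by (rule finite_subset) simp
qed

lemma finite_diagonal_occupied:
  assumes "charge_zero S" shows "finite {p :: int \<times> int. fst p = snd p \<and> (fst p \<in> S \<longleftrightarrow> fst p > 0)}"
proof -
  have vac: "charge_zero {..0}"
    using charge_zero_maya[of empty_partition] by (simp add: maya_empty partitions_def antimono_def)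
  have "{p :: int \<times> int. fst p = snd p \<and> (fst p \<in> S \<longleftrightarrow> fst p > 0)} \<subseteq>
      (\<lambda>i. (i, i)) ` ((S - {..0}) \<union> ({..0} - S))"
    by (auto simp: image_iff)
  then show ?thesis
    using finite_charge_zero_Diff[OF assms vac] finite_charge_zero_Diff[OF vac assms]
    by (meson finite_UnI finite_imageI finite_subset)
qed

text \<open>The occupied starting position is bounded above and the empty target below it is bounded
  below. For raising moves the target has no upper bound.\<close>

lemma finite_lowering_moves:
  assumes "charge_zero S" shows "finite {p :: int \<times> int. fst p < snd p \<and> snd p \<in> S \<and> fst p \<notin> S}"
proof -
  obtain N where N: "{..- int N} \<subseteq> S" "S \<subseteq> {..int N}" using charge_zero_bounds[OF assms] .
  have "{p :: int \<times> int. fst p < snd p \<and> snd p \<in> S \<and> fst p \<notin> S} \<subseteq> {- int N..int N} \<times> {- int N..int N}"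
  proof clarify
    fix i j assume *: "fst (i, j) < snd (i, j)" "snd (i, j) \<in> S" "fst (i, j) \<notin> S"
    then have "i \<notin> {..- int N}" "j \<in> {..int N}" using N by auto
    with * show "i \<in> {- int N..int N} \<and> j \<in> {- int N..int N}" by simp
  qed
  then show ?thesis by (rule finite_subset) simp
qed

lemma finite_bilin:
  assumes "mu \<in> partitions" "nu \<in> partitions"
  shows "finite {p. bilin p mu nu \<noteq> 0}"
proof -
  let ?S = "maya nu" and ?T = "maya mu"
  have "{p. bilin p mu nu \<noteq> 0} \<subseteq>
      {p. fst p = snd p \<and> (fst p \<in> ?S \<longleftrightarrow> fst p > 0)} \<union> (?T - ?S) \<times> (?S - ?T)"
  proof
    fix p assume "p \<in> {p. bilin p mu nu \<noteq> 0}"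
    with bilin_nonzero[OF assms(1), of p nu]
    show "p \<in> {p. fst p = snd p \<and> (fst p \<in> ?S \<longleftrightarrow> fst p > 0)} \<union> (?T - ?S) \<times> (?S - ?T)"
      by (cases p) (auto simp: move_def split: if_splits)
  qed
  moreover have "finite \<dots>"
    using assms by (intro finite_UnI finite_cartesian_product finite_diagonal_occupied
        finite_charge_zero_Diff charge_zero_maya)
  ultimately show ?thesis by (rule finite_subset)
qed

definition bilin_sum :: "(int \<times> int \<Rightarrow> complex) \<Rightarrow> (nat \<Rightarrow> nat) \<Rightarrow> (nat \<Rightarrow> nat) \<Rightarrow> complex"
  where "bilin_sum X mu nu = (\<Sum>\<^sub>\<infinity>p. X p * bilin p mu nu)"

lemma has_sum_bilin_sum:
  assumes "mu \<in> partitions" "nu \<in> partitions"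
  shows "((\<lambda>p. X p * bilin p mu nu) has_sum bilin_sum X mu nu) UNIV"
  unfolding bilin_sum_def
  by (intro has_sum_infsum finite_nonzero_values_imp_summable_on)
    (rule finite_subset[OF _ finite_bilin[OF assms]], auto)

definition bilin2 :: "int \<times> int \<Rightarrow> int \<times> int \<Rightarrow> (nat \<Rightarrow> nat) \<Rightarrow> (nat \<Rightarrow> nat) \<Rightarrow> complex"
  where "bilin2 p q mu nu = normal_ordered (fst p) (snd p) (normal_ordered (fst q) (snd q) (ket nu)) (maya mu)"

lemma bilin2_eq:
  assumes "mu \<in> partitions" "nu \<in> partitions" "rho \<in> partitions" "bilin q rho nu \<noteq> 0"
  shows "bilin2 p q mu nu = bilin p mu rho * bilin q rho nu"
proof -
  have "((\<lambda>rho'. bilin p mu rho' * bilin q rho' nu) has_sum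
      (\<Sum>rho'\<in>{rho}. bilin p mu rho' * bilin q rho' nu)) partitions"
  proof (rule has_sum_finite_neutralI)
    fix rho' assume "rho' \<in> partitions - {rho}"
    then have "bilin q rho' nu = 0"
      using bilin_unique[OF assms(3) _ assms(4)] by blast
    then show "bilin p mu rho' * bilin q rho' nu = 0" by simp
  qed (use assms in auto)
  with bilin_product[OF assms(1,2), of p q] show ?thesis
    by (simp add: bilin2_def has_sum_unique)
qed

lemma bilin2_nonzero:
  assumes "mu \<in> partitions" "nu \<in> partitions" "bilin2 p q mu nu \<noteq> 0"
  obtains rho where "rho \<in> partitions" "bilin p mu rho \<noteq> 0" "bilin q rho nu \<noteq> 0"
proof -
  have "\<not> ((\<lambda>rho. bilin p mu rho * bilin q rho nu) has_sum 0) partitions"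
    using bilin_product[OF assms(1,2), of p q] assms(3) has_sum_unique by (auto simp: bilin2_def)
  then obtain rho where "rho \<in> partitions" "bilin p mu rho * bilin q rho nu \<noteq> 0"
    by (meson has_sum_0)
  then show ?thesis using that by simp
qed

text \<open>A pair (p, q) passes through at most one intermediate partition, so the sum over pairs
  can be re-indexed by triples (rho, p, q); the inner sums over p and q then factor.\<close>

lemma bilin_sum_mult:
  assumes mu: "mu \<in> partitions" and nu: "nu \<in> partitions"
    and sum: "((\<lambda>(p, q). X p * Y q * bilin2 p q mu nu) has_sum s) UNIV"
  shows "((\<lambda>rho. bilin_sum X mu rho * bilin_sum Y rho nu) has_sum s) partitions"
proof -
  define f where "f = (\<lambda>(rho, p, q). (X p * bilin p mu rho) * (Y q * bilin q rho nu))"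
  define W where "W = {(rho, p, q). rho \<in> partitions \<and> bilin p mu rho \<noteq> 0 \<and> bilin q rho nu \<noteq> 0}"
  have inj: "inj_on snd W"
    by (rule inj_onI) (auto simp: W_def dest: bilin_unique)
  have "((\<lambda>(p, q). X p * Y q * bilin2 p q mu nu) has_sum s) UNIV \<longleftrightarrow>
      ((\<lambda>(p, q). X p * Y q * bilin2 p q mu nu) has_sum s) (snd ` W)"
  proof (rule has_sum_cong_neutral)
    fix x assume x: "x \<in> UNIV - snd ` W"
    obtain p q where [simp]: "x = (p, q)" by (cases x)
    have "bilin2 p q mu nu = 0"
    proof (rule ccontr)
      assume "bilin2 p q mu nu \<noteq> 0"
      then obtain rho where "rho \<in> partitions" "bilin p mu rho \<noteq> 0" "bilin q rho nu \<noteq> 0"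
        by (rule bilin2_nonzero[OF mu nu])
      then have "(rho, p, q) \<in> W" by (simp add: W_def)
      then have "snd (rho, p, q) \<in> snd ` W" by (rule imageI)
      with x show False by simp
    qed
    then show "(case x of (p, q) \<Rightarrow> X p * Y q * bilin2 p q mu nu) = 0" by simp
  qed auto
  also have "\<dots> \<longleftrightarrow> ((\<lambda>(p, q). X p * Y q * bilin2 p q mu nu) \<circ> snd has_sum s) W"
    by (rule has_sum_reindex[OF inj])
  also have "\<dots> \<longleftrightarrow> (f has_sum s) (partitions \<times> UNIV)"
    by (rule has_sum_cong_neutral) (auto simp: f_def W_def bilin2_eq[OF mu nu])
  finally have "(f has_sum s) (partitions \<times> UNIV)" using sum by simp
  then show ?thesis
  proof (rule has_sum_Sigma')
    fix rho assume "rho \<in> partitions"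
    then show "((\<lambda>y. f (rho, y)) has_sum bilin_sum X mu rho * bilin_sum Y rho nu) UNIV"
      using has_sum_mult_Times[OF has_sum_bilin_sum[OF mu, of rho X] has_sum_bilin_sum[OF _ nu, of rho Y]]
      by (simp add: f_def)
  qed
qed

text \<open>For families supported on a Kronecker delta: x stands for the free outer indices, of
  which finitely many matter, and a for the contracted index.\<close>

lemma has_sum_fibres:
  fixes f :: "'c \<Rightarrow> 'b::topological_comm_monoid_add"
  assumes "finite Z" and "\<And>x. x \<in> Z \<Longrightarrow> ((\<lambda>a. f (g x a)) has_sum s x) UNIV"
    and inj: "\<And>x y a b. g x a = g y b \<Longrightarrow> x = y \<and> a = b"
    and zero: "\<And>c. (\<And>x a. x \<in> Z \<Longrightarrow> c \<noteq> g x a) \<Longrightarrow> f c = 0"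
  shows "(f has_sum sum s Z) UNIV"
proof -
  have "(f has_sum sum s Z) (\<Union>x\<in>Z. range (g x))"
  proof (rule sum_has_sum[OF assms(1)])
    fix x assume "x \<in> Z"
    have "(f has_sum s x) (range (g x)) \<longleftrightarrow> (f \<circ> g x has_sum s x) UNIV"
      by (rule has_sum_reindex) (auto simp: inj_on_def dest: inj)
    with assms(2)[OF \<open>x \<in> Z\<close>] show "(f has_sum s x) (range (g x))" by (simp add: o_def)
  qed (auto dest: inj)
  also have "?this \<longleftrightarrow> (f has_sum sum s Z) UNIV"
    by (rule has_sum_cong_neutral) (auto intro: zero)
  finally show ?thesis .
qed

lemma bilin2_commutator:
  assumes mu: "mu \<in> partitions" and nu: "nu \<in> partitions"
  shows "bilin2 (i, j) (k, l) mu nu - bilin2 (k, l) (i, j) mu nu =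
    (if j = k then bilin (i, l) mu nu else 0) - (if i = l then bilin (k, j) mu nu else 0) +
    (if j = k \<and> i = l then (of_bool (i \<le> 0) - of_bool (j \<le> 0)) * (if mu = nu then 1 else 0) else 0)"
  using normal_ordered_commutator[OF up_finite_maya[OF mu], of i j k l "ket nu"]
  by (simp add: bilin2_def mel_def ket_eq[OF nu mu])

context deformation
begin

abbreviation Aplus' where "Aplus' k \<equiv> \<lambda>p. Aplus k (fst p) (snd p)"
abbreviation Aminus' where "Aminus' k \<equiv> \<lambda>p. Aminus k (fst p) (snd p)"

lemma current_plus_eq:
  "k \<ge> 1 \<Longrightarrow> current \<alpha> \<beta> (int k) mu nu = bilin_sum (Aplus' k) mu nu"
  by (simp add: current_def bilin_sum_def current_coeff_plus case_prod_unfold)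

lemma current_minus_eq:
  "k \<ge> 1 \<Longrightarrow> current \<alpha> \<beta> (- int k) mu nu = bilin_sum (Aminus' k) mu nu"
  by (simp add: current_def bilin_sum_def current_coeff_minus case_prod_unfold)

text \<open>The index pairs at which a lowering current can act nontrivially on S. With indices
  swapped and S taken from the resulting wedge, the same set bounds the raising currents.\<close>

definition lowering :: "int set \<Rightarrow> (int \<times> int) set"
  where "lowering S = {p. fst p = snd p \<and> (fst p \<in> S \<longleftrightarrow> fst p > 0)} \<union>
    {p. fst p < snd p \<and> snd p \<in> S \<and> fst p \<notin> S}"

lemma finite_lowering: "lam \<in> partitions \<Longrightarrow> finite (lowering (maya lam))"
  unfolding lowering_def
  by (intro finite_UnI finite_diagonal_occupied finite_lowering_moves charge_zero_maya)

lemma Aplus_bilin_nonzero: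
  assumes "mu \<in> partitions" "Aplus' k p * bilin p mu nu \<noteq> 0"
  shows "p \<in> lowering (maya nu)"
proof -
  have "fst p \<le> snd p" using assms(2) Aplus_eq_0[of "snd p" "fst p" k] by (cases "fst p \<le> snd p") simp_all
  with assms bilin_nonzero(2)[OF assms(1), of p nu] show ?thesis
    by (auto simp: lowering_def split: if_splits)
qed

lemma Aminus_bilin_nonzero:
  assumes "mu \<in> partitions" "Aminus' k p * bilin p mu nu \<noteq> 0"
  shows "prod.swap p \<in> lowering (maya mu)"
    and "maya nu = move (snd p) (fst p) (maya mu)"
proof -
  have 1: "snd p \<le> fst p" using assms(2) Aminus_eq_0[of "fst p" "snd p" k] by (cases "snd p \<le> fst p") simp_all
  have 2: "bilin p mu nu \<noteq> 0" using assms(2) by auto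
  note b = bilin_nonzero[OF assms(1) 2]
  show "prod.swap p \<in> lowering (maya mu)"
    using 1 b by (auto simp: lowering_def move_def split: if_splits)
  show "maya nu = move (snd p) (fst p) (maya mu)"
    using b by (auto simp: move_def split: if_splits)
qed

text \<open>The set \<open>lowering\<close> does not depend on k, so one finite set covers all
  lowering currents at once.\<close>

lemma finite_current_plus:
  assumes nu: "nu \<in> partitions"
  shows "finite {mu \<in> partitions. \<exists>k\<ge>1. current \<alpha> \<beta> (int k) mu nu \<noteq> 0}"
proof -
   let ?N = "{mu \<in> partitions. \<exists>k\<ge>1. current \<alpha> \<beta> (int k) mu nu \<noteq> 0}"
  let ?L = "(\<lambda>p. move (fst p) (snd p) (maya nu)) ` lowering (maya nu)"
 have "maya ` ?N \<subseteq>
      ?L"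
  proof clarify
    fix mu k assume mu: "mu \<in> partitions" and k: "1 \<le> k" and "current \<alpha> \<beta> (int k) mu nu \<noteq> 0"
    then have "bilin_sum (Aplus' k) mu nu \<noteq> 0" by (simp add: current_plus_eq)
    then obtain p where p: "Aplus' k p * bilin p mu nu \<noteq> 0"
      unfolding bilin_sum_def by (meson infsum_0)
    then have "maya mu = move (fst p) (snd p) (maya nu)"
      using bilin_nonzero(1)[OF mu, of p nu] by auto
    with Aplus_bilin_nonzero[OF mu p]
    show "maya mu \<in> ?L" by blast
  qed
  then have "finite (maya ` ?N)"
    using finite_lowering[OF nu] by (meson finite_imageI finite_subset)
  then show ?thesis
    by (rule finite_imageD) (rule inj_on_subset[OF inj_on_maya], auto)
qed

lemma finite_current_minus:
  assumes mu: "mu \<in> partitions"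
  shows "finite {nu \<in> partitions. \<exists>k\<ge>1. current \<alpha> \<beta> (- int k) mu nu \<noteq> 0}"
proof -
   let ?N = "{nu \<in> partitions. \<exists>k\<ge>1. current \<alpha> \<beta> (- int k) mu nu \<noteq> 0}"
  let ?L = "(\<lambda>p. move (fst p) (snd p) (maya mu)) ` lowering (maya mu)"
 have "maya ` ?N \<subseteq>
      ?L"
  proof clarify
    fix nu k assume nu: "nu \<in> partitions" and k: "1 \<le> k" and "current \<alpha> \<beta> (- int k) mu nu \<noteq> 0"
    then have "bilin_sum (Aminus' k) mu nu \<noteq> 0" by (simp add: current_minus_eq)
    then obtain p where p: "Aminus' k p * bilin p mu nu \<noteq> 0"
      unfolding bilin_sum_def by (meson infsum_0)
    from Aminus_bilin_nonzero[OF mu p]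
    show "maya nu \<in> ?L"
      by (intro image_eqI[of _ _ "prod.swap p"]) simp_all
  qed
  then have "finite (maya ` ?N)"
    using finite_lowering[OF mu] by (meson finite_imageI finite_subset)
  then show ?thesis
    by (rule finite_imageD) (rule inj_on_subset[OF inj_on_maya], auto)
qed

text \<open>With the raising current on the left, the sum over index pairs is finite. The bilinear
  commutator turns it into the other order at the cost of three delta-supported sums: ?D1 and ?D2
  contain the two products of coefficient matrices and cancel by \<open>A_commute\<close>, and ?D3
  is the cocycle.\<close>

lemma current_commutator:
  assumes vac: "vacuum_formulas \<alpha> \<beta>" and mu: "mu \<in> partitions" and nu: "nu \<in> partitions"
    and k: "k \<ge> 1" and l: "l \<ge> 1"
  shows "\<exists>s. ((\<lambda>rho. current \<alpha> \<beta> (- int l) mu rho * current \<alpha> \<beta> (int k) rho nu) has_sum s) partitions \<and>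
    ((\<lambda>rho. current \<alpha> \<beta> (int k) mu rho * current \<alpha> \<beta> (- int l) rho nu) has_sum
      s + (if k = l \<and> mu = nu then of_nat k else 0)) partitions"
proof -
  define A where "A = Aplus' k"
  define B where "B = Aminus' l"
  have AB: "((\<lambda>a. A (i, a) * B (a, j)) has_sum (\<Sum>\<^sub>\<infinity>a. A (i, a) * B (a, j))) UNIV"
    "((\<lambda>a. B (i, a) * A (a, j)) has_sum (\<Sum>\<^sub>\<infinity>a. A (i, a) * B (a, j))) UNIV" for i j
    using A_commute[OF vac k l, of i j] by (auto simp: A_def B_def infsumI)
  define C where "C p = (\<Sum>\<^sub>\<infinity>a. A (fst p, a) * B (a, snd p))" for p :: "int \<times> int"
  let ?Z = "{p. bilin p mu nu \<noteq> 0}"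
  have Z: "finite ?Z" by (rule finite_bilin[OF mu nu])
  let ?D1 = "\<lambda>(p, q). A p * B q * (if snd p = fst q then bilin (fst p, snd q) mu nu else 0)"
  let ?D2 = "\<lambda>(p, q). A p * B q * (if fst p = snd q then bilin (fst q, snd p) mu nu else 0)"
  let ?D3 = "\<lambda>(p, q). A p * B q * (if snd p = fst q \<and> fst p = snd q
    then (of_bool (fst p \<le> 0) - of_bool (snd p \<le> 0)) * (if mu = nu then 1 else 0) else 0)"
  have D1: "(?D1 has_sum (\<Sum>p\<in>?Z. C p * bilin p mu nu)) UNIV"
  proof (rule has_sum_fibres[OF Z, where g = "\<lambda>p a. ((fst p, a), (a, snd p))"])
    fix p
    show "((\<lambda>a. ?D1 ((fst p, a), (a, snd p))) has_sum C p * bilin p mu nu) UNIV"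
      using has_sum_cmult_left[OF AB(1)[of "fst p" "snd p"], of "bilin p mu nu"]
      by (simp add: C_def)
  next
    fix c :: "(int \<times> int) \<times> int \<times> int"
    assume c: "\<And>x a. x \<in> ?Z \<Longrightarrow> c \<noteq> ((fst x, a), a, snd x)"
    show "?D1 c = 0"
      using c[of "(fst (fst c), snd (snd c))" "snd (fst c)"] by (cases c) auto
  qed (auto simp: prod_eq_iff)
  have D2: "(?D2 has_sum (\<Sum>p\<in>?Z. C p * bilin p mu nu)) UNIV"
  proof (rule has_sum_fibres[OF Z, where g = "\<lambda>p a. ((a, snd p), (fst p, a))"])
    fix p
    show "((\<lambda>a. ?D2 ((a, snd p), (fst p, a))) has_sum C p * bilin p mu nu) UNIV"
      using has_sum_cmult_left[OF AB(2)[of "fst p" "snd p"], of "bilin p mu nu"]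
      by (simp add: C_def mult.commute)
  next
    fix c :: "(int \<times> int) \<times> int \<times> int"
    assume c: "\<And>x a. x \<in> ?Z \<Longrightarrow> c \<noteq> ((a, snd x), fst x, a)"
    show "?D2 c = 0"
      using c[of "(fst (snd c), snd (fst c))" "fst (fst c)"] by (cases c) auto
  qed (auto simp: prod_eq_iff)
  have D3: "(?D3 has_sum (if k = l \<and> mu = nu then of_nat k else 0)) UNIV"
  proof -
    let ?h = "\<lambda>p :: int \<times> int. (p, prod.swap p)"
    let ?c = "(if k = l then of_nat k else 0) * (if mu = nu then 1 else 0) :: complex"
    have "((\<lambda>(i, j). Aplus k i j * Aminus l j i * (if mu = nu then 1 else 0)) has_sum
        ?c) ({..0} \<times> {1..})"
      using has_sum_cmult_left[OF A_cocycle[OF vac, of k l], of "if mu = nu then 1 else 0"]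
      by (simp add: case_prod_unfold)
    also have "?this \<longleftrightarrow> (?D3 \<circ> ?h has_sum ?c) ({..0} \<times> {1..})"
      by (rule has_sum_cong) (auto simp: A_def B_def)
    also have "\<dots> \<longleftrightarrow> (?D3 has_sum ?c) (?h ` ({..0} \<times> {1..}))"
      by (rule has_sum_reindex[symmetric]) (auto simp: inj_on_def)
    also have "\<dots> \<longleftrightarrow> (?D3 has_sum ?c) UNIV"
    proof (rule has_sum_cong_neutral)
      fix c :: "(int \<times> int) \<times> int \<times> int"
      assume c: "c \<in> UNIV - ?h ` ({..0} \<times> {1..})"
      obtain i j i' j' where [simp]: "c = ((i, j), (i', j'))" by (metis prod.exhaust)
      show "?D3 c = 0"
      \<comment> \<open>\<open>Aplus\<close> vanishes for i > j; for i \<le> j the difference of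
        indicators is nonzero only when i \<le> 0 < j, where it is 1.\<close>
      proof (cases "i \<le> j \<and> j = i' \<and> i = j'")
        case True
        with c have "\<not> (i \<le> 0 \<and> 1 \<le> j)" by (auto simp: image_iff)
        with True show ?thesis by auto
      next
        case False
        then show ?thesis using Aplus_eq_0[of j i k] by (auto simp: A_def)
      qed
    qed auto
    finally show ?thesis by (simp split: if_splits)
  qed
  let ?S = "\<lambda>(p, q). A p * B q * bilin2 q p mu nu"
  have fin: "finite {x. ?S x \<noteq> 0}"
  proof (rule finite_subset)
    show "{x. ?S x \<noteq> 0} \<subseteq> lowering (maya nu) \<times> (prod.swap ` lowering (maya mu))"
    proof
      fix x assume x: "x \<in> {x. ?S x \<noteq> 0}"
      obtain p q where [simp]: "x = (p, q)" by (cases x)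
      have nz: "?S (p, q) \<noteq> 0" using x by simp
      then have "bilin2 q p mu nu \<noteq> 0" by auto
      then obtain rho where rho: "rho \<in> partitions" "bilin q mu rho \<noteq> 0" "bilin p rho nu \<noteq> 0"
        by (rule bilin2_nonzero[OF mu nu])
      have "p \<in> lowering (maya nu)"
        using Aplus_bilin_nonzero[OF rho(1), of k p nu] rho nz by (auto simp: A_def)
      moreover have "prod.swap q \<in> lowering (maya mu)"
        using Aminus_bilin_nonzero(1)[OF mu, of l q rho] rho nz by (auto simp: B_def)
      then have "prod.swap (prod.swap q) \<in> prod.swap ` lowering (maya mu)" by (rule imageI)
      ultimately show "x \<in> lowering (maya nu) \<times> prod.swap ` lowering (maya mu)" by simp
    qed
    show "finite (lowering (maya nu) \<times> (prod.swap ` lowering (maya mu)))"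
      using finite_lowering mu nu by simp
  qed
  then obtain s where s: "(?S has_sum s) UNIV"
    using finite_nonzero_values_imp_summable_on[of UNIV ?S] by (auto simp: summable_on_def)
  have low: "((\<lambda>rho. bilin_sum B mu rho * bilin_sum A rho nu) has_sum s) partitions"
  proof (rule bilin_sum_mult[OF mu nu])
    have "(?S has_sum s) (UNIV \<times> UNIV)" using s by simp
    then show "((\<lambda>(p, q). B p * A q * bilin2 p q mu nu) has_sum s) UNIV"
      by (subst (asm) has_sum_swap) (simp add: case_prod_unfold mult_ac)
  qed
  let ?kd = "if k = l \<and> mu = nu then of_nat k else 0 :: complex"
  have "((\<lambda>x. ?S x + (?D1 x + - ?D2 x + ?D3 x)) has_sum
      s + ((\<Sum>p\<in>?Z. C p * bilin p mu nu) + - (\<Sum>p\<in>?Z. C p * bilin p mu nu) + ?kd)) UNIV"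
    by (intro has_sum_add s D1 D3 has_sum_uminusI D2)
  also have "s + ((\<Sum>p\<in>?Z. C p * bilin p mu nu) + - (\<Sum>p\<in>?Z. C p * bilin p mu nu) + ?kd) = s + ?kd"
    by simp
  also have "((\<lambda>x. ?S x + (?D1 x + - ?D2 x + ?D3 x)) has_sum s + ?kd) UNIV \<longleftrightarrow>
      ((\<lambda>(p, q). A p * B q * bilin2 p q mu nu) has_sum s + ?kd) UNIV"
  proof (rule has_sum_cong)
    fix x :: "(int \<times> int) \<times> int \<times> int"
    obtain i j i' j' where [simp]: "x = ((i, j), (i', j'))" by (metis prod.exhaust)
    have "bilin2 (i, j) (i', j') mu nu = bilin2 (i', j') (i, j) mu nu +
        ((if j = i' then bilin (i, j') mu nu else 0) - (if i = j' then bilin (i', j) mu nu else 0) +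
        (if j = i' \<and> i = j' then (of_bool (i \<le> 0) - of_bool (j \<le> 0)) * (if mu = nu then 1 else 0) else 0))"
      using bilin2_commutator[OF mu nu, of i j i' j'] by (simp add: diff_eq_eq)
    then show "?S x + (?D1 x + - ?D2 x + ?D3 x) = (\<lambda>(p, q). A p * B q * bilin2 p q mu nu) x"
      by (simp add: distrib_left right_diff_distrib)
  qed
  finally have "((\<lambda>rho. bilin_sum A mu rho * bilin_sum B rho nu) has_sum s + ?kd) partitions"
    by (rule bilin_sum_mult[OF mu nu])
  with low show ?thesis
    using k l by (auto simp: A_def B_def current_plus_eq current_minus_eq)
qed

end

section \<open>Sums and gradings of power series\<close>

lemma pcoeff_simps [simp]:
  "pcoeff 0 M = 0" "pcoeff (f + g) M = pcoeff f M + pcoeff g M"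
  "pcoeff (- f) M = - pcoeff f M" "pcoeff (f - g) M = pcoeff f M - pcoeff g M"
  by (simp_all add: zero_pser_def plus_pser_def uminus_pser_def minus_pser_def)

lemma pcoeff_sum: "pcoeff (\<Sum>i\<in>I. f i) M = (\<Sum>i\<in>I. pcoeff (f i) M)"
  by (induction I rule: infinite_finite_induct) auto

lemma pcoeff_mult: "pcoeff (f * g) M = (\<Sum>A | A \<subseteq># M. pcoeff f A * pcoeff g (M - A))"
  by (simp add: times_pser_def)

lemma pcoeff_const_mult [simp]: "pcoeff (pconst c * f) M = c * pcoeff f M"
proof -
  have "pcoeff (pconst c * f) M = (\<Sum>A | A \<subseteq># M. if A = {#} then c * pcoeff f M else 0)"
    unfolding pcoeff_mult by (rule sum.cong) (auto simp: pconst_def)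
  then show ?thesis by (simp add: finite_submultisets)
qed

lemma pcoeff_one: "pcoeff 1 M = (if M = {#} then 1 else 0)"
  by (simp add: one_pser_def pconst_def)

lemma pconst_mult: "pconst a * pconst b = pconst (a * b)"
  by (rule pser_eqI) (simp, simp add: pconst_def)

lemma pconst_0 [simp]: "pconst 0 = 0" and pconst_1 [simp]: "pconst 1 = 1"
  by (rule pser_eqI, simp add: pconst_def) (simp add: one_pser_def)

lemma pconst_add: "pconst a + pconst b = pconst (a + b)"
  by (rule pser_eqI) (simp add: pconst_def)

lemma pconst_of_nat: "pconst (of_nat n) = of_nat n"
  by (induction n) (simp_all add: pconst_add[symmetric])

text \<open>Convergence and value in one statement; \<open>pinfsum\<close> alone assigns 0 to a
  coefficient whose sum does not converge.\<close>

definition phas_sum :: "('i \<Rightarrow> 'v pser) \<Rightarrow> 'v pser \<Rightarrow> 'i set \<Rightarrow> bool"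
  where "phas_sum f s I \<longleftrightarrow> (\<forall>M. ((\<lambda>i. pcoeff (f i) M) has_sum pcoeff s M) I)"

lemma phas_sumD: "phas_sum f s I \<Longrightarrow> ((\<lambda>i. pcoeff (f i) M) has_sum pcoeff s M) I"
  by (simp add: phas_sum_def)

lemma phas_sum_pinfsum: "phas_sum f s I \<Longrightarrow> pinfsum f I = s"
  by (rule pser_eqI) (simp add: phas_sum_def pinfsum_def infsumI)

lemma phas_sum_psummable: "phas_sum f s I \<Longrightarrow> psummable f I"
  by (auto simp: phas_sum_def psummable_def summable_on_def)

lemma psummable_phas_sum: "psummable f I \<Longrightarrow> phas_sum f (pinfsum f I) I"
  by (auto simp: phas_sum_def psummable_def pinfsum_def)

lemma phas_sum_unique: "phas_sum f s I \<Longrightarrow> phas_sum f t I \<Longrightarrow> s = t"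
  by (metis phas_sum_pinfsum)

lemma phas_sum_cong: "(\<And>i. i \<in> I \<Longrightarrow> f i = g i) \<Longrightarrow> phas_sum f s I \<longleftrightarrow> phas_sum g s I"
  unfolding phas_sum_def by (intro all_cong1 has_sum_cong) simp

lemma phas_sum_add: "phas_sum f s I \<Longrightarrow> phas_sum g t I \<Longrightarrow> phas_sum (\<lambda>i. f i + g i) (s + t) I"
  by (auto simp: phas_sum_def intro: has_sum_add)

lemma phas_sum_sum:
  "(\<And>j. j \<in> J \<Longrightarrow> phas_sum (f j) (s j) I) \<Longrightarrow> phas_sum (\<lambda>i. \<Sum>j\<in>J. f j i) (\<Sum>j\<in>J. s j) I"
proof (induction J rule: infinite_finite_induct)
  case (insert x F)
  then show ?case by (simp add: phas_sum_add)
qed (simp_all add: phas_sum_def)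

text \<open>A monomial has finitely many divisors, so each coefficient of the product is a finite
  combination of convergent coefficient sums.\<close>

lemma phas_sum_cmult:
  assumes "phas_sum f s I" shows "phas_sum (\<lambda>i. c * f i) (c * s) I"
  unfolding phas_sum_def
proof
  fix M
  have "((\<lambda>i. \<Sum>A\<in>{A. A \<subseteq># M}. pcoeff c A * pcoeff (f i) (M - A)) has_sum
      (\<Sum>A\<in>{A. A \<subseteq># M}. pcoeff c A * pcoeff s (M - A))) I"
    by (intro has_sum_sum has_sum_cmult_right phas_sumD assms)
  then show "((\<lambda>i. pcoeff (c * f i) M) has_sum pcoeff (c * s) M) I"
    by (simp add: pcoeff_mult)
qed

lemma phas_sum_cmult_right: "phas_sum f s I \<Longrightarrow> phas_sum (\<lambda>i. f i * c) (s * c) I"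
  using phas_sum_cmult[of f s I c] by (simp add: mult.commute)

lemma phas_sum_finite:
  assumes "finite B" "B \<subseteq> A" "\<And>x. x \<in> A - B \<Longrightarrow> f x = 0"
  shows "phas_sum f (\<Sum>x\<in>B. f x) A"
  unfolding phas_sum_def pcoeff_sum
  by (intro allI has_sum_finite_neutralI[OF assms(1,2)]) (simp_all add: assms(3))

lemma phas_sum_Sigma:
  assumes "phas_sum f a (A \<times> B)" "\<And>x. x \<in> A \<Longrightarrow> phas_sum (\<lambda>y. f (x, y)) (b x) B"
  shows "phas_sum b a A"
  unfolding phas_sum_def
proof
  fix M
  show "((\<lambda>i. pcoeff (b i) M) has_sum pcoeff a M) A"
    by (rule has_sum_Sigma'[OF phas_sumD[OF assms(1)]]) (rule phas_sumD[OF assms(2)])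
qed

lemma phas_sum_swap:
  "phas_sum f a (A \<times> B) \<Longrightarrow> phas_sum (\<lambda>(x, y). f (y, x)) a (B \<times> A)"
  unfolding phas_sum_def using has_sum_swap[of "\<lambda>p. pcoeff (f p) M" for M]
  by (simp add: case_prod_unfold)

section \<open>Decomposition of power series by total degree\<close>

definition homogeneous :: "nat \<Rightarrow> 'v pser \<Rightarrow> bool"
  where "homogeneous n f \<longleftrightarrow> (\<forall>M. pcoeff f M \<noteq> 0 \<longrightarrow> size M = n)"

lemma homogeneousD: "homogeneous n f \<Longrightarrow> size M \<noteq> n \<Longrightarrow> pcoeff f M = 0"
  by (auto simp: homogeneous_def)

lemma homogeneous_mult:
  assumes "homogeneous m f" "homogeneous n g" shows "homogeneous (m + n) (f * g)"
  unfolding homogeneous_def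
proof (intro allI impI)
  fix M assume "pcoeff (f * g) M \<noteq> 0"
  then obtain A where "A \<subseteq># M" "pcoeff f A * pcoeff g (M - A) \<noteq> 0"
    unfolding pcoeff_mult by (metis (no_types, lifting) mem_Collect_eq sum.neutral)
  then have "size A = m" "size (M - A) = n"
    using assms by (auto simp: homogeneous_def)
  with \<open>A \<subseteq># M\<close> show "size M = m + n"
    using size_mset_mono[of A M] by (simp add: size_Diff_submset)
qed

lemma homogeneous_0 [simp]: "homogeneous n 0"
  by (simp add: homogeneous_def)

lemma homogeneous_1: "homogeneous 0 1"
  by (simp add: homogeneous_def pcoeff_one)

lemma homogeneous_power: "homogeneous n f \<Longrightarrow> homogeneous (j * n) (f ^ j)"
  by (induction j) (simp_all add: homogeneous_1 homogeneous_mult)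

lemma homogeneous_const_mult: "homogeneous n f \<Longrightarrow> homogeneous n (pconst c * f)"
  by (auto simp: homogeneous_def)

lemma homogeneous_sum: "(\<And>i. i \<in> I \<Longrightarrow> homogeneous n (f i)) \<Longrightarrow> homogeneous n (\<Sum>i\<in>I. f i)"
  unfolding homogeneous_def pcoeff_sum by (metis sum.neutral)

lemma homogeneous_phas_sum:
  assumes "phas_sum f s I" "\<And>i. i \<in> I \<Longrightarrow> homogeneous n (f i)"
  shows "homogeneous n s"
  unfolding homogeneous_def
proof (intro allI impI, rule ccontr)
  fix M assume "pcoeff s M \<noteq> 0" "size M \<noteq> n"
  moreover have "((\<lambda>i. pcoeff (f i) M) has_sum pcoeff s M) I" by (rule phas_sumD[OF assms(1)])
  moreover have "((\<lambda>i. pcoeff (f i) M) has_sum 0) I"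
    by (rule has_sum_0) (use assms(2) \<open>size M \<noteq> n\<close> in \<open>auto intro: homogeneousD\<close>)
  ultimately show False using has_sum_unique by blast
qed

text \<open>g lists the homogeneous components of f. Each coefficient of f is read off from a single
  component, so no infinite sum over degrees occurs.\<close>

definition graded :: "'v pser \<Rightarrow> (nat \<Rightarrow> 'v pser) \<Rightarrow> bool"
  where "graded f g \<longleftrightarrow> (\<forall>n. homogeneous n (g n)) \<and> (\<forall>M. pcoeff f M = pcoeff (g (size M)) M)"

lemma graded_mult:
  assumes "graded f g" "graded f' g'"
  shows "graded (f * f') (\<lambda>n. \<Sum>a\<le>n. g a * g' (n - a))"
  unfolding graded_def
proof (intro conjI allI)
  fix n
  show "homogeneous n (\<Sum>a\<le>n. g a * g' (n - a))"
    using assms homogeneous_mult[of _ "g _" _ "g' _"]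
    by (intro homogeneous_sum) (metis atMost_iff graded_def le_add_diff_inverse)
next
  fix M
  have "pcoeff (\<Sum>a\<le>size M. g a * g' (size M - a)) M =
      (\<Sum>a\<le>size M. \<Sum>A | A \<subseteq># M. pcoeff (g a) A * pcoeff (g' (size M - a)) (M - A))"
    by (simp add: pcoeff_sum pcoeff_mult)
  also have "\<dots> = (\<Sum>A | A \<subseteq># M. \<Sum>a\<le>size M. pcoeff (g a) A * pcoeff (g' (size M - a)) (M - A))"
    by (rule sum.swap)
  also have "\<dots> = (\<Sum>A | A \<subseteq># M. pcoeff f A * pcoeff f' (M - A))"
  proof (rule sum.cong[OF refl])
    fix A assume "A \<in> {A. A \<subseteq># M}"
    then have A: "A \<subseteq># M" by simp
    have "(\<Sum>a\<le>size M. pcoeff (g a) A * pcoeff (g' (size M - a)) (M - A)) =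
        (\<Sum>a\<le>size M. if a = size A then pcoeff f A * pcoeff f' (M - A) else 0)"
    proof (rule sum.cong[OF refl])
      fix a
      have hom: "homogeneous n (g n)" for n using assms by (simp add: graded_def)
      show "pcoeff (g a) A * pcoeff (g' (size M - a)) (M - A) =
          (if a = size A then pcoeff f A * pcoeff f' (M - A) else 0)"
      proof (cases "a = size A")
        case True
        with assms A show ?thesis by (simp add: graded_def size_Diff_submset)
      next
        case False
        then have "pcoeff (g a) A = 0" by (intro homogeneousD[OF hom]) simp
        with False show ?thesis by simp
      qed
    qed
    then show "(\<Sum>a\<le>size M. pcoeff (g a) A * pcoeff (g' (size M - a)) (M - A)) =
        pcoeff f A * pcoeff f' (M - A)"
      using size_mset_mono[OF A] by simp
  qed
  finally show "pcoeff (f * f') M = pcoeff (\<Sum>a\<le>size M. g a * g' (size M - a)) M"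
    by (simp add: pcoeff_mult)
qed

text \<open>Every coefficient lives in one degree, so a sum converges as soon as it does in each
  degree, and the limit is assembled from the limits of the components.\<close>

lemma graded_phas_sum:
  assumes "\<And>i. i \<in> I \<Longrightarrow> graded (f i) (\<lambda>n. g n i)" "\<And>n. phas_sum (g n) (s n) I"
  shows "\<exists>t. phas_sum f t I \<and> graded t s"
proof (intro exI conjI)
  let ?t = "Pser (\<lambda>M. pcoeff (s (size M)) M)"
  show "phas_sum f ?t I"
    unfolding phas_sum_def
  proof
    fix M
    show "((\<lambda>i. pcoeff (f i) M) has_sum pcoeff ?t M) I"
      unfolding pcoeff_Pser
      by (rule has_sum_cong[THEN iffD2, OF _ phas_sumD[OF assms(2)]])
        (use assms(1) in \<open>auto simp: graded_def\<close>)
  qed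
  show "graded ?t s"
    unfolding graded_def
  proof (intro conjI allI)
    fix n show "homogeneous n (s n)"
      by (rule homogeneous_phas_sum[OF assms(2)]) (use assms(1) in \<open>auto simp: graded_def\<close>)
  qed simp
qed

lemma graded_unique: "graded f g \<Longrightarrow> graded f' g \<Longrightarrow> f = f'"
  by (rule pser_eqI) (simp add: graded_def)

lemma graded_pinfsum:
  assumes "\<And>n. homogeneous n (g n)" shows "graded (pinfsum g UNIV) g"
  unfolding graded_def
proof (intro conjI allI assms)
  fix M
  have "((\<lambda>n. pcoeff (g n) M) has_sum (\<Sum>n\<in>{size M}. pcoeff (g n) M)) UNIV"
    by (rule has_sum_finite_neutralI[where B = "{size M}"]) (auto intro: homogeneousD[OF assms])
  then show "pcoeff (pinfsum g UNIV) M = pcoeff (g (size M)) M"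
    by (simp add: pinfsum_def infsumI)
qed

lemma graded_pexp:
  assumes "homogeneous 2 x"
  shows "graded (pexp x) (\<lambda>n. if even n then pconst (1 / fact (n div 2)) * x ^ (n div 2) else 0)"
  unfolding graded_def
proof (intro conjI allI)
  have hom: "homogeneous (j * 2) (pconst (1 / fact j) * x ^ j)" for j
    by (intro homogeneous_const_mult homogeneous_power assms)
  fix n show "homogeneous n (if even n then pconst (1 / fact (n div 2)) * x ^ (n div 2) else 0)"
  proof (cases "even n")
    case True
    then have "n div 2 * 2 = n" by simp
    with hom[of "n div 2"] True show ?thesis by simp
  qed simp
next
  have hom: "homogeneous (j * 2) (pconst (1 / fact j) * x ^ j)" for j
    by (intro homogeneous_const_mult homogeneous_power assms)
  fix M
  have "((\<lambda>n. pcoeff (pconst (1 / fact n) * x ^ n) M) has_sum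
      (\<Sum>n\<in>{size M div 2}. pcoeff (pconst (1 / fact n) * x ^ n) M)) UNIV"
  proof (rule has_sum_finite_neutralI[where B = "{size M div 2}"])
    fix n assume "n \<in> UNIV - {size M div 2}"
    then show "pcoeff (pconst (1 / fact n) * x ^ n) M = 0"
      by (intro homogeneousD[OF hom]) auto
  qed auto
  then have *: "pcoeff (pexp x) M = pcoeff (pconst (1 / fact (size M div 2)) * x ^ (size M div 2)) M"
    by (simp add: pexp_def pinfsum_def infsumI)
  show "pcoeff (pexp x) M = pcoeff (if even (size M) then pconst (1 / fact (size M div 2)) * x ^ (size M div 2) else 0) M"
    unfolding * using homogeneousD[OF hom[of "size M div 2"], of M] by (auto elim: oddE)
qed

section \<open>Words of letters acting on partitions\<close>

definition pchains :: "nat \<Rightarrow> (nat \<Rightarrow> nat) list set"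
  where "pchains n = {c. set c \<subseteq> partitions \<and> length c = n}"

text \<open>\<open>path_weight\<close> over an arbitrary alphabet, so that constants such as 1/k can
  be absorbed into T and letters can double as indeterminates.\<close>

definition chain_weight :: "('v \<Rightarrow> (nat \<Rightarrow> nat) \<Rightarrow> (nat \<Rightarrow> nat) \<Rightarrow> complex) \<Rightarrow> 'v list \<Rightarrow>
    (nat \<Rightarrow> nat) \<Rightarrow> (nat \<Rightarrow> nat) list \<Rightarrow> (nat \<Rightarrow> nat) \<Rightarrow> complex"
  where "chain_weight T us mu c nu =
    (\<Prod>t<length us. T (us ! t) ((mu # c @ [nu]) ! t) ((mu # c @ [nu]) ! Suc t))"

lemma chain_weight_single [simp]: "chain_weight T [u] mu [] nu = T u mu nu"
  by (simp add: chain_weight_def)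

lemma chain_weight_Cons:
  "chain_weight T (u # us) mu (rho # c) nu = T u mu rho * chain_weight T us rho c nu"
  unfolding chain_weight_def list.size add_Suc_right add_0_right prod.lessThan_Suc_shift by simp

lemma chain_weight_append:
  "us \<noteq> [] \<Longrightarrow> length us = Suc (length c) \<Longrightarrow>
    chain_weight T (us @ vs) mu (c @ rho # c') nu =
    chain_weight T us mu c rho * chain_weight T vs rho c' nu"
proof (induction c arbitrary: us mu)
  case Nil
  then obtain u where "us = [u]" by (auto simp: length_Suc_conv)
  then show ?case by (simp add: chain_weight_Cons)
next
  case (Cons x c)
  then obtain u us' where us: "us = u # us'" by (cases us) auto
  with Cons.prems have "length us' = Suc (length c)" by simp
  moreover from this have "us' \<noteq> []" by auto
  ultimately show ?case
    using us Cons.IH[of us' x] by (simp add: chain_weight_Cons)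
qed

lemma split_list_at:
  assumes "length c = m + Suc n"
  obtains a x b where "c = a @ x # b" "length a = m" "length b = n"
proof (rule that)
  show "c = take m c @ c ! m # drop (Suc m) c" using assms by (intro id_take_nth_drop) simp
qed (use assms in auto)

lemma bij_betw_chains2:
  "bij_betw (\<lambda>(rho, c1, c2). c1 @ rho # c2) (partitions \<times> pchains m \<times> pchains n) (pchains (m + Suc n))"
proof (rule bij_betw_imageI)
  show "inj_on (\<lambda>(rho, c1, c2). c1 @ rho # c2) (partitions \<times> pchains m \<times> pchains n)"
  proof (rule inj_onI)
    fix x y assume *: "x \<in> partitions \<times> pchains m \<times> pchains n" "y \<in> partitions \<times> pchains m \<times> pchains n"
      "(case x of (rho, c1, c2) \<Rightarrow> c1 @ rho # c2) = (case y of (rho, c1, c2) \<Rightarrow> c1 @ rho # c2)"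
    obtain k c1 c2 l d1 d2 where xy: "x = (k, c1, c2)" "y = (l, d1, d2)" by (metis prod.exhaust)
    with * have "length c1 = length d1" by (simp add: pchains_def)
    with *(3) show "x = y" by (simp add: xy)
  qed
  show "(\<lambda>(rho, c1, c2). c1 @ rho # c2) ` (partitions \<times> pchains m \<times> pchains n) = pchains (m + Suc n)"
  proof (intro equalityI subsetI)
    fix c assume c: "c \<in> pchains (m + Suc n)"
    then have "length c = m + Suc n" by (simp add: pchains_def)
    from split_list_at[OF this] obtain a x b where "c = a @ x # b" "length a = m" "length b = n" .
    with c show "c \<in> (\<lambda>(rho, c1, c2). c1 @ rho # c2) ` (partitions \<times> pchains m \<times> pchains n)"
      by (intro image_eqI[of _ _ "(x, a, b)"]) (auto simp: pchains_def)
  qed (auto simp: pchains_def)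
qed

lemma bij_betw_chains3:
  "bij_betw (\<lambda>((rho, lam), c1, c2, c3). c1 @ rho # c2 @ lam # c3)
    ((partitions \<times> partitions) \<times> pchains m \<times> pchains n \<times> pchains k) (pchains (m + Suc (n + Suc k)))"
proof -
  let ?g = "\<lambda>((rho, lam), c1, c2, c3). c1 @ rho # c2 @ lam # c3"
  let ?S = "(partitions \<times> partitions) \<times> pchains m \<times> pchains n \<times> pchains k"
  show ?thesis
  proof (rule bij_betw_imageI)
    show "inj_on ?g
        ?S"
    proof (rule inj_onI)
      fix x y assume *: "x \<in> ?S"
        "y \<in> ?S"
        "?g x =
         ?g y"
      obtain a b c1 c2 c3 a' b' d1 d2 d3 where xy: "x = ((a, b), c1, c2, c3)" "y = ((a', b'), d1, d2, d3)"
        by (metis prod.exhaust)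
      with * have "length c1 = length d1" "length c2 = length d2" by (simp_all add: pchains_def)
      with *(3) show "x = y" by (simp add: xy)
    qed
    show "?g `
        ?S = pchains (m + Suc (n + Suc k))"
    proof (intro equalityI subsetI)
      fix c assume c: "c \<in> pchains (m + Suc (n + Suc k))"
      then have "length c = m + Suc (n + Suc k)" by (simp add: pchains_def)
      from split_list_at[OF this] obtain a x b
        where b: "c = a @ x # b" "length a = m" "length b = n + Suc k" .
      from split_list_at[OF b(3)] obtain a' x' b'
        where "b = a' @ x' # b'" "length a' = n" "length b' = k" .
      with b c show "c \<in> ?g `
        ?S"
        by (intro image_eqI[of _ _ "((x, x'), a, a', b')"]) (auto simp: pchains_def)
    qed (auto simp: pchains_def)
  qed
qed

text \<open>The operator obtained by summing T_v times the indeterminate v over S; for a given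
  monomial the index set has at most one element.\<close>

definition linear_op :: "('v \<Rightarrow> (nat \<Rightarrow> nat) \<Rightarrow> (nat \<Rightarrow> nat) \<Rightarrow> complex) \<Rightarrow> 'v set \<Rightarrow> 'v op"
  where "linear_op T S mu nu = Pser (\<lambda>M. \<Sum>v | v \<in> S \<and> M = {#v#}. T v mu nu)"

definition kron :: "'a \<Rightarrow> 'a \<Rightarrow> 'v pser"
  where "kron mu nu = (if mu = nu then 1 else 0)"

text \<open>Finite columns for \<open>low\<close> and finite rows for \<open>up\<close> make every
  product with the \<open>up\<close> factor on the left a finite sum. In the opposite order two
  letters are governed by \<open>commutator\<close>, longer words by \<open>converge\<close>. The
  series \<xi> collects the central terms and has degree 2.\<close>

locale letter_ops =
  fixes T :: "'v \<Rightarrow> (nat \<Rightarrow> nat) \<Rightarrow> (nat \<Rightarrow> nat) \<Rightarrow> complex"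
    and low up :: "'v set" and \<omega> :: "'v \<Rightarrow> 'v \<Rightarrow> complex" and \<xi> :: "'v pser"
  assumes column_finite: "nu \<in> partitions \<Longrightarrow> finite {mu \<in> partitions. \<exists>v\<in>low. T v mu nu \<noteq> 0}"
    and row_finite: "mu \<in> partitions \<Longrightarrow> finite {nu \<in> partitions. \<exists>w\<in>up. T w mu nu \<noteq> 0}"
    and commutator: "mu \<in> partitions \<Longrightarrow> nu \<in> partitions \<Longrightarrow> v \<in> low \<Longrightarrow> w \<in> up \<Longrightarrow>
      \<exists>s. ((\<lambda>rho. T w mu rho * T v rho nu) has_sum s) partitions \<and>
        ((\<lambda>rho. T v mu rho * T w rho nu) has_sum s + (if mu = nu then \<omega> v w else 0)) partitions"
    and converge: "mu \<in> partitions \<Longrightarrow> nu \<in> partitions \<Longrightarrow> us \<in> lists low \<Longrightarrow> ws \<in> lists up \<Longrightarrow>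
      us @ ws \<noteq> [] \<Longrightarrow>
      (\<lambda>c. chain_weight T (us @ ws) mu c nu) summable_on pchains (length (us @ ws) - 1)"
    and \<xi>: "pcoeff \<xi> M = (\<Sum>(v, w) | v \<in> low \<and> w \<in> up \<and> M = {#v, w#}. \<omega> v w)"
begin

text \<open>Words whose lowering letters all precede the raising ones; only for these do the sums over
  chains of partitions converge.\<close>

definition ordered_word :: "'v list \<Rightarrow> bool"
  where "ordered_word us \<longleftrightarrow> set us \<subseteq> low \<union> up \<and> sorted_wrt (\<lambda>x y. x \<in> low \<or> y \<in> up) us"

lemma ordered_word_append:
  "ordered_word (us @ vs) \<Longrightarrow> ordered_word us \<and> ordered_word vs"
  by (simp add: ordered_word_def sorted_wrt_append)

lemma ordered_word_split:
  "ordered_word us \<Longrightarrow> \<exists>a\<in>lists low. \<exists>b\<in>lists up. us = a @ b"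
proof (induction us)
  case (Cons u us)
  then obtain a b where ab: "a \<in> lists low" "b \<in> lists up" "us = a @ b"
    by (auto simp: ordered_word_def)
  show ?case
  proof (cases "u \<in> low")
    case True
    with ab have "u # a \<in> lists low" "u # us = (u # a) @ b" by auto
    with ab(2) show ?thesis by blast
  next
    case False
    with Cons.prems have "u # us \<in> lists up" by (auto simp: ordered_word_def)
    moreover have "u # us = [] @ (u # us)" "[] \<in> lists low" by auto
    ultimately show ?thesis by blast
  qed
qed auto

lemma ordered_wordI:
  assumes "set us \<subseteq> low" "set vs \<subseteq> up" shows "ordered_word (us @ vs)"
proof -
  have "sorted_wrt (\<lambda>x y. x \<in> low \<or> y \<in> up) us" using assms(1) by (induction us) auto
  moreover have "sorted_wrt (\<lambda>x y. x \<in> low \<or> y \<in> up) vs" using assms(2) by (induction vs) auto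
  ultimately show ?thesis using assms by (auto simp: ordered_word_def sorted_wrt_append)
qed

text \<open>The matrix entry of the product of the letters. A word of n letters passes through n - 1
  intermediate partitions; for the empty word the truncated subtraction gives no identity matrix, so
  it is excluded below.\<close>

definition word_mat :: "'v list \<Rightarrow> (nat \<Rightarrow> nat) \<Rightarrow> (nat \<Rightarrow> nat) \<Rightarrow> complex"
  where "word_mat us mu nu = (\<Sum>\<^sub>\<infinity>c\<in>pchains (length us - 1). chain_weight T us mu c nu)"

lemma has_sum_word_mat:
  assumes "mu \<in> partitions" "nu \<in> partitions" "ordered_word us" "us \<noteq> []"
  shows "((\<lambda>c. chain_weight T us mu c nu) has_sum word_mat us mu nu) (pchains (length us - 1))"
proof -
  obtain a b where "a \<in> lists low" "b \<in> lists up" "us = a @ b"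
    using ordered_word_split[OF assms(3)] by blast
  with converge[OF assms(1,2), of a b] assms(4) show ?thesis
    by (simp add: word_mat_def)
qed

lemma pchains_0: "pchains 0 = {[]}"
  by (auto simp: pchains_def)

lemma word_mat_single [simp]: "word_mat [u] mu nu = T u mu nu"
  by (simp add: word_mat_def pchains_0)

lemma word_mat_product2:
  assumes "mu \<in> partitions" "nu \<in> partitions" and ord: "ordered_word (us @ vs)"
    and ne: "us \<noteq> []" "vs \<noteq> []"
  shows "((\<lambda>rho. word_mat us mu rho * word_mat vs rho nu) has_sum
    word_mat (us @ vs) mu nu) partitions"
proof -
  let ?m = "length us - 1" and ?n = "length vs - 1"
  have len: "length (us @ vs) - 1 = ?m + Suc ?n" using ne by (cases us; cases vs) auto
  have "((\<lambda>c. chain_weight T (us @ vs) mu c nu) has_sum word_mat (us @ vs) mu nu) (pchains (?m + Suc ?n))"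
    using has_sum_word_mat[OF assms(1,2) ord] ne by (simp only: len append_is_Nil_conv simp_thms)
  also have "?this \<longleftrightarrow> ((\<lambda>(rho, c1, c2). chain_weight T us mu c1 rho * chain_weight T vs rho c2 nu)
      has_sum word_mat (us @ vs) mu nu) (partitions \<times> pchains ?m \<times> pchains ?n)"
    unfolding has_sum_reindex_bij_betw[OF bij_betw_chains2, symmetric]
    by (rule has_sum_cong) (use ne in \<open>auto simp: pchains_def chain_weight_append\<close>)
  finally show ?thesis
  proof (rule has_sum_Sigma')
    fix rho assume rho: "rho \<in> partitions"
    show "((\<lambda>y. case (rho, y) of (rho, c1, c2) \<Rightarrow> chain_weight T us mu c1 rho * chain_weight T vs rho c2 nu)
        has_sum word_mat us mu rho * word_mat vs rho nu) (pchains ?m \<times> pchains ?n)"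
      unfolding prod.case using ordered_word_append[OF ord] ne assms rho
      by (intro has_sum_mult_Times has_sum_word_mat) auto
  qed
qed

text \<open>Cutting the chains at two places gives an unconditionally convergent sum over pairs of
  partitions, which later allows the two summations to be exchanged.\<close>

lemma word_mat_product3:
  assumes "mu \<in> partitions" "nu \<in> partitions" and ord: "ordered_word (us @ vs @ ws)"
    and ne: "us \<noteq> []" "vs \<noteq> []" "ws \<noteq> []"
  shows "((\<lambda>(rho, lam). word_mat us mu rho * (word_mat vs rho lam * word_mat ws lam nu)) has_sum
    word_mat (us @ vs @ ws) mu nu) (partitions \<times> partitions)"
proof -
  let ?m = "length us - 1" and ?n = "length vs - 1" and ?k = "length ws - 1"
  have len: "length (us @ vs @ ws) - 1 = ?m + Suc (?n + Suc ?k)"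
    using ne by (cases us; cases vs; cases ws) auto
  have ords: "ordered_word us" "ordered_word vs" "ordered_word ws"
    using ordered_word_append[OF ord] ordered_word_append by blast+
  have "((\<lambda>c. chain_weight T (us @ vs @ ws) mu c nu) has_sum word_mat (us @ vs @ ws) mu nu)
      (pchains (?m + Suc (?n + Suc ?k)))"
    using has_sum_word_mat[OF assms(1,2) ord] ne by (simp only: len append_is_Nil_conv simp_thms)
  also have "?this \<longleftrightarrow> ((\<lambda>((rho, lam), c1, c2, c3). chain_weight T us mu c1 rho *
      (chain_weight T vs rho c2 lam * chain_weight T ws lam c3 nu))
      has_sum word_mat (us @ vs @ ws) mu nu) ((partitions \<times> partitions) \<times> pchains ?m \<times> pchains ?n \<times> pchains ?k)"
    unfolding has_sum_reindex_bij_betw[OF bij_betw_chains3, symmetric]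
    by (rule has_sum_cong) (use ne in \<open>auto simp: pchains_def chain_weight_append\<close>)
  finally show ?thesis
  proof (rule has_sum_Sigma')
    fix x assume "x \<in> partitions \<times> partitions"
    then obtain rho lam where x: "x = (rho, lam)" "rho \<in> partitions" "lam \<in> partitions" by blast
    have "((\<lambda>(c1, c23). chain_weight T us mu c1 rho * (case c23 of (c2, c3) \<Rightarrow>
          chain_weight T vs rho c2 lam * chain_weight T ws lam c3 nu)) has_sum
        word_mat us mu rho * (word_mat vs rho lam * word_mat ws lam nu))
        (pchains ?m \<times> pchains ?n \<times> pchains ?k)"
      using ords ne assms x by (intro has_sum_mult_Times has_sum_word_mat) auto
    then show "((\<lambda>y. (\<lambda>((rho, lam), c1, c2, c3). chain_weight T us mu c1 rho *
        (chain_weight T vs rho c2 lam * chain_weight T ws lam c3 nu)) (x, y))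
        has_sum (\<lambda>(rho, lam). word_mat us mu rho * (word_mat vs rho lam * word_mat ws lam nu)) x)
        (pchains ?m \<times> pchains ?n \<times> pchains ?k)"
      by (simp add: x case_prod_unfold)
  qed
qed

section \<open>Operators expanded over words\<close>

definition words :: "'v set \<Rightarrow> nat \<Rightarrow> 'v multiset \<Rightarrow> 'v list set"
  where "words S n A = {us. mset us = A \<and> set us \<subseteq> S \<and> length us = n}"

lemma finite_words: "finite (words S n A)"
proof (rule finite_subset)
  show "words S n A \<subseteq> {us. set us \<subseteq> set_mset A \<and> length us = n}" by (auto simp: words_def)
qed (rule finite_lists_length_eq, simp)

text \<open>The letters commute as indeterminates but not as operators, so the coefficient of a
  monomial sums over all its orderings into words.\<close>

definition word_op :: "'v op \<Rightarrow> 'v set \<Rightarrow> nat \<Rightarrow> bool"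
  where "word_op X S n \<longleftrightarrow> (\<forall>mu\<in>partitions. \<forall>nu\<in>partitions. \<forall>A.
    pcoeff (X mu nu) A = (\<Sum>us\<in>words S n A. word_mat us mu nu))"

lemma word_op_product2:
  assumes X: "word_op X S m" and Y: "word_op Y S' n" and ne: "m \<ge> 1" "n \<ge> 1"
    and ord: "\<And>us vs. set us \<subseteq> S \<Longrightarrow> set vs \<subseteq> S' \<Longrightarrow> ordered_word (us @ vs)"
    and mu: "mu \<in> partitions" and nu: "nu \<in> partitions"
  shows "phas_sum (\<lambda>rho. X mu rho * Y rho nu)
    (Pser (\<lambda>M. \<Sum>A | A \<subseteq># M. \<Sum>us\<in>words S m A. \<Sum>vs\<in>words S' n (M - A). word_mat (us @ vs) mu nu)) partitions"
  unfolding phas_sum_def pcoeff_Pser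
proof
  fix M
  let ?s = "\<Sum>A | A \<subseteq># M. \<Sum>us\<in>words S m A. \<Sum>vs\<in>words S' n (M - A). word_mat (us @ vs) mu nu"
  have "((\<lambda>rho. \<Sum>A | A \<subseteq># M. \<Sum>us\<in>words S m A. \<Sum>vs\<in>words S' n (M - A).
      word_mat us mu rho * word_mat vs rho nu) has_sum
    ?s) partitions"
    using ne by (intro has_sum_sum word_mat_product2 mu nu ord) (auto simp: words_def)
  also have "?this \<longleftrightarrow> ((\<lambda>rho. pcoeff (X mu rho * Y rho nu) M) has_sum
    ?s) partitions"
    using X Y mu nu by (intro has_sum_cong) (simp add: pcoeff_mult word_op_def sum_product)
  finally show \<dots> .
qed

lemma word_op_product3:
  assumes X: "word_op X S m" and Y: "word_op Y S' n" and Z: "word_op Z S'' k"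
    and ne: "m \<ge> 1" "n \<ge> 1" "k \<ge> 1"
    and ord: "\<And>us vs ws. set us \<subseteq> S \<Longrightarrow> set vs \<subseteq> S' \<Longrightarrow> set ws \<subseteq> S'' \<Longrightarrow> ordered_word (us @ vs @ ws)"
    and mu: "mu \<in> partitions" and nu: "nu \<in> partitions"
  shows "\<exists>s. phas_sum (\<lambda>(rho, lam). X mu rho * (Y rho lam * Z lam nu)) s (partitions \<times> partitions)"
proof -
  have "(\<lambda>x. pcoeff (case x of (rho, lam) \<Rightarrow> X mu rho * (Y rho lam * Z lam nu)) M) summable_on (partitions \<times> partitions)" for M
  proof -
    let ?f = "\<lambda>x. \<Sum>A | A \<subseteq># M. \<Sum>B | B \<subseteq># M - A. \<Sum>us\<in>words S m A. \<Sum>vs\<in>words S' n B. \<Sum>ws\<in>words S'' k (M - A - B).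
        (\<lambda>(rho, lam). word_mat us mu rho * (word_mat vs rho lam * word_mat ws lam nu)) x"
    have "(?f has_sum
      (\<Sum>A | A \<subseteq># M. \<Sum>B | B \<subseteq># M - A. \<Sum>us\<in>words S m A. \<Sum>vs\<in>words S' n B. \<Sum>ws\<in>words S'' k (M - A - B).
        word_mat (us @ vs @ ws) mu nu)) (partitions \<times> partitions)"
      using ne by (intro has_sum_sum word_mat_product3 mu nu ord) (auto simp: words_def)
    then have "?f
        summable_on (partitions \<times> partitions)"
      by (auto simp: summable_on_def)
    also have "?this \<longleftrightarrow> ?thesis"
    proof (rule summable_on_cong)
      fix x assume "x \<in> partitions \<times> partitions"
      then obtain rho lam where x: "x = (rho, lam)" "rho \<in> partitions" "lam \<in> partitions" by blast
      have "pcoeff (X mu rho * (Y rho lam * Z lam nu)) M =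
        (\<Sum>A | A \<subseteq># M. \<Sum>B | B \<subseteq># M - A. (\<Sum>us\<in>words S m A. word_mat us mu rho) *
          ((\<Sum>vs\<in>words S' n B. word_mat vs rho lam) * (\<Sum>ws\<in>words S'' k (M - A - B). word_mat ws lam nu)))"
        using X Y Z mu nu x by (simp add: pcoeff_mult word_op_def sum_distrib_left)
      also have "\<dots> = (\<Sum>A | A \<subseteq># M. \<Sum>B | B \<subseteq># M - A. \<Sum>us\<in>words S m A. \<Sum>vs\<in>words S' n B. \<Sum>ws\<in>words S'' k (M - A - B).
        word_mat us mu rho * (word_mat vs rho lam * word_mat ws lam nu))"
        unfolding sum_product unfolding sum_distrib_left ..
      finally show "?f x =
        pcoeff (case x of (rho, lam) \<Rightarrow> X mu rho * (Y rho lam * Z lam nu)) M"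
        by (simp add: x)
    qed
    finally show ?thesis .
  qed
  then have "psummable (\<lambda>(rho, lam). X mu rho * (Y rho lam * Z lam nu)) (partitions \<times> partitions)"
    by (simp add: psummable_def)
  then show ?thesis using psummable_phas_sum by blast
qed

lemma word_op_linear: "word_op (linear_op T S) S 1"
  unfolding word_op_def
proof (intro ballI allI)
  fix mu nu A
  have "(\<Sum>us\<in>words S 1 A. word_mat us mu nu) = (\<Sum>v | v \<in> S \<and> A = {#v#}. T v mu nu)"
    by (rule sum.reindex_bij_witness[of _ "\<lambda>v. [v]" hd]) (auto simp: words_def length_Suc_conv)
  then show "pcoeff (linear_op T S mu nu) A = (\<Sum>us\<in>words S 1 A. word_mat us mu nu)"
    by (simp add: linear_op_def)
qed

lemma op_power_one:
  assumes "nu \<in> partitions"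
  shows "op_power X 1 mu nu = X mu nu"
proof -
  have "phas_sum (\<lambda>rho. X mu rho * op_power X 0 rho nu)
      (\<Sum>rho\<in>{nu}. X mu rho * op_power X 0 rho nu) partitions"
    by (rule phas_sum_finite) (use assms in auto)
  from phas_sum_pinfsum[OF this] show ?thesis by simp
qed

lemma word_op_power:
  assumes ord: "\<And>us. set us \<subseteq> S \<Longrightarrow> ordered_word us" and "n \<ge> 1"
  shows "word_op (op_power (linear_op T S) n) S n"
  using \<open>n \<ge> 1\<close>
proof (induction n rule: nat_induct_at_least)
  case base
  show ?case using word_op_linear[of S] by (simp add: word_op_def op_power_one[unfolded One_nat_def] del: op_power.simps)
next
  case (Suc n)
  show ?case unfolding word_op_def
  proof (intro ballI allI)
    fix mu nu M assume "mu \<in> partitions" "nu \<in> partitions"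
    have "pinfsum (\<lambda>rho. linear_op T S mu rho * op_power (linear_op T S) n rho nu) partitions =
      Pser (\<lambda>M. \<Sum>A | A \<subseteq># M. \<Sum>us\<in>words S 1 A. \<Sum>vs\<in>words S n (M - A). word_mat (us @ vs) mu nu)"
      by (rule phas_sum_pinfsum, rule word_op_product2[OF word_op_linear Suc.IH])
        (use Suc.hyps \<open>mu \<in> _\<close> \<open>nu \<in> _\<close> in \<open>auto intro!: ord\<close>)
    then have "pcoeff (op_power (linear_op T S) (Suc n) mu nu) M =
      (\<Sum>A | A \<subseteq># M. \<Sum>us\<in>words S 1 A. \<Sum>vs\<in>words S n (M - A). word_mat (us @ vs) mu nu)"
      by simp
    also have "\<dots> = (\<Sum>(A, us)\<in>(SIGMA A:{A. A \<subseteq># M}. words S 1 A). \<Sum>vs\<in>words S n (M - A). word_mat (us @ vs) mu nu)"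
      by (rule sum.Sigma) (auto simp: finite_submultisets finite_words)
    also have "\<dots> = (\<Sum>((A, us), vs)\<in>(SIGMA p:(SIGMA A:{A. A \<subseteq># M}. words S 1 A). words S n (M - fst p)).
        word_mat (us @ vs) mu nu)"
      unfolding case_prod_unfold
      by (subst sum.Sigma) (auto simp: finite_submultisets finite_words case_prod_unfold)
    also have "\<dots> = (\<Sum>us\<in>words S (Suc n) M. word_mat us mu nu)"
      \<comment> \<open>A nonempty word is its first letter followed by the rest, and A can only be
        the singleton multiset of that letter.\<close>
      by (rule sum.reindex_bij_witness[of _ "\<lambda>us. (({#hd us#}, [hd us]), tl us)" "\<lambda>((A, us), vs). us @ vs"])
        (auto simp: words_def length_Suc_conv dest: subset_mset.add_diff_inverse)
    finally show "pcoeff (op_power (linear_op T S) (Suc n) mu nu) M = (\<Sum>us\<in>words S (Suc n) M. word_mat us mu nu)" .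
  qed
qed

end

section \<open>Exponentials of operators with central commutator\<close>

context letter_ops
begin

definition "H = linear_op T low"
definition "K = linear_op T up"

definition row_supp :: "(nat \<Rightarrow> nat) \<Rightarrow> (nat \<Rightarrow> nat) set"
  where "row_supp mu = {nu \<in> partitions. \<exists>w\<in>up. T w mu nu \<noteq> 0}"

definition col_supp :: "nat \<Rightarrow> (nat \<Rightarrow> nat) \<Rightarrow> (nat \<Rightarrow> nat) set"
  where "col_supp n nu = {mu \<in> partitions. op_power H n mu nu \<noteq> 0}"

lemma linear_op_eq_0: "(\<And>v. v \<in> S \<Longrightarrow> T v mu nu = 0) \<Longrightarrow> linear_op T S mu nu = 0"
  by (rule pser_eqI) (simp add: linear_op_def)

lemma finite_row_supp: "mu \<in> partitions \<Longrightarrow> finite (row_supp mu)"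
  unfolding row_supp_def by (rule row_finite)

lemma row_supp_partitions: "nu \<in> row_supp mu \<Longrightarrow> nu \<in> partitions"
  by (simp add: row_supp_def)

lemma K_eq_0: "nu \<in> partitions - row_supp mu \<Longrightarrow> K mu nu = 0"
  unfolding K_def by (rule linear_op_eq_0) (auto simp: row_supp_def)

lemma finite_col_supp: "nu \<in> partitions \<Longrightarrow> finite (col_supp n nu)"
proof (induction n)
  case 0
  then show ?case by (simp add: col_supp_def)
next
  case (Suc n)
  have "col_supp (Suc n) nu \<subseteq>
      (\<Union>rho\<in>col_supp n nu. {mu \<in> partitions. \<exists>v\<in>low. T v mu rho \<noteq> 0})"
  proof
    fix mu assume mu: "mu \<in> col_supp (Suc n) nu"
    have "\<exists>rho\<in>partitions. H mu rho * op_power H n rho nu \<noteq> 0"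
    proof (rule ccontr)
      assume "\<not> ?thesis"
      then have "phas_sum (\<lambda>rho. H mu rho * op_power H n rho nu) (\<Sum>rho\<in>{}. H mu rho * op_power H n rho nu) partitions"
        by (intro phas_sum_finite) auto
      from phas_sum_pinfsum[OF this] mu show False by (simp add: col_supp_def)
    qed
    then obtain rho where rho: "rho \<in> partitions" "H mu rho \<noteq> 0" "op_power H n rho nu \<noteq> 0"
      by fastforce
    then have "\<exists>v\<in>low. T v mu rho \<noteq> 0"
      using linear_op_eq_0[of low mu rho] by (auto simp: H_def)
    with rho mu show "mu \<in> (\<Union>rho\<in>col_supp n nu. {mu \<in> partitions. \<exists>v\<in>low. T v mu rho \<noteq> 0})"
      by (auto simp: col_supp_def)
  qed
  moreover have "finite \<dots>"
    using Suc by (intro finite_UN_I) (auto simp: col_supp_def intro: column_finite)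
  ultimately show ?case by (rule finite_subset)
qed

lemma phas_sum_row:
  "mu \<in> partitions \<Longrightarrow> phas_sum (\<lambda>rho. K mu rho * f rho) (\<Sum>rho\<in>row_supp mu. K mu rho * f rho) partitions"
  by (rule phas_sum_finite) (use K_eq_0 in \<open>auto simp: finite_row_supp intro: row_supp_partitions\<close>)

lemma phas_sum_column:
  "nu \<in> partitions \<Longrightarrow> phas_sum (\<lambda>rho. f rho * op_power H n rho nu)
    (\<Sum>rho\<in>col_supp n nu. f rho * op_power H n rho nu) partitions"
  by (rule phas_sum_finite[OF finite_col_supp]) (auto simp: col_supp_def)

lemma op_power_H_Suc:
  assumes "nu \<in> partitions"
  shows "phas_sum (\<lambda>rho. H mu rho * op_power H n rho nu) (op_power H (Suc n) mu nu) partitions"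
  using phas_sum_column[OF assms, of "\<lambda>rho. H mu rho" n]
  by (simp add: phas_sum_pinfsum[OF phas_sum_column[OF assms]])

lemma op_power_K_Suc:
  assumes "mu \<in> partitions"
  shows "phas_sum (\<lambda>rho. K mu rho * op_power K n rho nu) (op_power K (Suc n) mu nu) partitions"
  using phas_sum_row[OF assms, of "\<lambda>rho. op_power K n rho nu"]
  by (simp add: phas_sum_pinfsum[OF phas_sum_row[OF assms]])

lemma op_power_H_Suc_sum:
  "nu \<in> partitions \<Longrightarrow> op_power H (Suc n) mu nu = (\<Sum>rho\<in>col_supp n nu. H mu rho * op_power H n rho nu)"
  by (rule phas_sum_unique[OF op_power_H_Suc phas_sum_column])

lemma op_power_K_Suc_sum:
  "mu \<in> partitions \<Longrightarrow> op_power K (Suc n) mu nu = (\<Sum>rho\<in>row_supp mu. K mu rho * op_power K n rho nu)"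
  by (rule phas_sum_unique[OF op_power_K_Suc phas_sum_row])

lemma pcoeff_linear_op_mult:
  "pcoeff (linear_op T S mu rho * linear_op T S' rho' nu) M =
    (\<Sum>(v, w) | v \<in> S \<and> w \<in> S' \<and> M = {#v, w#}. T v mu rho * T w rho' nu)"
proof -
  have fin: "finite {v. v \<in> S \<and> A = {#v#}}" for S and A :: "'v multiset"
    by (rule finite_subset[of _ "set_mset A"]) auto
  have pair: "M = {#v, w#}" if "v \<in># M" "M - {#v#} = {#w#}" for v w
    using that by (metis insert_DiffM)
  have "pcoeff (linear_op T S mu rho * linear_op T S' rho' nu) M =
      (\<Sum>A | A \<subseteq># M. \<Sum>(v, w)\<in>{v. v \<in> S \<and> A = {#v#}} \<times> {w. w \<in> S' \<and> M - A = {#w#}}. T v mu rho * T w rho' nu)"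
    unfolding pcoeff_mult linear_op_def pcoeff_Pser sum_product sum.cartesian_product ..
  also have "\<dots> = (\<Sum>(A, v, w)\<in>(SIGMA A:{A. A \<subseteq># M}. {v. v \<in> S \<and> A = {#v#}} \<times> {w. w \<in> S' \<and> M - A = {#w#}}).
      T v mu rho * T w rho' nu)"
    by (subst sum.Sigma) (auto simp: finite_submultisets fin case_prod_unfold)
  also have "\<dots> = (\<Sum>(v, w) | v \<in> S \<and> w \<in> S' \<and> M = {#v, w#}. T v mu rho * T w rho' nu)"
    by (rule sum.reindex_bij_witness[of _ "\<lambda>(v, w). ({#v#}, v, w)" "\<lambda>(A, v, w). (v, w)"])
      (auto intro: pair)
  finally show ?thesis .
qed

text \<open>Each monomial involves finitely many pairs of letters, so \<open>commutator\<close>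
  applies coefficientwise. The sum for K H is finite, and this identifies the value s that
  \<open>commutator\<close> leaves unspecified.\<close>

lemma H_K_commute:
  assumes mu: "mu \<in> partitions" and nu: "nu \<in> partitions"
  shows "phas_sum (\<lambda>rho. H mu rho * K rho nu)
    ((\<Sum>rho\<in>row_supp mu. K mu rho * H rho nu) + \<xi> * kron mu nu) partitions"
  unfolding phas_sum_def
proof
  fix M
  define VW where "VW = {(v, w). v \<in> low \<and> w \<in> up \<and> M = {#v, w#}}"
  define s where "s = (\<lambda>(v, w). \<Sum>\<^sub>\<infinity>rho\<in>partitions. T w mu rho * T v rho nu)"
  have comm: "((\<lambda>rho. T w mu rho * T v rho nu) has_sum s (v, w)) partitions"
    "((\<lambda>rho. T v mu rho * T w rho nu) has_sum s (v, w) + (if mu = nu then \<omega> v w else 0)) partitions"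
    if "(v, w) \<in> VW" for v w
    using commutator[OF mu nu, of v w] that by (auto simp: VW_def s_def infsumI)
  have HK: "pcoeff (H mu rho * K rho nu) M = (\<Sum>(v, w)\<in>VW. T v mu rho * T w rho nu)" for rho
    by (simp add: H_def K_def pcoeff_linear_op_mult VW_def)
  have KH: "pcoeff (K mu rho * H rho nu) M = (\<Sum>(v, w)\<in>VW. T w mu rho * T v rho nu)" for rho
    unfolding H_def K_def pcoeff_linear_op_mult VW_def
    by (rule sum.reindex_bij_witness[of _ prod.swap prod.swap]) (auto simp: add_mset_commute)
  have "((\<lambda>rho. pcoeff (K mu rho * H rho nu) M) has_sum sum s VW) partitions"
    unfolding KH using comm(1) by (intro has_sum_sum) (auto simp: case_prod_unfold)
  moreover have "((\<lambda>rho. pcoeff (K mu rho * H rho nu) M) has_sum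
      pcoeff (\<Sum>rho\<in>row_supp mu. K mu rho * H rho nu) M) partitions"
    by (rule phas_sumD[OF phas_sum_row[OF mu]])
  ultimately have s: "sum s VW = pcoeff (\<Sum>rho\<in>row_supp mu. K mu rho * H rho nu) M"
    by (rule has_sum_unique)
  have "((\<lambda>rho. pcoeff (H mu rho * K rho nu) M) has_sum
      (\<Sum>p\<in>VW. s p + (if mu = nu then case_prod \<omega> p else 0))) partitions"
    unfolding HK using comm(2) by (intro has_sum_sum) (auto simp: case_prod_unfold)
  also have "(\<Sum>p\<in>VW. s p + (if mu = nu then case_prod \<omega> p else 0)) =
      pcoeff ((\<Sum>rho\<in>row_supp mu. K mu rho * H rho nu) + \<xi> * kron mu nu) M"
    unfolding sum.distrib s by (auto simp: kron_def \<xi> VW_def)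
  finally show "((\<lambda>rho. pcoeff (H mu rho * K rho nu) M) has_sum
      pcoeff ((\<Sum>rho\<in>row_supp mu. K mu rho * H rho nu) + \<xi> * kron mu nu) M) partitions" .
qed

lemma word_ops:
  assumes "n \<ge> 1"
  shows "word_op (op_power H n) low n" "word_op (op_power K n) up n" "word_op H low 1" "word_op K up 1"
  unfolding H_def K_def using assms ordered_wordI[of _ "[]"] ordered_wordI[of "[]"]
  by (auto intro!: word_op_power word_op_linear simp del: One_nat_def)

text \<open>Induction on n. The triple product of H, H^(n+1) and K converges unconditionally, hence
  is associative; moving K to the left past the additional H contributes one more \<xi>
  H^(n+1).\<close>

lemma op_power_H_K:
  assumes "mu \<in> partitions" "nu \<in> partitions"
  shows "phas_sum (\<lambda>lam. op_power H (Suc n) mu lam * K lam nu)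
    ((\<Sum>rho\<in>row_supp mu. K mu rho * op_power H (Suc n) rho nu) + of_nat (Suc n) * \<xi> * op_power H n mu nu)
    partitions"
  using assms
proof (induction n arbitrary: mu nu)
  case 0
  have "phas_sum (\<lambda>lam. op_power H 1 mu lam * K lam nu)
      ((\<Sum>rho\<in>row_supp mu. K mu rho * op_power H 1 rho nu) + of_nat 1 * \<xi> * op_power H 0 mu nu) partitions
      \<longleftrightarrow> phas_sum (\<lambda>rho. H mu rho * K rho nu)
      ((\<Sum>rho\<in>row_supp mu. K mu rho * op_power H 1 rho nu) + of_nat 1 * \<xi> * op_power H 0 mu nu) partitions"
    by (rule phas_sum_cong) (simp only: op_power_one)
  with H_K_commute[OF 0] 0 show ?case
    by (simp add: op_power_one[unfolded One_nat_def] kron_def del: op_power.simps(2))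
next
  case (Suc n)
  note mu = Suc.prems(1) and nu = Suc.prems(2)
  let ?Y = "op_power H (Suc n)" and ?C = "col_supp (Suc n) nu"
  let ?w = "\<lambda>rho. of_nat (Suc n) * \<xi> * op_power H n rho nu"
  let ?t = "\<Sum>rho\<in>row_supp mu. K mu rho * op_power H (Suc (Suc n)) rho nu"
  have C: "rho \<in> ?C \<Longrightarrow> rho \<in> partitions" for rho by (simp add: col_supp_def)
  have ord: "ordered_word (us @ vs @ ws)" if "set us \<subseteq> low" "set vs \<subseteq> low" "set ws \<subseteq> up" for us vs ws
    using ordered_wordI[of "us @ vs" ws] that by simp
  have "Suc n \<ge> 1" by simp
  have "\<exists>s. phas_sum (\<lambda>(rho, lam). H mu rho * (?Y rho lam * K lam nu)) s (partitions \<times> partitions)"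
    by (rule word_op_product3[OF word_ops(3)[OF order_refl] word_ops(1)[OF \<open>Suc n \<ge> 1\<close>]
          word_ops(4)[OF order_refl] _ _ _ ord mu nu]) simp_all
  then obtain s where s: "phas_sum (\<lambda>(rho, lam). H mu rho * (?Y rho lam * K lam nu)) s (partitions \<times> partitions)"
    by blast
  have left: "phas_sum (\<lambda>lam. op_power H (Suc (Suc n)) mu lam * K lam nu) s partitions"
  proof (rule phas_sum_Sigma[OF phas_sum_swap[OF s]])
    fix lam assume "lam \<in> partitions"
    from phas_sum_cmult_right[OF op_power_H_Suc[OF this, of mu "Suc n"], of "K lam nu"]
    show "phas_sum (\<lambda>y. case (lam, y) of (x, y) \<Rightarrow> case (y, x) of (rho, lam) \<Rightarrow> H mu rho * (?Y rho lam * K lam nu))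
        (op_power H (Suc (Suc n)) mu lam * K lam nu) partitions"
      by (simp add: mult.assoc del: op_power.simps)
  qed
  have "phas_sum (\<lambda>rho. H mu rho * ((\<Sum>lam\<in>?C. K rho lam * ?Y lam nu) + ?w rho)) s partitions"
  proof (rule phas_sum_Sigma[OF s])
    fix rho assume rho: "rho \<in> partitions"
    \<comment> \<open>The row support depends on rho, the column support of H^(n+1) at nu does not;
      only the latter lets the infinite sum over rho pass inside.\<close>
    have "(\<Sum>lam\<in>row_supp rho. K rho lam * ?Y lam nu) = (\<Sum>lam\<in>?C. K rho lam * ?Y lam nu)"
      by (rule phas_sum_unique[OF phas_sum_row[OF rho] phas_sum_column[OF nu]])
    with phas_sum_cmult[OF Suc.IH[OF rho nu], of "H mu rho"]
    show "phas_sum (\<lambda>y. case (rho, y) of (rho, lam) \<Rightarrow> H mu rho * (?Y rho lam * K lam nu))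
      (H mu rho * ((\<Sum>lam\<in>?C. K rho lam * ?Y lam nu) + ?w rho)) partitions"
      by (simp del: op_power.simps)
  qed
  moreover have "phas_sum (\<lambda>rho. H mu rho * ((\<Sum>lam\<in>?C. K rho lam * ?Y lam nu) + ?w rho))
    (?t +
      of_nat (Suc (Suc n)) * \<xi> * op_power H (Suc n) mu nu) partitions"
  proof -
    have "phas_sum (\<lambda>rho. (\<Sum>lam\<in>?C. (H mu rho * K rho lam) * ?Y lam nu) +
        of_nat (Suc n) * \<xi> * (H mu rho * op_power H n rho nu))
      ((\<Sum>lam\<in>?C. ((\<Sum>rho\<in>row_supp mu. K mu rho * H rho lam) + \<xi> * kron mu lam) * ?Y lam nu) +
        of_nat (Suc n) * \<xi> * ?Y mu nu) partitions"
      by (intro phas_sum_add phas_sum_sum phas_sum_cmult_right phas_sum_cmult H_K_commute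
          op_power_H_Suc mu nu C)
    moreover have "(\<lambda>rho. H mu rho * ((\<Sum>lam\<in>?C. K rho lam * ?Y lam nu) + ?w rho)) =
        (\<lambda>rho. (\<Sum>lam\<in>?C. (H mu rho * K rho lam) * ?Y lam nu) +
        of_nat (Suc n) * \<xi> * (H mu rho * op_power H n rho nu))"
      by (simp add: distrib_left sum_distrib_left mult_ac del: op_power.simps of_nat_Suc)
    moreover have "(\<Sum>lam\<in>?C. ((\<Sum>rho\<in>row_supp mu. K mu rho * H rho lam) + \<xi> * kron mu lam) * ?Y lam nu) =
        ?t + \<xi> * ?Y mu nu"
    proof -
      have "(\<Sum>lam\<in>?C. (\<Sum>rho\<in>row_supp mu. K mu rho * H rho lam) * ?Y lam nu) =
          (\<Sum>rho\<in>row_supp mu. K mu rho * (\<Sum>lam\<in>?C. H rho lam * ?Y lam nu))"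
        by (simp only: sum_distrib_left sum_distrib_right mult.assoc) (rule sum.swap)
      also have "\<dots> = ?t"
        by (simp only: op_power_H_Suc_sum[OF nu, of "Suc n"])
      moreover have "(\<Sum>lam\<in>?C. \<xi> * kron mu lam * ?Y lam nu) = \<xi> * ?Y mu nu"
      proof -
        have "(\<Sum>lam\<in>?C. \<xi> * kron mu lam * ?Y lam nu) = (\<Sum>lam\<in>?C. if lam = mu then \<xi> * ?Y mu nu else 0)"
          by (rule sum.cong) (auto simp: kron_def simp del: op_power.simps)
        also have "\<dots> = \<xi> * ?Y mu nu"
          using finite_col_supp[OF nu, of "Suc n"] mu
          by (auto simp: col_supp_def simp del: op_power.simps)
        finally show ?thesis .
      qed
      ultimately show ?thesis by (simp add: distrib_right sum.distrib del: op_power.simps)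
    qed
    ultimately show ?thesis by (simp add: algebra_simps del: op_power.simps)
  qed
  ultimately have "s = ?t +
      of_nat (Suc (Suc n)) * \<xi> * op_power H (Suc n) mu nu"
    by (rule phas_sum_unique)
  with left show ?case by simp
qed

section \<open>Reordering of divided powers\<close>

definition "H_div n mu nu = pconst (1 / fact n) * op_power H n mu nu"
definition "K_div n mu nu = pconst (1 / fact n) * op_power K n mu nu"
definition "xi_div j = pconst (1 / fact j) * \<xi> ^ j"

definition "KH_div a b mu nu = (\<Sum>lam\<in>col_supp b nu. K_div a mu lam * H_div b lam nu)"

lemma H_div_0: "H_div 0 mu nu = kron mu nu" and K_div_0: "K_div 0 mu nu = kron mu nu" and xi_div_0: "xi_div 0 = 1"
  by (simp_all add: H_div_def K_div_def xi_div_def kron_def)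

lemma phas_sum_kron_left:
  assumes "mu \<in> partitions" shows "phas_sum (\<lambda>lam. kron mu lam * f lam) (f mu) partitions"
proof -
  have "phas_sum (\<lambda>lam. kron mu lam * f lam) (\<Sum>lam\<in>{mu}. kron mu lam * f lam) partitions"
    by (rule phas_sum_finite) (use assms in \<open>auto simp: kron_def\<close>)
  then show ?thesis by (simp add: kron_def)
qed

lemma phas_sum_kron_right:
  assumes "nu \<in> partitions" shows "phas_sum (\<lambda>lam. f lam * kron lam nu) (f nu) partitions"
proof -
  have "phas_sum (\<lambda>lam. f lam * kron lam nu) (\<Sum>lam\<in>{nu}. f lam * kron lam nu) partitions"
    by (rule phas_sum_finite) (use assms in \<open>auto simp: kron_def\<close>)
  then show ?thesis by (simp add: kron_def)
qed

lemma phas_sum_KH_div: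
  assumes "nu \<in> partitions"
  shows "phas_sum (\<lambda>lam. K_div a mu lam * H_div b lam nu) (KH_div a b mu nu) partitions"
  unfolding KH_div_def
  by (rule phas_sum_finite[OF finite_col_supp[OF assms]]) (auto simp: col_supp_def H_div_def)

lemma KH_div_0_left: "mu \<in> partitions \<Longrightarrow> nu \<in> partitions \<Longrightarrow> KH_div 0 b mu nu = H_div b mu nu"
  using phas_sum_KH_div[of nu 0 mu b] phas_sum_kron_left[of mu "\<lambda>lam. H_div b lam nu"]
  unfolding K_div_0 by (auto intro: phas_sum_unique)

lemma KH_div_0_right: "nu \<in> partitions \<Longrightarrow> KH_div a 0 mu nu = K_div a mu nu"
  using phas_sum_KH_div[of nu a mu 0] phas_sum_kron_right[of nu "\<lambda>lam. K_div a mu lam"]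
  unfolding H_div_0 by (auto intro: phas_sum_unique)

lemma pconst_fact_Suc: "pconst (1 / fact n) = of_nat (Suc n) * (pconst (1 / fact (Suc n)) :: 'a pser)"
  by (simp add: pconst_of_nat[symmetric] pconst_mult del: of_nat_Suc)

lemma K_div_Suc:
  "mu \<in> partitions \<Longrightarrow> (\<Sum>rho\<in>row_supp mu. K mu rho * K_div n rho nu) = of_nat (Suc n) * K_div (Suc n) mu nu"
  by (simp add: K_div_def op_power_K_Suc_sum pconst_fact_Suc[of n] sum_distrib_left mult_ac
      del: op_power.simps of_nat_Suc fact_Suc)

lemma KH_div_Suc:
  assumes "mu \<in> partitions"
  shows "(\<Sum>rho\<in>row_supp mu. K mu rho * KH_div a b rho nu) = of_nat (Suc a) * KH_div (Suc a) b mu nu"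
proof -
  have "(\<Sum>rho\<in>row_supp mu. K mu rho * KH_div a b rho nu) =
      (\<Sum>lam\<in>col_supp b nu. (\<Sum>rho\<in>row_supp mu. K mu rho * K_div a rho lam) * H_div b lam nu)"
    unfolding KH_div_def sum_distrib_left sum_distrib_right mult.assoc by (rule sum.swap)
  also have "\<dots> = of_nat (Suc a) * KH_div (Suc a) b mu nu"
    unfolding K_div_Suc[OF assms] KH_div_def sum_distrib_left mult.assoc ..
  finally show ?thesis .
qed

lemma xi_div_Suc: "\<xi> * xi_div j = of_nat (Suc j) * xi_div (Suc j)"
  unfolding xi_div_def pconst_fact_Suc[of j] power_Suc by (simp only: mult_ac)

lemma H_div_K:
  assumes "mu \<in> partitions" "nu \<in> partitions"
  shows "phas_sum (\<lambda>lam. H_div (Suc n) mu lam * K lam nu)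
    ((\<Sum>rho\<in>row_supp mu. K mu rho * H_div (Suc n) rho nu) + \<xi> * H_div n mu nu) partitions"
proof -
  have "pconst (1 / fact (Suc n)) * ((\<Sum>rho\<in>row_supp mu. K mu rho * op_power H (Suc n) rho nu) +
      of_nat (Suc n) * \<xi> * op_power H n mu nu) =
      (\<Sum>rho\<in>row_supp mu. K mu rho * H_div (Suc n) rho nu) + \<xi> * H_div n mu nu"
    unfolding H_div_def pconst_fact_Suc[of n] distrib_left sum_distrib_left by (simp only: mult_ac)
  with phas_sum_cmult[OF op_power_H_K[OF assms, of n], of "pconst (1 / fact (Suc n))"]
  show ?thesis by (simp only: H_div_def mult.assoc)
qed

text \<open>Both sums are iterated forms of one unconditional double sum for H^(n+1), K and K^m. The
  case m = 0 is separate because the blocks of a cut word must be nonempty.\<close>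

lemma H_div_K_assoc:
  assumes mu: "mu \<in> partitions" and nu: "nu \<in> partitions"
  shows "\<exists>s. phas_sum (\<lambda>rho. H_div (Suc n) mu rho * (of_nat (Suc m) * K_div (Suc m) rho nu)) s partitions \<and>
    phas_sum (\<lambda>lam. ((\<Sum>rho\<in>row_supp mu. K mu rho * H_div (Suc n) rho lam) + \<xi> * H_div n mu lam) * K_div m lam nu)
      s partitions"
proof -
  let ?r = "\<lambda>lam. (\<Sum>rho\<in>row_supp mu. K mu rho * H_div (Suc n) rho lam) + \<xi> * H_div n mu lam"
  show ?thesis
  proof (cases m)
    case 0
    have "phas_sum (\<lambda>rho. H_div (Suc n) mu rho * K rho nu)
        ((\<Sum>rho\<in>row_supp mu. K mu rho * H_div (Suc n) rho nu) + \<xi> * H_div n mu nu) partitions"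
      by (rule H_div_K[OF mu nu])
    moreover have "of_nat (Suc m) * K_div (Suc m) rho nu = K rho nu" for rho
      using op_power_one[OF nu, of K rho] by (simp add: K_div_def 0 del: op_power.simps)
    ultimately show ?thesis
      using phas_sum_kron_right[OF nu, of "?r"]
      unfolding 0 K_div_0 by auto
  next
    case (Suc m')
    then have m: "m \<ge> 1" "Suc n \<ge> 1" by auto
    have ord: "ordered_word (us @ vs @ ws)" if "set us \<subseteq> low" "set vs \<subseteq> up" "set ws \<subseteq> up" for us vs ws
      using ordered_wordI[of us "vs @ ws"] that by simp
    have "\<exists>s. phas_sum (\<lambda>(lam, rho). op_power H (Suc n) mu lam * (K lam rho * op_power K m rho nu)) s (partitions \<times> partitions)"
      by (rule word_op_product3[OF word_ops(1)[OF m(2)] word_ops(4)[OF order_refl] word_ops(2)[OF m(1)] _ _ _ ord mu nu])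
        (use m in simp_all)
    then obtain s0 where "phas_sum (\<lambda>(lam, rho). op_power H (Suc n) mu lam * (K lam rho * op_power K m rho nu)) s0 (partitions \<times> partitions)"
      by blast
    from phas_sum_cmult[OF this, of "pconst (1 / fact (Suc n)) * pconst (1 / fact m)"]
    have "phas_sum (\<lambda>x. (\<lambda>(lam, rho). H_div (Suc n) mu lam * (K lam rho * K_div m rho nu)) x)
        (pconst (1 / fact (Suc n)) * pconst (1 / fact m) * s0) (partitions \<times> partitions)"
      unfolding H_div_def K_div_def case_prod_unfold by (simp only: mult_ac)
    then obtain s where s: "phas_sum (\<lambda>(lam, rho). H_div (Suc n) mu lam * (K lam rho * K_div m rho nu)) s (partitions \<times> partitions)"
      by blast
    have "phas_sum (\<lambda>rho. H_div (Suc n) mu rho * (of_nat (Suc m) * K_div (Suc m) rho nu)) s partitions"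
    proof (rule phas_sum_Sigma[OF s])
      fix lam assume lam: "lam \<in> partitions"
      from phas_sum_cmult[OF phas_sum_row[OF lam, of "\<lambda>rho. K_div m rho nu"], of "H_div (Suc n) mu lam"]
      show "phas_sum (\<lambda>y. case (lam, y) of (lam, rho) \<Rightarrow> H_div (Suc n) mu lam * (K lam rho * K_div m rho nu))
          (H_div (Suc n) mu lam * (of_nat (Suc m) * K_div (Suc m) lam nu)) partitions"
        by (simp only: K_div_Suc[OF lam] prod.case)
    qed
    moreover have "phas_sum (\<lambda>lam. ?r lam * K_div m lam nu)
        s partitions"
    proof (rule phas_sum_Sigma[OF phas_sum_swap[OF s]])
      fix lam assume lam: "lam \<in> partitions"
      from phas_sum_cmult_right[OF H_div_K[OF mu lam, of n], of "K_div m lam nu"]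
      show "phas_sum (\<lambda>y. case (lam, y) of (x, y) \<Rightarrow> case (y, x) of (lam, rho) \<Rightarrow> H_div (Suc n) mu lam * (K lam rho * K_div m rho nu))
          (?r lam * K_div m lam nu) partitions"
        by (simp only: mult.assoc prod.case)
    qed
    ultimately show ?thesis by blast
  qed
qed

text \<open>Induction on m: attach one more K. The term with \<xi>^j arises in two ways, with weight
  m + 1 - j from K meeting K^(m-j) and weight j from a new factor \<xi>; together they give the
  factor m + 1 that divided powers require.\<close>

lemma H_div_K_div:
  assumes "mu \<in> partitions" "nu \<in> partitions"
  shows "phas_sum (\<lambda>lam. H_div n mu lam * K_div m lam nu)
    (\<Sum>j\<le>m. if j \<le> n then xi_div j * KH_div (m - j) (n - j) mu nu else 0) partitions"
  using assms
proof (induction m arbitrary: n mu nu)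
  case 0
  then show ?case
    using phas_sum_kron_right[of nu "\<lambda>lam. H_div n mu lam"] by (simp add: K_div_0 xi_div_0 KH_div_0_left)
next
  case (Suc m)
  note mu = Suc.prems(1) and nu = Suc.prems(2)
  let ?t = "\<lambda>j. if j \<le> n then xi_div j * KH_div (Suc m - j) (n - j) mu nu else 0"
  show ?case
  proof (cases n)
    case 0
    have "(\<Sum>j\<le>Suc m. ?t j) = (\<Sum>j\<le>Suc m. if j = 0 then K_div (Suc m) mu nu else 0)"
      by (rule sum.cong) (auto simp: 0 xi_div_0 KH_div_0_right nu)
    then show ?thesis
      using phas_sum_kron_left[OF mu, of "\<lambda>lam. K_div (Suc m) lam nu"] by (simp add: 0 H_div_0)
  next
    case (Suc n')
    obtain s where s: "phas_sum (\<lambda>rho. H_div n mu rho * (of_nat (Suc m) * K_div (Suc m) rho nu)) s partitions"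
      "phas_sum (\<lambda>lam. ((\<Sum>rho\<in>row_supp mu. K mu rho * H_div n rho lam) + \<xi> * H_div n' mu lam) * K_div m lam nu) s partitions"
      using H_div_K_assoc[OF mu nu] Suc by blast
    let ?A = "\<Sum>rho\<in>row_supp mu. K mu rho * (\<Sum>j\<le>m. if j \<le> n then xi_div j * KH_div (m - j) (n - j) rho nu else 0)"
    let ?B = "\<xi> * (\<Sum>j\<le>m. if j \<le> n' then xi_div j * KH_div (m - j) (n' - j) mu nu else 0)"
    have "phas_sum (\<lambda>lam. (\<Sum>rho\<in>row_supp mu. K mu rho * (H_div n rho lam * K_div m lam nu)) + \<xi> * (H_div n' mu lam * K_div m lam nu))
      (?A +
       ?B) partitions"
      by (intro phas_sum_add phas_sum_sum phas_sum_cmult Suc.IH mu nu row_supp_partitions)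
    then have "s = ?A +
       ?B"
      by (intro phas_sum_unique[OF s(2)]) (simp add: distrib_right sum_distrib_right mult.assoc)
    also have "?A =
        (\<Sum>j\<le>m. if j \<le> n then xi_div j * (\<Sum>rho\<in>row_supp mu. K mu rho * KH_div (m - j) (n - j) rho nu) else 0)"
      unfolding sum_distrib_left by (subst sum.swap) (auto intro!: sum.cong simp: mult.left_commute sum_distrib_left)
    also have "\<dots> = (\<Sum>j\<le>m. of_nat (Suc m - j) * ?t j)"
      by (rule sum.cong) (auto simp: KH_div_Suc[OF mu] Suc_diff_le mult.left_commute simp del: of_nat_Suc)
    \<comment> \<open>The added term j = m + 1 has weight 0, as has the term j = 0 added to the
      other sum, so both run over the same range.\<close>
    also have "\<dots> = (\<Sum>j\<le>Suc m. of_nat (Suc m - j) * ?t j)" by simp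
    also have "?B =
        (\<Sum>j\<le>m. of_nat (Suc j) * ?t (Suc j))"
      unfolding sum_distrib_left
      by (rule sum.cong) (auto simp: Suc mult.assoc[symmetric] xi_div_Suc simp del: of_nat_Suc)
    also have "\<dots> = (\<Sum>j\<le>Suc m. of_nat j * ?t j)" by (subst sum.atMost_Suc_shift) simp
    also have "(\<Sum>j\<le>Suc m. of_nat (Suc m - j) * ?t j) + (\<Sum>j\<le>Suc m. of_nat j * ?t j) = of_nat (Suc m) * (\<Sum>j\<le>Suc m. ?t j)"
      unfolding sum.distrib[symmetric] sum_distrib_left
    proof (rule sum.cong[OF refl])
      fix j assume "j \<in> {..Suc m}"
      then have "of_nat (Suc m) = of_nat (Suc m - j) + (of_nat j :: 'v pser)"
        by (simp flip: of_nat_add)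
      then show "of_nat (Suc m - j) * ?t j + of_nat j * ?t j = of_nat (Suc m) * ?t j"
        by (simp only: distrib_right)
    qed
    finally have seq: "s = of_nat (Suc m) * (\<Sum>j\<le>Suc m. ?t j)" .
    have inv: "pconst (1 / of_nat (Suc m)) * (of_nat (Suc m) * f) = f" for f :: "'v pser"
      by (simp add: pconst_of_nat[symmetric] pconst_mult mult.assoc[symmetric] del: of_nat_Suc)
    from phas_sum_cmult[OF s(1), of "pconst (1 / of_nat (Suc m))"]
    show ?thesis unfolding seq inv mult.left_commute[of _ "H_div n mu _"] .
  qed
qed

section \<open>Comparison of the exponentials degree by degree\<close>

lemma homogeneous_kron: "homogeneous 0 (kron mu nu)"
  by (simp add: kron_def homogeneous_1)

lemma homogeneous_linear: "homogeneous 1 (linear_op T S mu nu)"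
  by (auto simp: homogeneous_def linear_op_def elim: sum.not_neutral_contains_not_neutral)

lemma homogeneous_H: "nu \<in> partitions \<Longrightarrow> homogeneous n (op_power H n mu nu)"
proof (induction n arbitrary: mu)
  case 0
  show ?case using homogeneous_kron[of mu nu] by (simp add: kron_def)
next
  case (Suc n)
  have "homogeneous (1 + n) (op_power H (Suc n) mu nu)"
    by (rule homogeneous_phas_sum[OF op_power_H_Suc[OF Suc.prems]])
      (unfold H_def, intro homogeneous_mult homogeneous_linear Suc.IH[unfolded H_def] Suc.prems)
  then show ?case by simp
qed

lemma homogeneous_K: "mu \<in> partitions \<Longrightarrow> homogeneous n (op_power K n mu nu)"
proof (induction n arbitrary: mu)
  case 0
  show ?case using homogeneous_kron[of mu nu] by (simp add: kron_def)
next
  case (Suc n)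
  have "homogeneous (1 + n) (op_power K (Suc n) mu nu)"
    by (rule homogeneous_phas_sum[OF op_power_K_Suc[OF Suc.prems]])
      (unfold K_def, intro homogeneous_mult homogeneous_linear Suc.IH[unfolded K_def])
  then show ?case by simp
qed

lemma homogeneous_\<xi>: "homogeneous 2 \<xi>"
  by (auto simp: homogeneous_def \<xi> elim!: sum.not_neutral_contains_not_neutral)

lemma graded_exp_H: "nu \<in> partitions \<Longrightarrow> graded (op_exp H mu nu) (\<lambda>n. H_div n mu nu)"
  unfolding op_exp_def H_div_def by (intro graded_pinfsum homogeneous_const_mult homogeneous_H)

lemma graded_exp_K: "mu \<in> partitions \<Longrightarrow> graded (op_exp K mu nu) (\<lambda>n. K_div n mu nu)"
  unfolding op_exp_def K_div_def by (intro graded_pinfsum homogeneous_const_mult homogeneous_K)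

text \<open>In degree N, e^H e^K is a sum of products of divided powers, which
  \<open>H_div_K_div\<close> reorders. As \<xi> has degree 2, a term with \<xi>^j leaves degree N -
  2j for the powers of K and H, so the comparison is a finite re-indexing.\<close>

theorem exp_commute:
  assumes mu: "mu \<in> partitions" and nu: "nu \<in> partitions"
  shows "\<exists>g. phas_sum (\<lambda>lam. op_exp K mu lam * op_exp H lam nu) g partitions \<and>
    phas_sum (\<lambda>lam. op_exp H mu lam * op_exp K lam nu) (pexp \<xi> * g) partitions"
proof -
  let ?L = "\<lambda>N. \<Sum>a\<le>N. \<Sum>j\<le>N - a. if j \<le> a then xi_div j * KH_div (N - a - j) (a - j) mu nu else 0"
  let ?G = "\<lambda>N. \<Sum>a\<le>N. KH_div a (N - a) mu nu"
  let ?R = "\<lambda>N. \<Sum>e\<le>N. (if even e then xi_div (e div 2) else 0) * (\<Sum>a\<le>N - e. KH_div a (N - e - a) mu nu)"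
  have "\<exists>g. phas_sum (\<lambda>lam. op_exp K mu lam * op_exp H lam nu) g partitions \<and>
      graded g ?G"
    by (rule graded_phas_sum[where g = "\<lambda>N lam. \<Sum>a\<le>N. K_div a mu lam * H_div (N - a) lam nu"])
      (intro graded_mult graded_exp_K[OF mu] graded_exp_H[OF nu] phas_sum_sum phas_sum_KH_div[OF nu])+
  then obtain g where g: "phas_sum (\<lambda>lam. op_exp K mu lam * op_exp H lam nu) g partitions"
    "graded g ?G" by blast
  have "\<exists>f. phas_sum (\<lambda>lam. op_exp H mu lam * op_exp K lam nu) f partitions \<and>
      graded f ?L"
  proof (rule graded_phas_sum[where g = "\<lambda>N lam. \<Sum>a\<le>N. H_div a mu lam * K_div (N - a) lam nu"])
    fix lam assume "lam \<in> partitions"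
    then show "graded (op_exp H mu lam * op_exp K lam nu) (\<lambda>N. \<Sum>a\<le>N. H_div a mu lam * K_div (N - a) lam nu)"
      by (intro graded_mult graded_exp_K graded_exp_H)
  next
    fix N
    show "phas_sum (\<lambda>lam. \<Sum>a\<le>N. H_div a mu lam * K_div (N - a) lam nu)
        (?L N) partitions"
      by (rule phas_sum_sum) (rule H_div_K_div[OF mu nu])
  qed
  then obtain f where f: "phas_sum (\<lambda>lam. op_exp H mu lam * op_exp K lam nu) f partitions"
    "graded f ?L" by blast
  have "graded (pexp \<xi> * g) ?R"
    unfolding xi_div_def by (rule graded_mult[OF graded_pexp[OF homogeneous_\<xi>] g(2)])
  also have "?R =
      ?L"
  proof
    fix N
    have "(?R N) =
        (\<Sum>(e, a)\<in>(SIGMA e:{..N}. {..N - e}). if even e then xi_div (e div 2) * KH_div a (N - e - a) mu nu else 0)"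
      by (subst sum.Sigma[symmetric]) (auto simp: sum_distrib_left intro!: sum.cong)
    also have "\<dots> = (\<Sum>(e, a)\<in>{(e, a). even e \<and> e + a \<le> N}. xi_div (e div 2) * KH_div a (N - e - a) mu nu)"
      by (rule sum.mono_neutral_cong_right) (auto split: if_splits)
    also have "\<dots> = (\<Sum>(j, a)\<in>{(j, a). 2 * j + a \<le> N}. xi_div j * KH_div a (N - 2 * j - a) mu nu)"
      by (rule sum.reindex_bij_witness[of _ "\<lambda>(j, a). (2 * j, a)" "\<lambda>(e, a). (e div 2, a)"]) auto
    also have "\<dots> = (\<Sum>(a, j)\<in>{(a, j). a + j \<le> N \<and> j \<le> a}. xi_div j * KH_div (N - a - j) (a - j) mu nu)"
    \<comment> \<open>On the left a is the power of K after reordering, on the right the power of H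
      before it; with j contractions each is N - j minus the other.\<close>
    proof (rule sum.reindex_bij_witness[of _ "\<lambda>(a, j). (j, N - a - j)" "\<lambda>(j, a). (N - a - j, j)"])
      fix x assume "x \<in> {(j, a). 2 * j + a \<le> N}"
      then obtain j a where x: "x = (j, a)" "2 * j + a \<le> N" by auto
      then have "N - (N - a - j) - j = a" "N - a - j - j = N - 2 * j - a" by auto
      with x show "(case case x of (j, a) \<Rightarrow> (N - a - j, j) of (a, j) \<Rightarrow> xi_div j * KH_div (N - a - j) (a - j) mu nu) =
          (case x of (j, a) \<Rightarrow> xi_div j * KH_div a (N - 2 * j - a) mu nu)"
        by simp
    qed auto
    also have "\<dots> = (\<Sum>(a, j)\<in>(SIGMA a:{..N}. {..N - a}). if j \<le> a then xi_div j * KH_div (N - a - j) (a - j) mu nu else 0)"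
      by (rule sum.mono_neutral_cong_left) (auto split: if_splits)
    also have "\<dots> = (?L N)"
      by (subst sum.Sigma[symmetric]) auto
    finally show "(?R N) =
        (?L N)" .
  qed
  finally have "pexp \<xi> * g = f"
    by (rule graded_unique) (rule f(2))
  with f(1) g(1) show ?thesis by auto
qed

end

section \<open>The Cauchy identity\<close>

definition letter_idx :: "nat + nat \<Rightarrow> int"
  where "letter_idx v = (case v of Inl k \<Rightarrow> int k | Inr k \<Rightarrow> - int k)"

text \<open>The factors 1/k of the Hamiltonians; c rescales the second set of indeterminates and is
  later 1 or -1.\<close>

definition letter_weight :: "complex \<Rightarrow> nat + nat \<Rightarrow> complex"
  where "letter_weight c v = (case v of Inl k \<Rightarrow> 1 / of_nat k | Inr k \<Rightarrow> c / of_nat k)"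

definition letter :: "(int \<Rightarrow> complex) \<Rightarrow> (int \<Rightarrow> complex) \<Rightarrow> complex \<Rightarrow> nat + nat \<Rightarrow>
    (nat \<Rightarrow> nat) \<Rightarrow> (nat \<Rightarrow> nat) \<Rightarrow> complex"
  where "letter \<alpha> \<beta> c v mu nu = letter_weight c v * current \<alpha> \<beta> (letter_idx v) mu nu"

text \<open>For matching letters this is (1/k)(c/k)k = c/k, the coefficient of the product of the
  k-th indeterminates in c \<xi>.\<close>

definition letter_cocycle :: "complex \<Rightarrow> nat + nat \<Rightarrow> nat + nat \<Rightarrow> complex"
  where "letter_cocycle c v w = (if letter_idx v = - letter_idx w
    then letter_weight c v * letter_weight c w * of_int (letter_idx v) else 0)"

lemma pcoeff_pvar: "pcoeff (pvar v) M = (if M = {#v#} then 1 else 0)"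
  by (simp add: pvar_def)

lemma pcoeff_pvar_mult: "pcoeff (pvar v * pvar w) M = (if M = {#v, w#} then 1 else 0)"
proof -
  have pair: "{#v#} \<subseteq># M \<and> M - {#v#} = {#w#} \<longleftrightarrow> M = {#v, w#}"
  proof
    assume "{#v#} \<subseteq># M \<and> M - {#v#} = {#w#}"
    then show "M = {#v, w#}" by (metis insert_DiffM single_subset_iff)
  qed simp
  have "pcoeff (pvar v * pvar w) M = (\<Sum>A | A \<subseteq># M. if A = {#v#} then (if M - {#v#} = {#w#} then 1 else 0) else 0)"
    unfolding pcoeff_mult by (rule sum.cong) (auto simp: pcoeff_pvar)
  also have "\<dots> = (if {#v#} \<subseteq># M \<and> M - {#v#} = {#w#} then 1 else 0)"
    by (simp add: finite_submultisets)
  also have "\<dots> = (if M = {#v, w#} then 1 else 0)"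
    by (simp only: pair)
  finally show ?thesis .
qed

lemma infsum_finite_support:
  assumes "finite B" "B \<subseteq> A" "\<And>x. x \<in> A - B \<Longrightarrow> f x = 0"
  shows "infsum f A = sum f B"
  using has_sum_finite_neutralI[OF assms refl] by (rule infsumI)

lemma ham_plus_linear: "ham_plus \<alpha> \<beta> P = linear_op (letter \<alpha> \<beta> c) (Inl ` {1..})"
proof (intro ext pser_eqI)
  fix mu nu and M :: "(nat + nat) multiset"
  let ?f = "\<lambda>k. current \<alpha> \<beta> (int k) mu nu / of_nat k * (if M = {#Inl k#} then 1 else 0)"
  have fin: "finite {k. k \<ge> 1 \<and> M = {#Inl k#}}"
    by (rule finite_subset[of _ "Inl -` set_mset M"]) (auto intro: finite_vimageI)
  have "pcoeff (ham_plus \<alpha> \<beta> P mu nu) M = infsum ?f {1..}"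
    by (simp add: ham_plus_def pinfsum_def P_def pcoeff_pvar)
  also have "\<dots> = sum ?f {k. k \<ge> 1 \<and> M = {#Inl k#}}"
    by (rule infsum_finite_support[OF fin]) auto
  also have "\<dots> = (\<Sum>v | v \<in> Inl ` {1..} \<and> M = {#v#}. letter \<alpha> \<beta> c v mu nu)"
    by (rule sum.reindex_bij_witness[of _ projl Inl]) (auto simp: letter_def letter_weight_def letter_idx_def)
  finally show "pcoeff (ham_plus \<alpha> \<beta> P mu nu) M = pcoeff (linear_op (letter \<alpha> \<beta> c) (Inl ` {1..}) mu nu) M"
    by (simp add: linear_op_def)
qed

lemma ham_minus_linear:
  "ham_minus \<alpha> \<beta> (\<lambda>k. pconst c * P' k) = linear_op (letter \<alpha> \<beta> c) (Inr ` {1..})"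
proof (intro ext pser_eqI)
  fix mu nu and M :: "(nat + nat) multiset"
  let ?f = "\<lambda>k. current \<alpha> \<beta> (- int k) mu nu / of_nat k * (c * (if M = {#Inr k#} then 1 else 0))"
  have fin: "finite {k. k \<ge> 1 \<and> M = {#Inr k#}}"
    by (rule finite_subset[of _ "Inr -` set_mset M"]) (auto intro: finite_vimageI)
  have "pcoeff (ham_minus \<alpha> \<beta> (\<lambda>k. pconst c * P' k) mu nu) M = infsum ?f {1..}"
    by (simp add: ham_minus_def pinfsum_def P'_def pcoeff_pvar)
  also have "\<dots> = sum ?f {k. k \<ge> 1 \<and> M = {#Inr k#}}"
    by (rule infsum_finite_support[OF fin]) auto
  also have "\<dots> = (\<Sum>v | v \<in> Inr ` {1..} \<and> M = {#v#}. letter \<alpha> \<beta> c v mu nu)"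
    by (rule sum.reindex_bij_witness[of _ projr Inr]) (auto simp: letter_def letter_weight_def letter_idx_def)
  finally show "pcoeff (ham_minus \<alpha> \<beta> (\<lambda>k. pconst c * P' k) mu nu) M =
      pcoeff (linear_op (letter \<alpha> \<beta> c) (Inr ` {1..}) mu nu) M"
    by (simp add: linear_op_def)
qed

lemma pcoeff_xi:
  "pcoeff (pconst c * xi P P') M =
    (\<Sum>(v, w) | v \<in> Inl ` {1..} \<and> w \<in> Inr ` {1..} \<and> M = {#v, w#}. letter_cocycle c v w)"
proof -
  let ?f = "\<lambda>k. 1 / of_nat k * (if M = {#Inl k, Inr k#} then 1 else 0)"
  have fin: "finite {k. k \<ge> 1 \<and> M = {#Inl k, Inr k#}}"
    by (rule finite_subset[of _ "Inl -` set_mset M"]) (auto intro: finite_vimageI)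
  have fin2: "finite {(v, w). v \<in> Inl ` {1..} \<and> w \<in> Inr ` {1..} \<and> M = {#v, w#}}"
    by (rule finite_subset[of _ "set_mset M \<times> set_mset M"]) auto
  have "pcoeff (pconst c * xi P P') M = c * infsum ?f {1..}"
    by (simp add: xi_def pinfsum_def P_def P'_def pcoeff_pvar_mult mult.assoc)
  also have "infsum ?f {1..} = sum ?f {k. k \<ge> 1 \<and> M = {#Inl k, Inr k#}}"
    by (rule infsum_finite_support[OF fin]) auto
  also have "c * \<dots> = (\<Sum>k | k \<ge> 1 \<and> M = {#Inl k, Inr k#}. c / of_nat k)"
    unfolding sum_distrib_left by (rule sum.cong) auto
  also have "\<dots> = (\<Sum>(v, w) | v \<in> Inl ` {1..} \<and> w \<in> Inr ` {1..} \<and> M = {#v, w#} \<and> projl v = projr w. letter_cocycle c v w)"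
    by (rule sum.reindex_bij_witness[of _ "\<lambda>(v, w). projl v" "\<lambda>k. (Inl k, Inr k)"])
      (auto simp: letter_cocycle_def letter_weight_def letter_idx_def)
  also have "\<dots> = (\<Sum>(v, w) | v \<in> Inl ` {1..} \<and> w \<in> Inr ` {1..} \<and> M = {#v, w#}. letter_cocycle c v w)"
    by (rule sum.mono_neutral_left[OF fin2]) (auto simp: letter_cocycle_def letter_idx_def split: if_splits)
  finally show ?thesis .
qed

lemma chain_weight_letter:
  "chain_weight (letter \<alpha> \<beta> c) us mu rhos nu =
    (\<Prod>t<length us. letter_weight c (us ! t)) * path_weight \<alpha> \<beta> (map letter_idx us) mu rhos nu"
  by (simp add: chain_weight_def path_weight_def letter_def prod.distrib)

text \<open>The weights are constants: they rescale the commutator of two currents, and they pull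
  out of every chain sum, which reduces \<open>converge\<close> to
  \<open>current_products_converge\<close>.\<close>

lemma letter_ops_current:
  assumes vac: "vacuum_formulas \<alpha> \<beta>" and conv: "current_products_converge \<alpha> \<beta>"
  shows "letter_ops (letter \<alpha> \<beta> c) (Inl ` {1..}) (Inr ` {1..}) (letter_cocycle c) (pconst c * xi P P')"
proof -
  let ?T = "letter \<alpha> \<beta> c"
  show ?thesis
  proof
    fix nu :: "nat \<Rightarrow> nat" assume nu: "nu \<in> partitions"
    show "finite {mu \<in> partitions. \<exists>v\<in>Inl ` {1..}. ?T v mu nu \<noteq> 0}"
    proof (rule finite_subset[OF _ deformation.finite_current_plus[OF nu, of \<alpha> \<beta>]], clarify)
      fix mu k assume "1 \<le> k" "?T (Inl k) mu nu \<noteq> 0"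
      then show "\<exists>k\<ge>1. current \<alpha> \<beta> (int k) mu nu \<noteq> 0"
        by (intro exI[of _ k]) (simp add: letter_def letter_idx_def)
    qed
  next
    fix mu :: "nat \<Rightarrow> nat" assume mu: "mu \<in> partitions"
    show "finite {nu \<in> partitions. \<exists>w\<in>Inr ` {1..}. ?T w mu nu \<noteq> 0}"
    proof (rule finite_subset[OF _ deformation.finite_current_minus[OF mu, of \<alpha> \<beta>]], clarify)
      fix nu k assume "1 \<le> k" "?T (Inr k) mu nu \<noteq> 0"
      then show "\<exists>k\<ge>1. current \<alpha> \<beta> (- int k) mu nu \<noteq> 0"
        by (intro exI[of _ k]) (simp add: letter_def letter_idx_def)
    qed
  next
    fix mu nu :: "nat \<Rightarrow> nat" and v w :: "nat + nat"
    assume mu: "mu \<in> partitions" and nu: "nu \<in> partitions" and v: "v \<in> Inl ` {1..}" and w: "w \<in> Inr ` {1..}"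
    obtain k l where kl: "v = Inl k" "k \<ge> 1" "w = Inr l" "l \<ge> 1" using v w by auto
    obtain s where s:
      "((\<lambda>rho. current \<alpha> \<beta> (- int l) mu rho * current \<alpha> \<beta> (int k) rho nu) has_sum s) partitions"
      "((\<lambda>rho. current \<alpha> \<beta> (int k) mu rho * current \<alpha> \<beta> (- int l) rho nu) has_sum
        s + (if k = l \<and> mu = nu then of_nat k else 0)) partitions"
      using deformation.current_commutator[OF vac mu nu kl(2,4)] by blast
    let ?c = "letter_weight c v * letter_weight c w"
    have "((\<lambda>rho. ?T w mu rho * ?T v rho nu) has_sum ?c * s) partitions"
      using has_sum_cmult_right[OF s(1), of ?c] by (simp add: letter_def kl letter_idx_def mult_ac)
    moreover have "((\<lambda>rho. ?T v mu rho * ?T w rho nu) has_sum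
        ?c * (s + (if k = l \<and> mu = nu then of_nat k else 0))) partitions"
      using has_sum_cmult_right[OF s(2), of ?c] by (simp add: letter_def kl letter_idx_def mult_ac)
    moreover have "?c * (s + (if k = l \<and> mu = nu then of_nat k else 0)) =
        ?c * s + (if mu = nu then letter_cocycle c v w else 0)"
      by (simp add: letter_cocycle_def kl letter_idx_def distrib_left)
    ultimately show "\<exists>s. ((\<lambda>rho. ?T w mu rho * ?T v rho nu) has_sum s) partitions \<and>
        ((\<lambda>rho. ?T v mu rho * ?T w rho nu) has_sum
          s + (if mu = nu then letter_cocycle c v w else 0)) partitions"
      by auto
  next
    fix mu nu :: "nat \<Rightarrow> nat" and us ws :: "(nat + nat) list"
    assume mu: "mu \<in> partitions" and nu: "nu \<in> partitions" and us: "us \<in> lists (Inl ` {1..})"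
      and ws: "ws \<in> lists (Inr ` {1..})" and ne: "us @ ws \<noteq> []"
    let ?ks = "map letter_idx us" and ?ls = "map letter_idx ws"
    have "\<forall>k\<in>set ?ks. k > 0" "\<forall>l\<in>set ?ls. l < 0" using us ws by (auto simp: letter_idx_def)
    then have "(\<lambda>rhos. path_weight \<alpha> \<beta> (?ks @ ?ls) mu rhos nu) summable_on
        {rhos. set rhos \<subseteq> partitions \<and> Suc (length rhos) = length (?ks @ ?ls)}"
      using conv mu nu unfolding current_products_converge_def by blast
    moreover have "length us + length ws \<noteq> 0" using ne by simp
    then have "{rhos. set rhos \<subseteq> partitions \<and> Suc (length rhos) = length (?ks @ ?ls)} =
        pchains (length (us @ ws) - 1)"
      by (auto simp: pchains_def)
    ultimately show "(\<lambda>rhos. chain_weight ?T (us @ ws) mu rhos nu) summable_on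
        pchains (length (us @ ws) - 1)"
      unfolding chain_weight_letter map_append by (intro summable_on_cmult_right) simp
  qed (rule pcoeff_xi)
qed

lemma cauchy_identity:
  fixes c :: complex
  assumes "vacuum_formulas \<alpha> \<beta>" "current_products_converge \<alpha> \<beta>"
    and mu: "mu \<in> partitions" and nu: "nu \<in> partitions"
  defines "q \<equiv> \<lambda>k. pconst c * P' k"
  shows "psummable (\<lambda>lam. schur \<alpha> \<beta> lam mu P * schur_hat \<alpha> \<beta> lam nu q) partitions \<and>
    psummable (\<lambda>lam. schur_hat \<alpha> \<beta> mu lam q * schur \<alpha> \<beta> nu lam P) partitions \<and>
    pinfsum (\<lambda>lam. schur \<alpha> \<beta> lam mu P * schur_hat \<alpha> \<beta> lam nu q) partitions =
      pexp (pconst c * xi P P') * pinfsum (\<lambda>lam. schur_hat \<alpha> \<beta> mu lam q * schur \<alpha> \<beta> nu lam P) partitions"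
proof -
  interpret letter_ops "letter \<alpha> \<beta> c" "Inl ` {1..}" "Inr ` {1..}" "letter_cocycle c" "pconst c * xi P P'"
    by (rule letter_ops_current[OF assms(1,2)])
  have "ham_plus \<alpha> \<beta> P = H" "ham_minus \<alpha> \<beta> q = K"
    by (simp_all only: ham_plus_linear[of \<alpha> \<beta> c] ham_minus_linear H_def K_def q_def)
  with exp_commute[OF mu nu] show ?thesis
    unfolding schur_def schur_hat_def by (auto dest: phas_sum_pinfsum phas_sum_psummable)
qed

theorem theorem5p27:
  fixes \<alpha> \<beta> :: "int \<Rightarrow> complex" and \<mu> \<nu> :: "nat \<Rightarrow> nat"
  assumes "vacuum_formulas \<alpha> \<beta>" and "current_products_converge \<alpha> \<beta>"
    and "\<mu> \<in> partitions" and "\<nu> \<in> partitions"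
  shows
    "(psummable (\<lambda>lam. schur \<alpha> \<beta> lam \<mu> P * schur_hat \<alpha> \<beta> lam \<nu> P') partitions \<and>
      psummable (\<lambda>lam. schur_hat \<alpha> \<beta> \<mu> lam P' * schur \<alpha> \<beta> \<nu> lam P) partitions \<and>
      pinfsum (\<lambda>lam. schur \<alpha> \<beta> lam \<mu> P * schur_hat \<alpha> \<beta> lam \<nu> P') partitions =
        pexp (xi P P') *
          pinfsum (\<lambda>lam. schur_hat \<alpha> \<beta> \<mu> lam P' * schur \<alpha> \<beta> \<nu> lam P) partitions) \<and>
     (psummable (\<lambda>lam. schur \<alpha> \<beta> lam \<mu> P * schur_hat \<alpha> \<beta> lam \<nu> (\<lambda>k. - P' k)) partitions \<and>
      psummable (\<lambda>lam. schur_hat \<alpha> \<beta> \<mu> lam (\<lambda>k. - P' k) * schur \<alpha> \<beta> \<nu> lam P) partitions \<and>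
      pinfsum (\<lambda>lam. schur \<alpha> \<beta> lam \<mu> P * schur_hat \<alpha> \<beta> lam \<nu> (\<lambda>k. - P' k)) partitions =
        pexp (- xi P P') *
          pinfsum (\<lambda>lam. schur_hat \<alpha> \<beta> \<mu> lam (\<lambda>k. - P' k) * schur \<alpha> \<beta> \<nu> lam P) partitions)"
proof -
  have "pconst (- 1) * f = - f" for f :: "(nat + nat) pser"
    by (rule pser_eqI) simp
  then show ?thesis
    using cauchy_identity[OF assms, of 1] cauchy_identity[OF assms, of "- 1"] by simp
qed

end
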